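(* Let $d\ge2$, and let $m\ge0$ and $j$ be integers with $|j|\ge m/(d-1)$. Then there exist a positive number $\varepsilon_0$ and a constant $C$, both independent of $j,m$, such that $$\|\mathcal B_{j,m}(f,g)\|_{L^1}\le C\max\Big\{2^{\frac{m-(d-1)|j|}{3}},\,2^{-\varepsilon_0 m}\Big\}\|f\|_{L^2}\|g\|_{L^2}$$ for all $f,g\in L^2(\mathbb R)$.
   Context: $\rho_1$ is a fixed smooth function supported on $[1/2,2]$, and $\rho(t)=\rho_1(t)$ for $t>0$, $\rho(t)=-\rho_1(-t)$ for $t<0$. $\Theta$ is a Schwartz function supported in $(-1,1)$ with $\Theta=1$ on $[-1/2,1/2]$; $\Phi$ is the Schwartz function with $\widehat\Phi(\xi)=\Theta(\xi/2)-\Theta(\xi)$. $R_\Phi f$ is defined by $\widehat{R_\Phi f}=\widehat f\,\widehat\Phi$ (Fourier transform $\widehat f(\xi)=\int f(x)e^{-2\pi ix\xi}dx$). The bilinear operator $\mathcal B_{j,m}$ is $$\mathcal B_{j,m}(f,g)(x)=2^{-(d-1)j/2}\int R_\Phi f(2^{-(d-1)j}x-2^mt)\,R_\Phi g(x-2^mt^d)\rho(t)\,dt\quad (j\ge0),$$ $$\mathcal B_{j,m}(f,g)(x)=2^{(d-1)j/2}\int R_\Phi f(x-2^mt)\,R_\Phi g(2^{(d-1)j}x-2^mt^d)\rho(t)\,dt\quad (j<0).$$ *)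

theory Defs
  imports "HOL-Analysis.Analysis"
begin

definition smooth_fun :: "(real \<Rightarrow> real) \<Rightarrow> bool" where
  "smooth_fun h \<longleftrightarrow> (\<forall>k x. ((deriv ^^ k) h) differentiable (at x))"

definition supp_fun :: "(real \<Rightarrow> real) \<Rightarrow> real set" where
  "supp_fun h = closure {x. h x \<noteq> 0}"

definition rho_of :: "(real \<Rightarrow> real) \<Rightarrow> real \<Rightarrow> real" where
  "rho_of \<rho>1 t = (if t > 0 then \<rho>1 t else if t < 0 then - \<rho>1 (- t) else 0)"

text \<open>Phi: the function whose Fourier transform is Theta(xi/2) - Theta(xi), given by the
  inverse Fourier integral (convention hat f(xi) = int f(x) e^{-2 pi i x xi} dx).\<close>
definition Phi_of :: "(real \<Rightarrow> real) \<Rightarrow> real \<Rightarrow> complex" where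
  "Phi_of \<Theta> x = (LINT \<xi>|lborel. complex_of_real (\<Theta> (\<xi> / 2) - \<Theta> \<xi>) * cis (2 * pi * x * \<xi>))"

text \<open>R_Phi f, i.e. the Fourier multiplier with symbol hat Phi, written as the convolution f * Phi.\<close>
definition R_Phi :: "(real \<Rightarrow> real) \<Rightarrow> (real \<Rightarrow> complex) \<Rightarrow> real \<Rightarrow> complex" where
  "R_Phi \<Theta> f x = (LINT y|lborel. f y * Phi_of \<Theta> (x - y))"

definition B_op :: "nat \<Rightarrow> (real \<Rightarrow> real) \<Rightarrow> (real \<Rightarrow> real) \<Rightarrow> int \<Rightarrow> nat
      \<Rightarrow> (real \<Rightarrow> complex) \<Rightarrow> (real \<Rightarrow> complex) \<Rightarrow> real \<Rightarrow> complex" where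
  "B_op d \<rho>1 \<Theta> j m f g x =
     (if j \<ge> 0 then
        complex_of_real (2 powr (- (real d - 1) * real_of_int j / 2)) *
        (LINT t|lborel. R_Phi \<Theta> f (2 powr (- (real d - 1) * real_of_int j) * x - 2 ^ m * t) *
                         R_Phi \<Theta> g (x - 2 ^ m * t ^ d) * complex_of_real (rho_of \<rho>1 t))
      else
        complex_of_real (2 powr ((real d - 1) * real_of_int j / 2)) *
        (LINT t|lborel. R_Phi \<Theta> f (x - 2 ^ m * t) *
                         R_Phi \<Theta> g (2 powr ((real d - 1) * real_of_int j) * x - 2 ^ m * t ^ d) *
                         complex_of_real (rho_of \<rho>1 t)))"

definition in_L2 :: "(real \<Rightarrow> complex) \<Rightarrow> bool" where
  "in_L2 f \<longleftrightarrow> f \<in> borel_measurable lborel \<and> (\<integral>\<^sup>+ x. ennreal (norm (f x) ^ 2) \<partial>lborel) < \<infinity>"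

definition L2_norm :: "(real \<Rightarrow> complex) \<Rightarrow> real" where
  "L2_norm f = sqrt (LINT x|lborel. norm (f x) ^ 2)"

definition L1_norm :: "(real \<Rightarrow> complex) \<Rightarrow> ennreal" where
  "L1_norm f = (\<integral>\<^sup>+ x. ennreal (norm (f x)) \<partial>lborel)"

end

theory Submission
  imports Defs "HOL-Probability.Probability"
begin

text \<open>Put \<open>N = 2\<^sup>m\<close> and let \<open>A \<le> 1/N\<close> be the small dilation factor. Splitting by the sign of \<open>t\<close>, and
  substituting \<open>s = t\<^sup>d\<close> if \<open>j < 0\<close>, both cases become
  \<open>sqrt A \<integral> P (A x - N s) Q (x - N \<gamma>(s)) \<psi>(s) ds\<close> with \<open>\<gamma>(s) = \<plusminus> s\<^sup>a\<close>, \<open>a \<noteq> 1\<close>. Since \<open>P\<close> and \<open>Q\<close> have their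
  frequencies in an annulus, \<open>P'\<close> and a primitive \<open>H\<close> of \<open>Q\<close> are bounded in \<open>L\<^sup>2\<close> as well.
  On the cell \<open>n \<le> A x < n + 1\<close> the argument \<open>A x\<close> may be frozen to \<open>u = n + v\<close>, \<open>0 \<le> v \<le> 1\<close>, at the cost of
  \<open>P'\<close>, and \<open>Q\<close> may be localised to \<open>\<bar>A y - u\<bar> \<le> L\<close>. In the variable \<open>x\<close> the frozen form is the Fourier multiplier
  \<open>M\<^sub>u(\<xi>) = \<integral> P (u - N s) e\<^sup>-\<^sup>i\<^sup>\<xi>\<^sup>N\<^sup>\<gamma>\<^sup>(\<^sup>s\<^sup>) \<psi>(s) ds\<close> applied to the localised \<open>Q\<close>. For \<open>\<bar>\<xi>\<bar> \<ge> N\<^sup>-\<^sup>1\<^sup>/\<^sup>2\<close> the large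
  sieve, with van der Corput's estimate for the inner products of the kernels, bounds
  \<open>\<Sum>\<^sub>n sup \<bar>M\<^sub>n\<bar>\<^sup>2\<close> by \<open>N\<^sup>-\<^sup>1\<^sup>/\<^sup>4 \<parallel>P\<parallel>\<^sup>2\<close>, while for smaller \<open>\<bar>\<xi>\<bar>\<close> writing \<open>Q = H'\<close> gains the factor \<open>\<bar>\<xi>\<bar>\<close>.
  Plancherel and Cauchy-Schwarz over the cells then give the decay \<open>N\<^sup>-\<^sup>1\<^sup>/\<^sup>8\<close>, that is \<open>\<epsilon>0 = 1/8\<close>.\<close>

section \<open>Plancherel's theorem for continuous functions of compact support\<close>

text \<open>The condition |j| >= m/(d-1) says that A N <= 1. Within a cell of length 1/A the curve
  moves by at most R N, hence by a fixed multiple of the cell length, so a windowed cell meets only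
  boundedly many others. The obstacle is that every cell may have its own worst frequency. The
  kernels compared by the large sieve therefore carry unrelated frequencies, and the oscillation
  estimate has to be uniform in one of them, with a decay that sees only the other one times the
  shift. This is possible because, for a \<noteq> 1 and a nonzero shift r, the ratio of the slopes
  of the curve at s + r and at s is strictly monotone in s. Oscillation gives nothing near \<xi> =
  0; there the vanishing of the symbol of \<open>R_Phi\<close> near frequency 0 takes over, through
  the primitive H. Passing from L^2 to L^1 on a cell costs A^(-1/2), which is what the normalising
  factor sqrt A pays for.\<close>

lemma integrable_continuous_compact_support:
  fixes f :: "'a::euclidean_space \<Rightarrow> 'b::{banach,second_countable_topology}"
  assumes "continuous_on UNIV f" "compact S" "\<And>x. x \<notin> S \<Longrightarrow> f x = 0"
  shows "integrable lborel f"
proof -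
  have "integrable lborel (\<lambda>x. indicator S x *\<^sub>R f x)"
    using assms(1) by (intro borel_integrable_compact assms) (rule continuous_on_subset, auto)
  also have "(\<lambda>x. indicator S x *\<^sub>R f x) = f"
    using assms(3) by (auto simp: indicator_def fun_eq_iff)
  finally show ?thesis .
qed

text \<open>This class contains the windowed functions and the symbol of \<open>R_Phi\<close>, so
  that Plancherel's identity and integration by parts have to be proved for it alone.\<close>

definition test_fun :: "(real \<Rightarrow> complex) \<Rightarrow> bool" where
  "test_fun h \<longleftrightarrow> continuous_on UNIV h \<and> (\<exists>K. \<forall>x. h x \<noteq> 0 \<longrightarrow> \<bar>x\<bar> \<le> K)"

lemma test_funE:
  assumes "test_fun h"
  obtains K where "K > 0" "\<And>x. \<bar>x\<bar> > K \<Longrightarrow> h x = 0"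
proof -
  from assms obtain K where "\<forall>x. h x \<noteq> 0 \<longrightarrow> \<bar>x\<bar> \<le> K" by (auto simp: test_fun_def)
  thus ?thesis by (intro that[of "max K 1"]) force+
qed

lemma test_fun_continuous: "test_fun h \<Longrightarrow> continuous_on UNIV h"
  by (simp add: test_fun_def)

lemma test_fun_compose_continuous:
  "test_fun h \<Longrightarrow> continuous_on S f \<Longrightarrow> continuous_on S (\<lambda>x. h (f x))"
  by (rule continuous_on_compose2[OF test_fun_continuous]) auto

lemma test_fun_measurable: "test_fun h \<Longrightarrow> h \<in> borel_measurable borel"
  by (simp add: test_fun_def borel_measurable_continuous_onI)

lemma test_fun_mult:
  assumes "test_fun h" "continuous_on UNIV g"
  shows "test_fun (\<lambda>x. g x * h x)"
proof -
  have "continuous_on UNIV (\<lambda>x. g x * h x)"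
    using assms by (intro continuous_intros) (auto simp: test_fun_def)
  thus ?thesis using assms(1) by (auto simp: test_fun_def)
qed

lemma test_fun_integrable:
  assumes "test_fun h"
  shows "integrable lborel h"
proof -
  obtain K where "\<And>x. \<bar>x\<bar> > K \<Longrightarrow> h x = 0" using test_funE[OF assms] by metis
  thus ?thesis
    by (intro integrable_continuous_compact_support[of h "{-K..K}"] test_fun_continuous assms) auto
qed

lemma test_fun_square_integrable:
  assumes "test_fun h"
  shows "integrable lborel (\<lambda>x. (norm (h x))\<^sup>2)"
proof -
  obtain K where "\<And>x. \<bar>x\<bar> > K \<Longrightarrow> h x = 0" using test_funE[OF assms] by metis
  thus ?thesis
    by (intro integrable_continuous_compact_support[of _ "{-K..K}"] continuous_intros
      test_fun_continuous[OF assms]) auto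
qed

lemma test_fun_bounded:
  assumes "test_fun h"
  obtains B where "B > 0" "\<And>x. norm (h x) \<le> B"
proof -
  obtain K where K: "K > 0" "\<And>x. \<bar>x\<bar> > K \<Longrightarrow> h x = 0" using test_funE[OF assms] by metis
  have "compact (h ` {-K..K})"
    by (intro compact_continuous_image continuous_on_subset[OF test_fun_continuous[OF assms]]) auto
  then obtain B where B: "B > 0" "\<And>x. x \<in> {-K..K} \<Longrightarrow> norm (h x) \<le> B"
    by (metis bounded_pos compact_imp_bounded image_eqI)
  show ?thesis
  proof (rule that[OF B(1)])
    fix x show "norm (h x) \<le> B"
    proof (cases "\<bar>x\<bar> > K")
      case True thus ?thesis using K(2)[of x] B(1) by simp
    next
      case False
      hence "x \<in> {-K..K}" by auto
      thus ?thesis by (rule B(2))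
    qed
  qed
qed

text \<open>Angular frequency, without 2 pi in the exponent: differentiation becomes multiplication
  by \<open>\<i> * \<xi>\<close>, at the price of a factor 2 pi in Plancherel's identity.\<close>

definition fourier :: "(real \<Rightarrow> complex) \<Rightarrow> real \<Rightarrow> complex" where
  "fourier h \<xi> = (LINT x|lborel. h x * cis (- x * \<xi>))"

lemma measurable_fourier [measurable]:
  assumes [measurable]: "h \<in> borel_measurable borel"
  shows "fourier h \<in> borel_measurable borel"
  unfolding fourier_def[abs_def] cis_conv_exp by measurable

lemma continuous_on_cis_compose [continuous_intros]:
  "continuous_on S f \<Longrightarrow> continuous_on S (\<lambda>x. cis (f x))"
  unfolding cis_conv_exp by (intro continuous_intros)

lemma borel_measurable_cnj [measurable (raw)]:
  assumes [measurable]: "f \<in> borel_measurable M"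
  shows "(\<lambda>x. cnj (f x)) \<in> borel_measurable M"
  using measurable_compose[OF assms borel_measurable_continuous_onI[of cnj]]
  by (simp add: continuous_on_cnj)

text \<open>The convolution of \<open>h\<close> with its conjugate reflection. Its transform is
  |fourier h|^2 and its value at 0 is the squared norm of \<open>h\<close>, so Plancherel's identity
  is Fourier inversion for this function at the single point 0.\<close>

definition autocorr :: "(real \<Rightarrow> complex) \<Rightarrow> real \<Rightarrow> complex" where
  "autocorr h t = (LINT x|lborel. h x * cnj (h (x - t)))"

lemma measurable_autocorr [measurable]:
  assumes [measurable]: "h \<in> borel_measurable borel"
  shows "autocorr h \<in> borel_measurable borel"
  unfolding autocorr_def[abs_def] by measurable

lemma
  assumes h: "test_fun h"
  shows integrable_autocorr: "integrable lborel (autocorr h)"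
    and fourier_autocorr: "fourier (autocorr h) \<xi> = of_real ((norm (fourier h \<xi>))\<^sup>2)"
proof -
  obtain K where K: "K > 0" "\<And>x. \<bar>x\<bar> > K \<Longrightarrow> h x = 0" using test_funE[OF h] by metis
  have int: "integrable (lborel \<Otimes>\<^sub>M lborel) (\<lambda>(t,x). h x * cnj (h (x - t)) * cis (- t * \<xi>))" for \<xi>
    unfolding lborel_prod
  proof (rule integrable_continuous_compact_support[where S="{-2*K..2*K} \<times> {-K..K}"])
    fix z :: "real \<times> real" assume z: "z \<notin> {-2*K..2*K} \<times> {-K..K}"
    obtain t x where [simp]: "z = (t,x)" by force
    from z have "\<bar>x\<bar> > K \<or> \<bar>x - t\<bar> > K" by auto
    thus "(case z of (t,x) \<Rightarrow> h x * cnj (h (x - t)) * cis (- t * \<xi>)) = 0" using K(2) by auto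
  qed (auto simp: case_prod_beta intro!: continuous_intros compact_Times test_fun_compose_continuous[OF h])
  from lborel_pair.integrable_fst'[OF int[of 0]] show "integrable lborel (autocorr h)"
    by (simp add: autocorr_def[abs_def])
  have "fourier (autocorr h) \<xi> = (LINT t|lborel. LINT x|lborel. h x * cnj (h (x - t)) * cis (- t * \<xi>))"
    by (simp add: fourier_def autocorr_def)
  also have "\<dots> = (LINT x|lborel. LINT t|lborel. h x * cnj (h (x - t)) * cis (- t * \<xi>))"
    using lborel_pair.Fubini_integral[OF int[of \<xi>]] by simp
  also have "\<dots> = (LINT x|lborel. h x * cis (-x * \<xi>) * cnj (fourier h \<xi>))"
  proof (rule Bochner_Integration.integral_cong[OF refl])
    fix x
    have "(LINT t|lborel. h x * cnj (h (x - t)) * cis (- t * \<xi>)) =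
        (LINT y|lborel. h x * cnj (h y) * cis (- (x - y) * \<xi>))"
      by (subst lborel_integral_real_affine[where c="-1" and t=x]) auto
    also have "\<dots> = (LINT y|lborel. h x * cis (-x*\<xi>) * cnj (h y * cis (- y * \<xi>)))"
    proof (rule Bochner_Integration.integral_cong[OF refl])
      fix y
      have "cis (- (x - y) * \<xi>) = cis (-x*\<xi>) * cnj (cis (-y*\<xi>))"
        by (simp add: cis_cnj cis_mult algebra_simps)
      thus "h x * cnj (h y) * cis (- (x - y) * \<xi>) = h x * cis (-x*\<xi>) * cnj (h y * cis (- y * \<xi>))"
        by simp
    qed
    also have "\<dots> = h x * cis (-x * \<xi>) * cnj (fourier h \<xi>)"
      unfolding fourier_def by (subst Bochner_Integration.integral_cnj[symmetric]) simp
    finally show "(LINT t|lborel. h x * cnj (h (x - t)) * cis (- t * \<xi>)) = h x * cis (-x * \<xi>) * cnj (fourier h \<xi>)" .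
  qed
  also have "\<dots> = fourier h \<xi> * cnj (fourier h \<xi>)"
    by (simp add: fourier_def)
  finally show "fourier (autocorr h) \<xi> = of_real ((norm (fourier h \<xi>))\<^sup>2)"
    by (simp only: complex_norm_square)
qed

lemma integral_cis_std_normal:
  "(LINT x|lborel. of_real (std_normal_density x) * cis (t * x)) = of_real (exp (- t\<^sup>2 / 2))"
proof -
  have "char std_normal_distribution t = (LINT x|lborel. of_real (std_normal_density x) * cis (t * x))"
    unfolding char_def
    by (subst integral_density) (auto simp: scaleR_conv_of_real cis_conv_exp)
  thus ?thesis using char_std_normal_distribution by (simp add: fun_eq_iff)
qed

lemma fourier_gauss:
  assumes "\<epsilon> > 0"
  shows "(LINT x|lborel. of_real (std_normal_density (\<epsilon> * x)) * cis (- (t * x)))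
     = of_real (exp (- (t/\<epsilon>)\<^sup>2 / 2) / \<epsilon>)"
proof -
  have "of_real (exp (- (-t/\<epsilon>)\<^sup>2 / 2)) =
    (LINT x|lborel. of_real (std_normal_density x) * cis ((-t/\<epsilon>) * x))"
    by (rule integral_cis_std_normal[symmetric])
  also have "\<dots> = \<epsilon> *\<^sub>R (LINT x|lborel. of_real (std_normal_density (\<epsilon> * x)) * cis (- (t * x)))"
    using assms by (subst lborel_integral_real_affine[where c="\<epsilon>" and t=0]) auto
  finally show ?thesis using assms by (simp add: scaleR_conv_of_real field_simps)
qed

text \<open>Continuity of the autocorrelation at 0, put sequentially because it feeds dominated
  convergence.\<close>

lemma autocorr_tendsto:
  assumes h: "test_fun h" and s: "s \<longlonglongrightarrow> 0"
  shows "(\<lambda>k. autocorr h (s k)) \<longlonglongrightarrow> of_real (LINT x|lborel. (norm (h x))\<^sup>2)"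
proof -
  obtain B where B: "B > 0" "\<And>x. norm (h x) \<le> B" using test_fun_bounded[OF h] by metis
  have [measurable]: "h \<in> borel_measurable borel" by (rule test_fun_measurable[OF h])
  have "(\<lambda>k. autocorr h (s k)) \<longlonglongrightarrow> (LINT x|lborel. h x * cnj (h x))"
    unfolding autocorr_def
  proof (rule integral_dominated_convergence[where w="\<lambda>x. norm (h x) * B"])
    show "integrable lborel (\<lambda>x. norm (h x) * B)" using test_fun_integrable[OF h] by simp
    have "(\<lambda>k. h x * cnj (h (x - s k))) \<longlonglongrightarrow> h x * cnj (h (x - 0))" for x
    proof -
      have "isCont h (x - 0)" using h by (simp add: test_fun_def continuous_on_eq_continuous_at)
      then have "(\<lambda>k. h (x - s k)) \<longlonglongrightarrow> h (x - 0)"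
        by (rule isCont_tendsto_compose) (intro tendsto_intros s)
      thus ?thesis by (intro tendsto_intros)
    qed
    thus "AE x in lborel. (\<lambda>k. h x * cnj (h (x - s k))) \<longlonglongrightarrow> h x * cnj (h x)" by simp
    show "AE x in lborel. norm (h x * cnj (h (x - s k))) \<le> norm (h x) * B" for k
      using B(2) by (auto simp: norm_mult intro!: mult_left_mono)
  qed auto
  also have "(LINT x|lborel. h x * cnj (h x)) = of_real (LINT x|lborel. (norm (h x))\<^sup>2)"
    by (simp only: complex_norm_square[symmetric] integral_complex_of_real)
  finally show ?thesis .
qed

lemma norm_autocorr_le:
  assumes h: "test_fun h"
  obtains B where "\<And>t. norm (autocorr h t) \<le> B"
proof -
  obtain B where B: "B > 0" "\<And>x. norm (h x) \<le> B" using test_fun_bounded[OF h] by metis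
  have [measurable]: "h \<in> borel_measurable borel" by (rule test_fun_measurable[OF h])
  have hB: "integrable lborel (\<lambda>x. norm (h x) * B)" using test_fun_integrable[OF h] by simp
  have le: "norm (h x * cnj (h (x - t))) \<le> norm (h x) * B" for x t
    using B(2) by (simp add: norm_mult mult_left_mono)
  have le': "norm (h x * cnj (h (x - t))) \<le> norm (norm (h x) * B)" for x t
    using le[of x t] B(1) by simp
  have "norm (autocorr h t) \<le> (LINT x|lborel. norm (h x) * B)" for t
    unfolding autocorr_def
    by (rule Bochner_Integration.integral_norm_bound_integral[OF _ hB],
        rule Bochner_Integration.integrable_bound[OF hB])
       (simp_all only: le le' AE_I2, measurable)
  thus ?thesis by (rule that)
qed

text \<open>Fubini moves the transform from \<open>a\<close> to the Gaussian. After rescaling, the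
  Gaussian on the right no longer depends on \<open>\<epsilon>\<close>; only the argument of
  \<open>a\<close> shrinks, which prepares the limit \<open>\<epsilon>\<close> to 0.\<close>

lemma integral_fourier_gauss:
  assumes a: "integrable lborel a" and e: "\<epsilon> > 0"
  shows "(LINT \<xi>|lborel. of_real (std_normal_density (\<epsilon> * \<xi>)) * fourier a \<xi>) =
     (LINT z|lborel. a (\<epsilon> * z) * of_real (exp (- z\<^sup>2 / 2)))"
proof -
  have [measurable]: "a \<in> borel_measurable borel" using a by (auto dest: borel_measurable_integrable)
  have g: "integrable lborel (\<lambda>\<xi>. std_normal_density (\<epsilon> * \<xi>))"
    using lborel_integrable_real_affine[OF integrable_normal_density[of 1 0], of \<epsilon> 0] e by simp
  have int: "integrable (lborel \<Otimes>\<^sub>M lborel)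
     (\<lambda>(\<xi>,x). of_real (std_normal_density (\<epsilon> * \<xi>)) * (a x * cis (- x * \<xi>)))"
  proof (rule lborel_pair.Fubini_integrable)
    show "(\<lambda>(\<xi>,x). of_real (std_normal_density (\<epsilon> * \<xi>)) * (a x * cis (- x * \<xi>))) \<in> borel_measurable (lborel \<Otimes>\<^sub>M lborel)"
      unfolding cis_conv_exp by measurable
    have "integrable lborel (\<lambda>\<xi>. std_normal_density (\<epsilon> * \<xi>) * (LINT x|lborel. norm (a x)))"
      using g by simp
    thus "integrable lborel (\<lambda>\<xi>. LINT x|lborel. norm (case (\<xi>,x) of (\<xi>,x) \<Rightarrow> complex_of_real (std_normal_density (\<epsilon> * \<xi>)) * (a x * cis (- x * \<xi>))))"
      by (simp add: norm_mult)
    have "integrable lborel (\<lambda>x. a x * cis (- (x * \<xi>)))" for \<xi>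
      by (rule Bochner_Integration.integrable_bound[OF a]) (auto simp: norm_mult cis_conv_exp)
    thus "AE \<xi> in lborel. integrable lborel (\<lambda>x. case (\<xi>,x) of (\<xi>,x) \<Rightarrow> complex_of_real (std_normal_density (\<epsilon> * \<xi>)) * (a x * cis (- x * \<xi>)))"
      by (auto intro!: integrable_mult_right)
  qed
  have "(LINT \<xi>|lborel. of_real (std_normal_density (\<epsilon> * \<xi>)) * fourier a \<xi>) =
    (LINT \<xi>|lborel. LINT x|lborel. of_real (std_normal_density (\<epsilon> * \<xi>)) * (a x * cis (- x * \<xi>)))"
    by (simp add: fourier_def)
  also have "\<dots> = (LINT x|lborel. LINT \<xi>|lborel. of_real (std_normal_density (\<epsilon> * \<xi>)) * (a x * cis (- x * \<xi>)))"
    using lborel_pair.Fubini_integral[OF int] by simp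
  also have "\<dots> = (LINT x|lborel. a x * (LINT \<xi>|lborel. of_real (std_normal_density (\<epsilon> * \<xi>)) * cis (- (x * \<xi>))))"
    by (simp add: mult_ac flip: integral_mult_right_zero)
  also have "\<dots> = (LINT x|lborel. a x * of_real (exp (- (x/\<epsilon>)\<^sup>2 / 2) / \<epsilon>))"
    using e by (simp only: fourier_gauss)
  also have "\<dots> = \<epsilon> *\<^sub>R (LINT z|lborel. a (\<epsilon> * z) * of_real (exp (- z\<^sup>2 / 2) / \<epsilon>))"
    using e by (subst lborel_integral_real_affine[where c="\<epsilon>" and t=0]) auto
  also have "\<dots> = (LINT z|lborel. a (\<epsilon> * z) * of_real (exp (- z\<^sup>2 / 2)))"
    using e by (simp add: scaleR_conv_of_real)
  finally show ?thesis .
qed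

text \<open>The right-hand side of the Gaussian formula tends to \<open>autocorr h 0\<close> times
  the integral of exp(-z^2/2), which is sqrt (2 pi).\<close>

lemma plancherel_gauss:
  assumes h: "test_fun h"
  shows "(\<lambda>k. \<integral>\<^sup>+\<xi>. ennreal (std_normal_density (inverse (Suc k) * \<xi>) * (norm (fourier h \<xi>))\<^sup>2) \<partial>lborel)
     \<longlonglongrightarrow> ennreal (sqrt (2*pi) * (LINT x|lborel. (norm (h x))\<^sup>2))"
proof -
  have [measurable]: "h \<in> borel_measurable borel" by (rule test_fun_measurable[OF h])
  define I where "I = (LINT x|lborel. (norm (h x))\<^sup>2)"
  obtain B where B: "\<And>t. norm (autocorr h t) \<le> B" using norm_autocorr_le[OF h] by metis
  have gi: "integrable lborel (\<lambda>z::real. exp (- z\<^sup>2 / 2))"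
    using integrable_mult_right[OF integrable_normal_density[of 1 0], of "sqrt (2*pi)"]
    by (simp add: std_normal_density_def mult.assoc[symmetric])
  have gI: "(LINT z|lborel. exp (- z\<^sup>2 / 2)) = sqrt (2*pi)"
    using integral_normal_density[of 1 0] by (simp add: std_normal_density_def)
  let ?G = "\<lambda>k. LINT z|lborel. autocorr h (inverse (Suc k) * z) * of_real (exp (- z\<^sup>2 / 2))"
  have "?G \<longlonglongrightarrow> (LINT z|lborel. of_real I * complex_of_real (exp (- z\<^sup>2 / 2)))"
  proof (rule integral_dominated_convergence[where w="\<lambda>z. B * exp (- z\<^sup>2 / 2)"])
    show "integrable lborel (\<lambda>z. B * exp (- z\<^sup>2 / 2))" using gi by simp
    show "AE z in lborel. (\<lambda>k. autocorr h (inverse (real (Suc k)) * z) * complex_of_real (exp (- z\<^sup>2 / 2)))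
       \<longlonglongrightarrow> complex_of_real I * complex_of_real (exp (- z\<^sup>2 / 2))"
      unfolding I_def
      using LIMSEQ_inverse_real_of_nat
      by (intro AE_I2 tendsto_mult tendsto_const autocorr_tendsto[OF h] tendsto_mult_left_zero)
    show "AE z in lborel. norm (autocorr h (inverse (real (Suc k)) * z) * complex_of_real (exp (- z\<^sup>2 / 2))) \<le> B * exp (- z\<^sup>2 / 2)" for k
      using B by (auto simp: norm_mult)
  qed auto
  also have "(LINT z|lborel. of_real I * complex_of_real (exp (- z\<^sup>2 / 2))) = of_real (sqrt (2*pi) * I)"
    using gI by simp
  finally have lim: "?G \<longlonglongrightarrow> of_real (sqrt (2*pi) * I)" .
  have eq: "?G k = of_real (LINT \<xi>|lborel. std_normal_density (inverse (Suc k) * \<xi>) * (norm (fourier h \<xi>))\<^sup>2)" for k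
  proof -
    have "?G k = (LINT \<xi>|lborel. of_real (std_normal_density (inverse (Suc k) * \<xi>)) * fourier (autocorr h) \<xi>)"
      by (rule integral_fourier_gauss[OF integrable_autocorr[OF h], symmetric]) simp
    also have "\<dots> = (LINT \<xi>|lborel. complex_of_real (std_normal_density (inverse (Suc k) * \<xi>) * (norm (fourier h \<xi>))\<^sup>2))"
      by (simp add: fourier_autocorr[OF h])
    finally show ?thesis by (simp only: integral_complex_of_real)
  qed
  have "(\<lambda>k. Re (?G k)) \<longlonglongrightarrow> Re (of_real (sqrt (2*pi) * I))"
    by (intro tendsto_Re lim)
  hence "(\<lambda>k. LINT \<xi>|lborel. std_normal_density (inverse (Suc k) * \<xi>) * (norm (fourier h \<xi>))\<^sup>2) \<longlonglongrightarrow> sqrt (2*pi) * I"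
    by (simp only: eq Re_complex_of_real)
  hence "(\<lambda>k. ennreal (LINT \<xi>|lborel. std_normal_density (inverse (Suc k) * \<xi>) * (norm (fourier h \<xi>))\<^sup>2)) \<longlonglongrightarrow> ennreal (sqrt (2*pi) * I)"
    by (rule tendsto_ennrealI)
  also have "(\<lambda>k. ennreal (LINT \<xi>|lborel. std_normal_density (inverse (Suc k) * \<xi>) * (norm (fourier h \<xi>))\<^sup>2)) =
    (\<lambda>k. \<integral>\<^sup>+\<xi>. ennreal (std_normal_density (inverse (Suc k) * \<xi>) * (norm (fourier h \<xi>))\<^sup>2) \<partial>lborel)"
  proof
    fix k
    have hi: "integrable lborel h" by (rule test_fun_integrable[OF h])
    define J where "J = (LINT x|lborel. norm (h x))"
    have fb: "norm (fourier h \<xi>) \<le> J" for \<xi>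
      unfolding fourier_def J_def
      by (rule order.trans[OF integral_norm_bound]) (simp add: norm_mult)
    have g: "integrable lborel (\<lambda>\<xi>. std_normal_density (inverse (Suc k) * \<xi>))"
      using lborel_integrable_real_affine[OF integrable_normal_density[of 1 0], of "inverse (Suc k)" 0] by simp
    have "integrable lborel (\<lambda>\<xi>. std_normal_density (inverse (Suc k) * \<xi>) * (norm (fourier h \<xi>))\<^sup>2)"
      by (rule Bochner_Integration.integrable_bound[OF integrable_mult_left[OF g, of "J\<^sup>2"]])
         (auto simp: norm_mult fb intro!: mult_left_mono power_mono)
    thus "ennreal (LINT \<xi>|lborel. std_normal_density (inverse (Suc k) * \<xi>) * (norm (fourier h \<xi>))\<^sup>2) =
      (\<integral>\<^sup>+\<xi>. ennreal (std_normal_density (inverse (Suc k) * \<xi>) * (norm (fourier h \<xi>))\<^sup>2) \<partial>lborel)"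
      by (intro nn_integral_eq_integral[symmetric]) auto
  qed
  finally show ?thesis by (simp only: I_def)
qed

text \<open>The Gaussian weights increase to the constant \<open>std_normal_density 0\<close>, so
  monotone convergence evaluates the left side without knowing beforehand that
  \<open>fourier h\<close> is square integrable; hence the formulation with a nonnegative
  integral.\<close>

theorem plancherel:
  assumes h: "test_fun h"
  shows "(\<integral>\<^sup>+\<xi>. ennreal ((norm (fourier h \<xi>))\<^sup>2) \<partial>lborel) = ennreal (2 * pi * (LINT x|lborel. (norm (h x))\<^sup>2))"
proof -
  have [measurable]: "h \<in> borel_measurable borel" by (rule test_fun_measurable[OF h])
  let ?g = "\<lambda>k \<xi>. ennreal (std_normal_density (inverse (Suc k) * \<xi>) * (norm (fourier h \<xi>))\<^sup>2)"
  have "(\<lambda>k. \<integral>\<^sup>+\<xi>. ?g k \<xi> \<partial>lborel) \<longlonglongrightarrow> (\<integral>\<^sup>+\<xi>. ennreal (std_normal_density 0 * (norm (fourier h \<xi>))\<^sup>2) \<partial>lborel)"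
  proof (rule nn_integral_LIMSEQ)
    show "incseq ?g"
    proof (rule incseq_SucI, rule le_funI, rule ennreal_leI, rule mult_right_mono)
      fix k and \<xi> :: real
      have "\<bar>inverse (real (Suc (Suc k))) * \<xi>\<bar> \<le> \<bar>inverse (real (Suc k)) * \<xi>\<bar>"
        unfolding abs_mult by (intro mult_right_mono) (auto simp: field_simps)
      hence "(inverse (real (Suc (Suc k))) * \<xi>)\<^sup>2 \<le> (inverse (real (Suc k)) * \<xi>)\<^sup>2"
        by (simp only: abs_le_square_iff)
      thus "std_normal_density (inverse (real (Suc k)) * \<xi>) \<le> std_normal_density (inverse (real (Suc (Suc k))) * \<xi>)"
        unfolding std_normal_density_def by (intro mult_left_mono) auto
    qed auto
    fix \<xi>
    have "isCont std_normal_density 0"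
      unfolding std_normal_density_def by (intro continuous_intros) auto
    then have "(\<lambda>k. std_normal_density (inverse (real (Suc k)) * \<xi>)) \<longlonglongrightarrow> std_normal_density 0"
      by (rule isCont_tendsto_compose)
         (intro tendsto_mult_left_zero LIMSEQ_inverse_real_of_nat)
    thus "(\<lambda>k. ?g k \<xi>) \<longlonglongrightarrow> ennreal (std_normal_density 0 * (norm (fourier h \<xi>))\<^sup>2)"
      by (intro tendsto_ennrealI tendsto_intros)
  qed auto
  from LIMSEQ_unique[OF this plancherel_gauss[OF h]]
  have eq: "ennreal (sqrt (2*pi) * (LINT x|lborel. (norm (h x))\<^sup>2)) =
      (\<integral>\<^sup>+\<xi>. ennreal (std_normal_density 0 * (norm (fourier h \<xi>))\<^sup>2) \<partial>lborel)" by simp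
  have "(\<integral>\<^sup>+\<xi>. ennreal ((norm (fourier h \<xi>))\<^sup>2) \<partial>lborel) =
     (\<integral>\<^sup>+\<xi>. ennreal (sqrt (2*pi)) * ennreal (std_normal_density 0 * (norm (fourier h \<xi>))\<^sup>2) \<partial>lborel)"
    by (intro nn_integral_cong) (simp add: std_normal_density_def flip: ennreal_mult)
  also have "\<dots> = ennreal (sqrt (2*pi)) * (\<integral>\<^sup>+\<xi>. ennreal (std_normal_density 0 * (norm (fourier h \<xi>))\<^sup>2) \<partial>lborel)"
    by (rule nn_integral_cmult) measurable
  also have "\<dots> = ennreal (sqrt (2*pi)) * ennreal (sqrt (2*pi) * (LINT x|lborel. (norm (h x))\<^sup>2))"
    by (simp only: eq)
  also have "\<dots> = ennreal (2 * pi * (LINT x|lborel. (norm (h x))\<^sup>2))"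
    by (subst ennreal_mult[symmetric]) (auto simp: mult.assoc[symmetric] simp flip: power2_eq_square)
  finally show ?thesis .
qed


section \<open>The large sieve inequality\<close>

lemma integrable_mult_L2:
  fixes p q :: "real \<Rightarrow> complex"
  assumes [measurable]: "p \<in> borel_measurable borel" "q \<in> borel_measurable borel"
    and p: "integrable lborel (\<lambda>x. (norm (p x))\<^sup>2)" and q: "integrable lborel (\<lambda>x. (norm (q x))\<^sup>2)"
  shows "integrable lborel (\<lambda>x. p x * q x)"
proof (rule Bochner_Integration.integrable_bound[OF Bochner_Integration.integrable_add[OF p q]])
  show "AE x in lborel. norm (p x * q x) \<le> norm ((norm (p x))\<^sup>2 + (norm (q x))\<^sup>2)"
  proof (rule AE_I2)
    fix x
    have "2 * norm (p x) * norm (q x) \<le> (norm (p x))\<^sup>2 + (norm (q x))\<^sup>2"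
      by (rule sum_squares_bound)
    moreover have "0 \<le> norm (p x) * norm (q x)" by simp
    ultimately show "norm (p x * q x) \<le> norm ((norm (p x))\<^sup>2 + (norm (q x))\<^sup>2)"
      unfolding norm_mult real_norm_def by linarith
  qed
qed measurable

text \<open>Schur's test: |c_i c_j| is at most the mean of the two squares, and by the symmetry of
  |g| both halves lead to the same row sums.\<close>

lemma sum_gram_le:
  fixes c :: "'i \<Rightarrow> complex" and g :: "'i \<Rightarrow> 'i \<Rightarrow> complex"
  assumes I: "finite I" and sym: "\<And>i j. norm (g i j) = norm (g j i)"
    and B: "\<And>i. i \<in> I \<Longrightarrow> (\<Sum>j\<in>I. norm (g i j)) \<le> B"
  shows "norm (\<Sum>i\<in>I. \<Sum>j\<in>I. c i * cnj (c j) * g i j) \<le> B * (\<Sum>i\<in>I. (norm (c i))\<^sup>2)"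
proof -
  have "norm (\<Sum>i\<in>I. \<Sum>j\<in>I. c i * cnj (c j) * g i j) \<le> (\<Sum>i\<in>I. \<Sum>j\<in>I. norm (c i * cnj (c j) * g i j))"
    by (intro order.trans[OF norm_sum] sum_mono norm_sum)
  also have "\<dots> \<le> (\<Sum>i\<in>I. \<Sum>j\<in>I. ((norm (c i))\<^sup>2 + (norm (c j))\<^sup>2) / 2 * norm (g i j))"
  proof (intro sum_mono)
    fix i j
    have "2 * norm (c i) * norm (c j) \<le> (norm (c i))\<^sup>2 + (norm (c j))\<^sup>2"
      by (rule sum_squares_bound)
    thus "norm (c i * cnj (c j) * g i j) \<le> ((norm (c i))\<^sup>2 + (norm (c j))\<^sup>2) / 2 * norm (g i j)"
      unfolding norm_mult complex_mod_cnj by (intro mult_right_mono) auto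
  qed
  also have "\<dots> = (\<Sum>i\<in>I. \<Sum>j\<in>I. (norm (c i))\<^sup>2 / 2 * norm (g i j)) + (\<Sum>i\<in>I. \<Sum>j\<in>I. (norm (c j))\<^sup>2 / 2 * norm (g i j))"
    by (simp add: add_divide_distrib ring_distribs sum.distrib)
  also have "(\<Sum>i\<in>I. \<Sum>j\<in>I. (norm (c j))\<^sup>2 / 2 * norm (g i j)) = (\<Sum>i\<in>I. \<Sum>j\<in>I. (norm (c i))\<^sup>2 / 2 * norm (g i j))"
    by (subst sum.swap) (simp add: sym)
  also have "(\<Sum>i\<in>I. \<Sum>j\<in>I. (norm (c i))\<^sup>2 / 2 * norm (g i j)) + (\<Sum>i\<in>I. \<Sum>j\<in>I. (norm (c i))\<^sup>2 / 2 * norm (g i j))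
     = (\<Sum>i\<in>I. (norm (c i))\<^sup>2 * (\<Sum>j\<in>I. norm (g i j)))"
    unfolding sum_distrib_left sum.distrib[symmetric] by (intro sum.cong refl) simp
  also have "\<dots> \<le> (\<Sum>i\<in>I. (norm (c i))\<^sup>2 * B)"
    by (intro sum_mono mult_left_mono B) auto
  finally show ?thesis by (simp only: sum_distrib_left mult.commute[of _ B])
qed

text \<open>Expand \<open>\<integral>\<bar>p - B\<^sup>-\<^sup>1 \<Sum> c\<^sub>i cnj k\<^sub>i\<bar>\<^sup>2 \<ge> 0\<close>, where \<open>c\<^sub>i = \<integral> p k\<^sub>i\<close>.\<close>
lemma large_sieve:
  fixes p :: "real \<Rightarrow> complex" and k :: "'i \<Rightarrow> real \<Rightarrow> complex"
  assumes I: "finite I" and [measurable]: "p \<in> borel_measurable borel"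
    and p: "integrable lborel (\<lambda>x. (norm (p x))\<^sup>2)"
    and k: "\<And>i. test_fun (k i)"
    and B: "B > 0" "\<And>i. i \<in> I \<Longrightarrow> (\<Sum>j\<in>I. norm (LINT x|lborel. k i x * cnj (k j x))) \<le> B"
  shows "(\<Sum>i\<in>I. (norm (LINT x|lborel. p x * k i x))\<^sup>2) \<le> B * (LINT x|lborel. (norm (p x))\<^sup>2)"
proof -
  define c where "c i = (LINT x|lborel. p x * k i x)" for i
  define S where "S = (\<Sum>i\<in>I. (norm (c i))\<^sup>2)"
  define G where "G x = (\<Sum>i\<in>I. c i * cnj (k i x))" for x
  define g where "g i j = (LINT x|lborel. cnj (k i x) * k j x)" for i j
  have [measurable]: "k i \<in> borel_measurable borel" for i by (rule test_fun_measurable[OF k])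
  note ks = test_fun_square_integrable[OF k]
  have kk: "integrable lborel (\<lambda>x. cnj (k i x) * k j x)" for i j
    by (rule integrable_mult_L2) (auto intro: ks)
  have pk: "integrable lborel (\<lambda>x. p x * k i x)" for i
    by (rule integrable_mult_L2) (auto intro: ks p)
  have g_eq: "norm (g i j) = norm (LINT x|lborel. k i x * cnj (k j x))" for i j
  proof -
    have "g i j = cnj (LINT x|lborel. k i x * cnj (k j x))"
      unfolding g_def by (subst Bochner_Integration.integral_cnj[symmetric]) simp
    thus ?thesis by simp
  qed
  have g_sym: "norm (g i j) = norm (g j i)" for i j
    by (subst g_eq) (simp add: g_def mult.commute)
  have pG_eq: "p x * cnj (G x) = (\<Sum>i\<in>I. cnj (c i) * (p x * k i x))" for x
    by (simp add: G_def sum_distrib_left mult_ac)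
  have pG: "integrable lborel (\<lambda>x. p x * cnj (G x))" "(LINT x|lborel. p x * cnj (G x)) = of_real S"
  proof -
    show "integrable lborel (\<lambda>x. p x * cnj (G x))" unfolding pG_eq
      by (intro Bochner_Integration.integrable_sum integrable_mult_right pk)
    have "(LINT x|lborel. p x * cnj (G x)) = (\<Sum>i\<in>I. cnj (c i) * c i)"
      unfolding pG_eq by (subst Bochner_Integration.integral_sum) (auto intro: pk simp: c_def)
    thus "(LINT x|lborel. p x * cnj (G x)) = of_real S"
      by (simp only: S_def of_real_sum complex_norm_square mult.commute)
  qed
  have GG_eq: "G x * cnj (G x) = (\<Sum>i\<in>I. \<Sum>j\<in>I. c i * cnj (c j) * (cnj (k i x) * k j x))" for x
    by (simp add: G_def sum_product mult_ac)
  have GG: "integrable lborel (\<lambda>x. G x * cnj (G x))" "norm (LINT x|lborel. G x * cnj (G x)) \<le> B * S"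
  proof -
    show "integrable lborel (\<lambda>x. G x * cnj (G x))" unfolding GG_eq
      by (intro Bochner_Integration.integrable_sum integrable_mult_right kk)
    have "(LINT x|lborel. G x * cnj (G x)) = (\<Sum>i\<in>I. \<Sum>j\<in>I. c i * cnj (c j) * g i j)"
      unfolding GG_eq g_def
      by (subst Bochner_Integration.integral_sum, intro Bochner_Integration.integrable_sum integrable_mult_right kk)
         (intro sum.cong refl, subst Bochner_Integration.integral_sum, auto intro: kk)
    also have "norm \<dots> \<le> B * S"
      unfolding S_def by (intro sum_gram_le I g_sym) (simp add: g_eq B(2))
    finally show "norm (LINT x|lborel. G x * cnj (G x)) \<le> B * S" .
  qed
  \<comment> \<open>\<open>1 / B\<close> minimises \<open>- 2 * l * S + l\<^sup>2 * (B * S)\<close>,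
    the estimate for the part of the expansion that depends on \<open>l\<close>.\<close>
  define l where "l = inverse B"
  have expand: "(norm (p x - of_real l * G x))\<^sup>2 = (norm (p x))\<^sup>2 - 2 * l * Re (p x * cnj (G x)) + l\<^sup>2 * Re (G x * cnj (G x))" for x
    by (simp only: cmod_power2) (simp add: power2_eq_square algebra_simps)
  have "0 \<le> (LINT x|lborel. (norm (p x - of_real l * G x))\<^sup>2)" by simp
  also have "\<dots> = (LINT x|lborel. (norm (p x))\<^sup>2) - 2 * l * Re (LINT x|lborel. p x * cnj (G x)) + l\<^sup>2 * Re (LINT x|lborel. G x * cnj (G x))"
    unfolding expand using p pG(1) GG(1)
    by (simp add: Bochner_Integration.integral_add Bochner_Integration.integral_diff del: times_complex.sel)
  also have "\<dots> \<le> (LINT x|lborel. (norm (p x))\<^sup>2) - 2 * l * S + l\<^sup>2 * (B * S)"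
    using order.trans[OF complex_Re_le_cmod GG(2)] by (simp add: pG(2) mult_left_mono)
  also have "\<dots> = (LINT x|lborel. (norm (p x))\<^sup>2) - S / B"
    using B(1) by (simp add: l_def field_simps power2_eq_square)
  finally show ?thesis using B(1) by (simp add: S_def c_def field_simps)
qed


section \<open>Van der Corput's estimate for power curves\<close>

text \<open>With \<open>\<delta> = sqrt \<mu>\<close>, multiply the integrand by \<open>1 = w\<^sup>2/(w\<^sup>2 + \<delta>\<^sup>2) + \<delta>\<^sup>2/(w\<^sup>2 + \<delta>\<^sup>2)\<close>: the first
  part cancels the stationary point and is integrated by parts, the second is small; both errors
  are controlled by the total variation of an arctangent.\<close>
lemma van_der_corput:
  fixes \<phi> w w' b \<eta> \<eta>' :: "real \<Rightarrow> real"
  assumes ab: "\<alpha> \<le> \<beta>" and mu: "\<mu> > 0"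
    and d\<phi>: "\<And>x. x \<in> {\<alpha>..\<beta>} \<Longrightarrow> (\<phi> has_real_derivative b x * w x) (at x within {\<alpha>..\<beta>})"
    and dw: "\<And>x. x \<in> {\<alpha>..\<beta>} \<Longrightarrow> (w has_real_derivative w' x) (at x within {\<alpha>..\<beta>})"
    and d\<eta>: "\<And>x. x \<in> {\<alpha>..\<beta>} \<Longrightarrow> (\<eta> has_real_derivative \<eta>' x) (at x within {\<alpha>..\<beta>})"
    and w': "\<And>x. x \<in> {\<alpha>..\<beta>} \<Longrightarrow> \<mu> \<le> w' x"
    and \<eta>': "\<And>x. x \<in> {\<alpha>..\<beta>} \<Longrightarrow> \<bar>\<eta>' x\<bar> \<le> K1"
    and \<eta>: "\<And>x. x \<in> {\<alpha>..\<beta>} \<Longrightarrow> \<bar>\<eta> x\<bar> \<le> K0"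
    and b\<eta>: "\<And>x. x \<in> {\<alpha>..\<beta>} \<Longrightarrow> \<bar>b x * \<eta> x\<bar> \<le> K0"
    and b: "continuous_on {\<alpha>..\<beta>} b"
    and ends: "\<eta> \<alpha> = 0" "\<eta> \<beta> = 0"
  shows "norm (integral {\<alpha>..\<beta>} (\<lambda>x. cis (\<phi> x) * of_real (b x * \<eta> x)))
      \<le> (K1 * (\<beta> - \<alpha>) + 2 * pi * K0) / sqrt \<mu>"
proof -
  define \<delta> where "\<delta> = sqrt \<mu>"
  have \<delta>: "\<delta> > 0" "\<delta>\<^sup>2 = \<mu>" using mu by (auto simp: \<delta>_def)
  define D where "D x = (w x)\<^sup>2 + \<delta>\<^sup>2" for x
  have D: "D x > 0" for x using \<delta> mu by (simp add: D_def add_nonneg_pos)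
  define G where "G x = \<eta> x * w x / D x" for x
  define G' where "G' x = \<eta>' x * w x / D x + \<eta> x * w' x * (\<delta>\<^sup>2 - (w x)\<^sup>2) / (D x)\<^sup>2" for x
  define f where "f x = cis (\<phi> x) * of_real (b x * \<eta> x)" for x
  \<comment> \<open>\<open>e\<close> is the derivative of
    \<open>- \<i> * cis (\<phi> x) * of_real (G x)\<close>. Its integral is zero since
    \<open>G\<close> vanishes at both ends with \<open>\<eta>\<close>, so only \<open>f - e\<close>
    has to be estimated, and \<open>r\<close> is the majorant for it.\<close>
  define e where "e x = cis (\<phi> x) * of_real (b x * w x * G x) - \<i> * cis (\<phi> x) * of_real (G' x)" for x
  define r where "r x = K1 / (2 * \<delta>) + 2 * K0 * (w' x / D x)" for x
  have K0: "K0 \<ge> 0" using \<eta>[of \<alpha>] ab by auto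
  have K1: "K1 \<ge> 0" using \<eta>'[of \<alpha>] ab by auto
  have dG: "(G has_real_derivative G' x) (at x within {\<alpha>..\<beta>})" if x: "x \<in> {\<alpha>..\<beta>}" for x
  proof -
    have "(D has_real_derivative 2 * w x * w' x) (at x within {\<alpha>..\<beta>})"
      unfolding D_def[abs_def] by (auto intro!: derivative_eq_intros dw[OF x])
    from DERIV_divide[OF DERIV_mult[OF d\<eta>[OF x] dw[OF x]] this] D[of x]
    have "(G has_real_derivative ((\<eta>' x * w x + w' x * \<eta> x) * D x - \<eta> x * w x * (2 * w x * w' x)) / (D x * D x)) (at x within {\<alpha>..\<beta>})"
      unfolding G_def[abs_def] by simp
    also have "(\<eta>' x * w x + w' x * \<eta> x) * D x - \<eta> x * w x * (2 * w x * w' x) = \<eta>' x * w x * D x + \<eta> x * w' x * (\<delta>\<^sup>2 - (w x)\<^sup>2)"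
      unfolding D_def by (simp add: algebra_simps power2_eq_square)
    also have "\<dots> / (D x * D x) = G' x"
      using D[of x] by (simp add: G'_def add_divide_distrib power2_eq_square)
    finally show ?thesis .
  qed
  have "(e has_integral - \<i> * cis (\<phi> \<beta>) * of_real (G \<beta>) - - \<i> * cis (\<phi> \<alpha>) * of_real (G \<alpha>)) {\<alpha>..\<beta>}"
  proof (rule fundamental_theorem_of_calculus[OF ab])
    fix x assume x: "x \<in> {\<alpha>..\<beta>}"
    have 1: "((\<lambda>x. cis (\<phi> x)) has_vector_derivative (b x * w x) *\<^sub>R (\<i> * cis (\<phi> x))) (at x within {\<alpha>..\<beta>})"
      unfolding cis_conv_exp
      using field_vector_diff_chain_within[OF has_vector_derivative_mult_right[OF has_vector_derivative_of_real[OF d\<phi>[OF x]], of \<i>]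
          has_field_derivative_at_within[OF DERIV_exp]]
      by (simp add: scaleR_conv_of_real o_def mult_ac)
    have 2: "((\<lambda>x. complex_of_real (G x)) has_vector_derivative of_real (G' x)) (at x within {\<alpha>..\<beta>})"
      by (rule has_vector_derivative_of_real[OF dG[OF x]])
    show "((\<lambda>x. - \<i> * cis (\<phi> x) * of_real (G x)) has_vector_derivative e x) (at x within {\<alpha>..\<beta>})"
      using has_vector_derivative_mult[OF has_vector_derivative_mult_right[OF 1, of "-\<i>"] 2]
      by (rule has_vector_derivative_eq_rhs) (simp add: e_def scaleR_conv_of_real algebra_simps)
  qed
  hence e: "(e has_integral 0) {\<alpha>..\<beta>}" using ends by (simp add: G_def)
  have "((\<lambda>x. w' x / D x) has_integral arctan (w \<beta> / \<delta>) / \<delta> - arctan (w \<alpha> / \<delta>) / \<delta>) {\<alpha>..\<beta>}"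
  proof (rule fundamental_theorem_of_calculus[OF ab])
    fix x assume x: "x \<in> {\<alpha>..\<beta>}"
    have "((\<lambda>x. arctan (w x / \<delta>) / \<delta>) has_real_derivative w' x / D x) (at x within {\<alpha>..\<beta>})"
    proof -
      have "((\<lambda>x. arctan (w x / \<delta>) / \<delta>) has_real_derivative (inverse (1 + (w x / \<delta>)\<^sup>2) * (w' x / \<delta>)) / \<delta>) (at x within {\<alpha>..\<beta>})"
        by (intro DERIV_cdivide DERIV_chain2[OF DERIV_arctan] dw[OF x])
      moreover have "D x = \<delta> * \<delta> * (1 + (w x / \<delta>)\<^sup>2)"
        using \<delta>(1) by (simp add: D_def field_simps power2_eq_square)
      ultimately show ?thesis by (simp add: divide_inverse mult_ac)
    qed
    thus "((\<lambda>x. arctan (w x / \<delta>) / \<delta>) has_vector_derivative w' x / D x) (at x within {\<alpha>..\<beta>})"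
      by (simp add: has_real_derivative_iff_has_vector_derivative)
  qed
  from has_integral_add[OF has_integral_const_real[of "K1 / (2 * \<delta>)"] has_integral_mult_right[OF this, of "2 * K0"]]
  have r: "(r has_integral (\<beta> - \<alpha>) *\<^sub>R (K1 / (2*\<delta>)) + 2 * K0 * (arctan (w \<beta> / \<delta>) / \<delta> - arctan (w \<alpha> / \<delta>) / \<delta>)) {\<alpha>..\<beta>}"
    unfolding r_def[abs_def] using ab by auto
  have c: "continuous_on {\<alpha>..\<beta>} \<phi>" "continuous_on {\<alpha>..\<beta>} \<eta>"
    using DERIV_continuous_on[OF d\<phi>] DERIV_continuous_on[OF d\<eta>] by blast+
  have fint: "f integrable_on {\<alpha>..\<beta>}"
    unfolding f_def[abs_def] by (intro integrable_continuous_real continuous_intros c b)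
  have bound: "norm (f x - e x) \<le> r x" if x: "x \<in> {\<alpha>..\<beta>}" for x
  proof -
    have "f x - e x = cis (\<phi> x) * of_real (b x * \<eta> x * \<delta>\<^sup>2 / D x) + \<i> * cis (\<phi> x) * of_real (G' x)"
    proof -
      have "b x * \<eta> x = b x * w x * G x + b x * \<eta> x * \<delta>\<^sup>2 / D x"
      proof -
        have "b x * w x * G x + b x * \<eta> x * \<delta>\<^sup>2 / D x = b x * \<eta> x * ((w x)\<^sup>2 + \<delta>\<^sup>2) / D x"
          by (simp add: G_def power2_eq_square distrib_left add_divide_distrib mult_ac)
        thus ?thesis using D[of x] unfolding D_def[of x, symmetric] by simp
      qed
      hence "of_real (b x * \<eta> x) = (of_real (b x * w x * G x) + of_real (b x * \<eta> x * \<delta>\<^sup>2 / D x) :: complex)"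
        by (metis of_real_add)
      thus ?thesis unfolding f_def e_def by (simp only:) (simp add: algebra_simps)
    qed
    also have "norm \<dots> \<le> \<bar>b x * \<eta> x * \<delta>\<^sup>2 / D x\<bar> + \<bar>G' x\<bar>"
      by (rule order.trans[OF norm_triangle_ineq]) (simp add: norm_mult del: of_real_mult of_real_divide)
    also have "\<bar>b x * \<eta> x * \<delta>\<^sup>2 / D x\<bar> = \<bar>b x * \<eta> x\<bar> * (\<mu> / D x)"
      using D[of x] mu by (simp add: \<delta>(2) abs_mult)
    also have "\<dots> \<le> K0 * (w' x / D x)"
      using D[of x] mu w'[OF x] b\<eta>[OF x] K0 by (intro mult_mono divide_right_mono) auto
    also have "\<bar>G' x\<bar> \<le> K1 / (2 * \<delta>) + K0 * (w' x / D x)"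
      unfolding G'_def
    proof (rule order.trans[OF abs_triangle_ineq], rule add_mono)
      have "2 * \<bar>w x\<bar> * \<delta> \<le> D x" unfolding D_def using sum_squares_bound[of "\<bar>w x\<bar>" \<delta>] by simp
      hence "\<bar>w x\<bar> / D x \<le> 1 / (2 * \<delta>)" using D[of x] \<delta>(1) by (simp add: field_simps)
      hence "\<bar>\<eta>' x\<bar> * (\<bar>w x\<bar> / D x) \<le> K1 * (1 / (2 * \<delta>))"
        using \<eta>'[OF x] D[of x] K1 by (intro mult_mono) auto
      thus "\<bar>\<eta>' x * w x / D x\<bar> \<le> K1 / (2 * \<delta>)" using D[of x] by (simp add: abs_mult)
      have "\<bar>\<delta>\<^sup>2 - (w x)\<^sup>2\<bar> \<le> D x" unfolding D_def by (simp add: abs_le_iff)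
      hence "\<bar>\<eta> x\<bar> * (w' x * (\<bar>\<delta>\<^sup>2 - (w x)\<^sup>2\<bar> / (D x)\<^sup>2)) \<le> K0 * (w' x * (D x / (D x)\<^sup>2))"
        using \<eta>[OF x] w'[OF x] mu K0 D[of x] by (intro mult_mono divide_right_mono) auto
      thus "\<bar>\<eta> x * w' x * (\<delta>\<^sup>2 - (w x)\<^sup>2) / (D x)\<^sup>2\<bar> \<le> K0 * (w' x / D x)"
        using D[of x] w'[OF x] mu by (simp add: abs_mult power2_eq_square mult.assoc)
    qed
    finally show ?thesis by (simp add: r_def)
  qed
  have "integral {\<alpha>..\<beta>} f = integral {\<alpha>..\<beta>} (\<lambda>x. f x - e x)"
    using Henstock_Kurzweil_Integration.integral_diff[OF fint has_integral_integrable[OF e]] integral_unique[OF e] by simp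
  also have "norm \<dots> \<le> integral {\<alpha>..\<beta>} r"
    using bound
    by (rule integral_norm_bound_integral[OF Henstock_Kurzweil_Integration.integrable_diff[OF fint has_integral_integrable[OF e]] has_integral_integrable[OF r]])
  also have "\<dots> = (\<beta> - \<alpha>) * (K1 / (2*\<delta>)) + 2 * K0 * ((arctan (w \<beta> / \<delta>) - arctan (w \<alpha> / \<delta>)) / \<delta>)"
    using integral_unique[OF r] by (simp add: diff_divide_distrib)
  also have "\<dots> \<le> (\<beta> - \<alpha>) * (K1 / \<delta>) + 2 * K0 * (pi / \<delta>)"
  proof (intro add_mono mult_left_mono divide_right_mono)
    show "K1 / (2 * \<delta>) \<le> K1 / \<delta>" using K1 \<delta>(1) by (simp add: field_simps)
    show "arctan (w \<beta> / \<delta>) - arctan (w \<alpha> / \<delta>) \<le> pi"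
      using arctan_bounded[of "w \<beta> / \<delta>"] arctan_bounded[of "w \<alpha> / \<delta>"] by linarith
  qed (use ab K0 \<delta>(1) in auto)
  finally show ?thesis
    by (simp add: f_def[abs_def] \<delta>_def add_divide_distrib mult.commute mult.left_commute)
qed

text \<open>The argument is clamped to \<open>[c1, c2]\<close> to make the curve continuous and bounded on the whole line.\<close>
definition power_curve :: "real \<Rightarrow> real \<Rightarrow> real \<Rightarrow> real \<Rightarrow> real" where
  "power_curve c1 c2 a s = max c1 (min c2 s) powr a"

lemma power_curve_eq: "s \<in> {c1..c2} \<Longrightarrow> power_curve c1 c2 a s = s powr a"
  by (simp add: power_curve_def)

lemma continuous_power_curve:
  assumes "0 < c1"
  shows "continuous_on UNIV (power_curve c1 c2 a)"
proof -
  have "max c1 (min c2 s) \<noteq> 0" for s using assms by (auto simp: max_def)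
  thus ?thesis unfolding power_curve_def[abs_def] by (intro continuous_intros) auto
qed

lemma powr_between:
  fixes s :: real
  assumes "0 < l" "l \<le> s" "s \<le> u"
  shows "s powr e \<le> max (l powr e) (u powr e)" "min (l powr e) (u powr e) \<le> s powr e"
  using assms
  by (cases "e \<ge> 0"; auto simp: le_max_iff_disj min_le_iff_disj intro: powr_mono2 powr_mono2')+

lemma power_curve_bounded:
  assumes "0 < c1" "c1 \<le> c2"
  shows "\<bar>power_curve c1 c2 a s\<bar> \<le> max (c1 powr a) (c2 powr a)"
  using powr_between(1)[of c1 "max c1 (min c2 s)" c2 a] assms by (simp add: power_curve_def)

text \<open>Taking the factor a s^(a-1) out of the derivative of the phase leaves L1 - L2 (1 +
  r/s)^(a-1). The derivative of this is L2 r (a-1) (1 + r/s)^(a-2) / s^2, of constant sign and of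
  size at least a multiple of |L2 r|, whatever \<open>L1\<close> is. A stationary point may well
  occur, but \<open>w\<close> crosses it with this slope, and that is all that
  \<open>van_der_corput\<close> asks for.\<close>

theorem power_curve_oscillation:
  fixes \<psi> \<psi>' :: "real \<Rightarrow> real"
  assumes a: "a > 0" "a \<noteq> 1" and c: "0 < c1" "c1 < c2"
    and d\<psi>: "\<And>s. (\<psi> has_real_derivative \<psi>' s) (at s)"
    and X: "\<And>s. \<bar>\<psi> s\<bar> \<le> X" "\<And>s. \<bar>\<psi>' s\<bar> \<le> X"
    and supp: "\<And>s. s \<notin> {c1<..<c2} \<Longrightarrow> \<psi> s = 0"
  shows "\<exists>C>0. \<forall>L1 L2 r. L2 \<noteq> 0 \<longrightarrow> r \<noteq> 0 \<longrightarrow>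
     norm (LINT s|lborel. cis (L1 * power_curve c1 c2 a s - L2 * power_curve c1 c2 a (s + r)) * of_real (\<psi> s * \<psi> (s + r)))
       \<le> C / sqrt \<bar>L2 * r\<bar>"
proof -
  define q where "q = c1 / c2"
  have q: "0 < q" "q < 1" using c by (auto simp: q_def)
  \<comment> \<open>\<open>\<kappa> * \<bar>L2 * r\<bar>\<close> will bound the slope of
    \<open>w\<close> from below: the quotient \<open>(s + r) / s\<close> stays in
    \<open>{q..1/q}\<close> and \<open>s\<close> stays below \<open>c2\<close>.\<close>
  define \<kappa> where "\<kappa> = \<bar>a - 1\<bar> * min (q powr (a-2)) ((1/q) powr (a-2)) / c2\<^sup>2"
  have \<kappa>: "\<kappa> > 0" using a c q by (simp add: \<kappa>_def)
  define M where "M = 1 + max (c1 powr (1-a)) (c2 powr (1-a)) + max (c1 powr (-a)) (c2 powr (-a))"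
  have M1: "M \<ge> 1" by (simp add: M_def add_nonneg_nonneg le_max_iff_disj)
  have M: "s powr (1-a) \<le> M" "s powr (-a) \<le> M" if "s \<in> {c1..c2}" for s
  proof -
    have "s powr (1-a) \<le> max (c1 powr (1-a)) (c2 powr (1-a))" "s powr (-a) \<le> max (c1 powr (-a)) (c2 powr (-a))"
      using that c by (auto intro!: powr_between)
    moreover have "0 \<le> s powr (1-a)" "0 \<le> s powr (-a)" by simp_all
    ultimately show "s powr (1-a) \<le> M" "s powr (-a) \<le> M" unfolding M_def by linarith+
  qed
  have X0: "X \<ge> 0" using X(1)[of 0] by linarith
  define K0 where "K0 = X\<^sup>2 * M / a + X\<^sup>2"
  define K1 where "K1 = (2 * X\<^sup>2 * M + X\<^sup>2 * (\<bar>1 - a\<bar> * M)) / a"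
  have K: "K0 \<ge> 0" "K1 \<ge> 0" using M1 a by (auto simp: K0_def K1_def)
  define C where "C = (K1 * c2 + 2 * pi * K0) / sqrt \<kappa> + 1"
  have C: "C > 0" using K c \<kappa> unfolding C_def by (intro add_nonneg_pos divide_nonneg_nonneg add_nonneg_nonneg mult_nonneg_nonneg) auto
  have "norm (LINT s|lborel. cis (L1 * power_curve c1 c2 a s - L2 * power_curve c1 c2 a (s + r)) * of_real (\<psi> s * \<psi> (s + r)))
       \<le> C / sqrt \<bar>L2 * r\<bar>" if nz: "L2 \<noteq> 0" "r \<noteq> 0" for L1 L2 r
  proof -
    define \<alpha> where "\<alpha> = max c1 (c1 - r)"
    define \<beta> where "\<beta> = min c2 (c2 - r)"
    define F where "F s = cis (L1 * power_curve c1 c2 a s - L2 * power_curve c1 c2 a (s + r)) * of_real (\<psi> s * \<psi> (s + r))" for s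
    have F0: "F s = 0" if "s \<notin> {\<alpha>..\<beta>}" for s
    proof -
      have "s \<notin> {c1<..<c2} \<or> s + r \<notin> {c1<..<c2}" using that by (auto simp: \<alpha>_def \<beta>_def)
      thus ?thesis using supp by (auto simp: F_def)
    qed
    show ?thesis
    proof (cases "\<alpha> \<le> \<beta>")
      case False
      hence "F = (\<lambda>s. 0)" using F0 by (auto simp: fun_eq_iff)
      thus ?thesis using C nz by (simp add: F_def[abs_def])
    next
      case ab: True
      have \<psi>c: "continuous_on UNIV \<psi>" using d\<psi> DERIV_continuous_on by (metis has_field_derivative_at_within)
      have "integrable lborel F"
      proof (rule integrable_continuous_compact_support[where S="{\<alpha>..\<beta>}"])
        show "continuous_on UNIV F" unfolding F_def
          by (intro continuous_intros continuous_on_compose2[OF continuous_power_curve[OF c(1)]] continuous_on_compose2[OF \<psi>c]) auto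
      qed (use F0 in auto)
      hence "(LINT s|lborel. F s) = integral UNIV F" by (simp add: integral_lborel)
      also have "F = (\<lambda>s. if s \<in> {\<alpha>..\<beta>} then F s else 0)" using F0 by auto
      hence "integral UNIV F = integral {\<alpha>..\<beta>} F" by (metis integral_restrict_UNIV)
      finally have FI: "(LINT s|lborel. F s) = integral {\<alpha>..\<beta>} F" .
      have sr: "s \<in> {c1..c2}" "s + r \<in> {c1..c2}" if "s \<in> {\<alpha>..\<beta>}" for s
        using that by (auto simp: \<alpha>_def \<beta>_def)
      \<comment> \<open>This sign makes \<open>w\<close> increasing. It is put into both
        \<open>b\<close> and \<open>w\<close>, so it disappears from the product
        \<open>b s * w s\<close>.\<close>
      define \<sigma> where "\<sigma> = sgn (L2 * r * (a - 1))"
      have \<sigma>: "\<sigma> * \<sigma> = 1" "\<bar>\<sigma>\<bar> = 1" "\<sigma> * (L2 * r * (a-1)) = \<bar>L2 * r\<bar> * \<bar>a - 1\<bar>"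
      proof -
        define y where "y = L2 * r * (a - 1)"
        have "y \<noteq> 0" using nz a by (simp add: y_def)
        thus "\<sigma> * \<sigma> = 1" "\<bar>\<sigma>\<bar> = 1" unfolding \<sigma>_def y_def[symmetric] by (auto simp: sgn_if)
        have "\<sigma> * y = \<bar>y\<bar>" unfolding \<sigma>_def y_def[symmetric] by (simp add: abs_sgn mult.commute)
        thus "\<sigma> * (L2 * r * (a-1)) = \<bar>L2 * r\<bar> * \<bar>a - 1\<bar>" unfolding y_def by (simp add: abs_mult)
      qed
      define b where "b s = \<sigma> * a * s powr (a-1)" for s
      define w where "w s = \<sigma> * (L1 - L2 * (1 + r / s) powr (a-1))" for s
      define w' where "w' s = \<sigma> * (L2 * r * (a-1)) * ((1 + r / s) powr (a-2) / s\<^sup>2)" for s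
      define \<omega> where "\<omega> s = \<psi> s * \<psi> (s + r)" for s
      define \<omega>' where "\<omega>' s = \<psi>' s * \<psi> (s + r) + \<psi> s * \<psi>' (s + r)" for s
      \<comment> \<open>The amplitude divided by \<open>b\<close>: the integrand then has the shape
        \<open>cis (\<phi> s) * of_real (b s * \<eta> s)\<close> that \<open>van_der_corput\<close>
        treats.\<close>
      define \<eta> where "\<eta> s = \<sigma> * \<omega> s * s powr (1-a) / a" for s
      define \<eta>' where "\<eta>' s = \<sigma> * (\<omega>' s * s powr (1-a) + \<omega> s * ((1-a) * s powr (-a))) / a" for s
      define \<phi> where "\<phi> s = L1 * s powr a - L2 * (s + r) powr a" for s
      have pos: "s > 0" "s + r > 0" "1 + r / s > 0" "1 + r / s = (s + r) / s" if "s \<in> {\<alpha>..\<beta>}" for s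
      proof -
        show *: "s > 0" "s + r > 0" using sr[OF that] c by auto
        show "1 + r / s = (s + r) / s" using * by (simp add: field_simps)
        thus "1 + r / s > 0" using * by simp
      qed
      have b\<eta>: "b s * \<eta> s = \<omega> s" if "s \<in> {\<alpha>..\<beta>}" for s
      proof -
        have "b s * \<eta> s = (\<sigma> * \<sigma>) * \<omega> s * (s powr (a-1) * s powr (1-a))"
          using a by (simp add: b_def \<eta>_def)
        thus ?thesis using pos[OF that] \<sigma>(1) by (simp flip: powr_add)
      qed
      have \<omega>b: "\<bar>\<omega> s\<bar> \<le> X\<^sup>2" "\<bar>\<omega>' s\<bar> \<le> 2 * X\<^sup>2" for s
      proof -
        have *: "\<bar>\<psi> s * \<psi> (s + r)\<bar> \<le> X * X" "\<bar>\<psi>' s * \<psi> (s + r)\<bar> \<le> X * X" "\<bar>\<psi> s * \<psi>' (s + r)\<bar> \<le> X * X"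
          unfolding abs_mult by (intro mult_mono X X0 abs_ge_zero)+
        thus "\<bar>\<omega> s\<bar> \<le> X\<^sup>2" "\<bar>\<omega>' s\<bar> \<le> 2 * X\<^sup>2"
          unfolding \<omega>_def \<omega>'_def power2_eq_square by linarith+
      qed
      have "norm (integral {\<alpha>..\<beta>} (\<lambda>s. cis (\<phi> s) * of_real (b s * \<eta> s))) \<le> (K1 * (\<beta> - \<alpha>) + 2 * pi * K0) / sqrt (\<kappa> * \<bar>L2 * r\<bar>)"
      proof (rule van_der_corput[OF ab])
        show "\<kappa> * \<bar>L2 * r\<bar> > 0" using \<kappa> nz by simp
        fix s assume s: "s \<in> {\<alpha>..\<beta>}"
        note p = pos[OF s]
        have e1: "(s + r) powr (a-1) = s powr (a-1) * (1 + r / s) powr (a-1)"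
          using p by (simp add: powr_divide)
        have "(\<phi> has_real_derivative L1 * (a * s powr (a-1)) - L2 * (a * (s + r) powr (a-1))) (at s within {\<alpha>..\<beta>})"
          unfolding \<phi>_def[abs_def] using p by (auto intro!: derivative_eq_intros)
        also have "L1 * (a * s powr (a-1)) - L2 * (a * (s + r) powr (a-1)) = (\<sigma> * \<sigma>) * (L1 * (a * s powr (a-1)) - L2 * (a * (s + r) powr (a-1)))"
          using \<sigma>(1) by simp
        also have "\<dots> = b s * w s"
          unfolding e1 by (simp add: b_def w_def algebra_simps)
        finally show "(\<phi> has_real_derivative b s * w s) (at s within {\<alpha>..\<beta>})" .
        have "((\<lambda>s. (1 + r / s) powr (a-1)) has_real_derivative (a-1) * (1 + r/s) powr (a - 1 - 1) * (- r / s\<^sup>2)) (at s within {\<alpha>..\<beta>})"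
          using p by (auto intro!: derivative_eq_intros simp: power2_eq_square)
        hence "(w has_real_derivative \<sigma> * (0 - L2 * ((a-1) * (1 + r/s) powr (a - 1 - 1) * (- r / s\<^sup>2)))) (at s within {\<alpha>..\<beta>})"
          unfolding w_def[abs_def] by (intro DERIV_cmult DERIV_diff DERIV_const)
        also have "\<sigma> * (0 - L2 * ((a-1) * (1 + r/s) powr (a - 1 - 1) * (- r / s\<^sup>2))) = w' s"
          by (simp add: w'_def mult_ac)
        finally show "(w has_real_derivative w' s) (at s within {\<alpha>..\<beta>})" .
        have d\<omega>: "(\<omega> has_real_derivative \<omega>' s) (at s within {\<alpha>..\<beta>})"
        proof -
          have "((\<lambda>s. \<psi> (s + r)) has_real_derivative \<psi>' (s + r)) (at s)"
            using DERIV_shift[of \<psi> "\<psi>' (s+r)" s r] d\<psi>[of "s+r"] by simp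
          from has_field_derivative_at_within[OF DERIV_mult[OF d\<psi>[of s] this]] show ?thesis
            by (simp add: \<omega>_def[abs_def] \<omega>'_def mult.commute)
        qed
        show "(\<eta> has_real_derivative \<eta>' s) (at s within {\<alpha>..\<beta>})"
          unfolding \<eta>_def[abs_def] \<eta>'_def using p a
          by (auto intro!: derivative_eq_intros d\<omega> simp: field_simps)
        have "q \<le> 1 + r/s" "1 + r/s \<le> 1/q"
        proof -
          have "c1 * s \<le> (s + r) * c2" "c1 * (s + r) \<le> s * c2"
            using sr[OF s] c p by (intro mult_mono; simp)+
          thus "q \<le> 1 + r/s" "1 + r/s \<le> 1/q"
            unfolding p(4) q_def using c p(1) by (simp_all add: divide_le_eq le_divide_eq mult.commute)
        qed
        hence "min (q powr (a-2)) ((1/q) powr (a-2)) \<le> (1 + r/s) powr (a-2)"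
          using powr_between(2)[of q "1 + r/s" "1/q"] q by simp
        moreover have "1 / c2\<^sup>2 \<le> 1 / s\<^sup>2"
          using sr[OF s] p c by (intro divide_left_mono power_mono mult_pos_pos) auto
        ultimately have "min (q powr (a-2)) ((1/q) powr (a-2)) * (1 / c2\<^sup>2) \<le> (1 + r/s) powr (a-2) * (1 / s\<^sup>2)"
          using q by (intro mult_mono) auto
        hence "\<bar>L2 * r\<bar> * \<bar>a - 1\<bar> * (min (q powr (a-2)) ((1/q) powr (a-2)) * (1 / c2\<^sup>2)) \<le> \<bar>L2 * r\<bar> * \<bar>a - 1\<bar> * ((1 + r/s) powr (a-2) * (1 / s\<^sup>2))"
          by (rule mult_left_mono) simp
        thus "\<kappa> * \<bar>L2 * r\<bar> \<le> w' s"
          unfolding w'_def \<sigma>(3) \<kappa>_def by (simp add: mult_ac)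
        have m: "s powr (1-a) \<le> M" "s powr (-a) \<le> M" using M sr[OF s] by auto
        show "\<bar>\<eta>' s\<bar> \<le> K1"
        proof -
          have "\<bar>\<omega>' s * s powr (1-a) + \<omega> s * ((1-a) * s powr (-a))\<bar> \<le> \<bar>\<omega>' s\<bar> * s powr (1-a) + \<bar>\<omega> s\<bar> * (\<bar>1-a\<bar> * s powr (-a))"
            by (rule order.trans[OF abs_triangle_ineq]) (simp add: abs_mult)
          also have "\<dots> \<le> 2 * X\<^sup>2 * M + X\<^sup>2 * (\<bar>1-a\<bar> * M)"
            using m M1 by (intro add_mono mult_mono \<omega>b) auto
          finally show ?thesis using a \<sigma>(2) by (simp add: \<eta>'_def K1_def abs_mult divide_right_mono)
        qed
        show "\<bar>\<eta> s\<bar> \<le> K0"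
        proof -
          have "\<bar>\<omega> s\<bar> * s powr (1-a) / a \<le> X\<^sup>2 * M / a"
            using m a by (intro divide_right_mono mult_mono \<omega>b) auto
          also have "\<dots> \<le> K0" by (simp add: K0_def)
          finally show ?thesis using a \<sigma>(2) by (simp add: \<eta>_def abs_mult)
        qed
        show "\<bar>b s * \<eta> s\<bar> \<le> K0"
        proof -
          have "0 \<le> X\<^sup>2 * M / a" using M1 a by simp
          thus ?thesis unfolding b\<eta>[OF s] K0_def using \<omega>b(1)[of s] by linarith
        qed
      next
        show "continuous_on {\<alpha>..\<beta>} b"
          unfolding b_def by (intro continuous_intros ballI) (metis pos(1) less_irrefl)
        have "\<psi> \<alpha> * \<psi> (\<alpha> + r) = 0" "\<psi> \<beta> * \<psi> (\<beta> + r) = 0"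
          using supp[of c1] supp[of c2] by (auto simp: \<alpha>_def \<beta>_def max_def min_def)
        thus "\<eta> \<alpha> = 0" "\<eta> \<beta> = 0" by (simp_all add: \<eta>_def \<omega>_def)
      qed
      also have "integral {\<alpha>..\<beta>} (\<lambda>s. cis (\<phi> s) * of_real (b s * \<eta> s)) = integral {\<alpha>..\<beta>} F"
      proof (rule integral_cong)
        fix s assume s: "s \<in> {\<alpha>..\<beta>}"
        show "cis (\<phi> s) * of_real (b s * \<eta> s) = F s"
          unfolding b\<eta>[OF s] F_def power_curve_eq[OF sr(1)[OF s]] power_curve_eq[OF sr(2)[OF s]]
          by (simp add: \<phi>_def \<omega>_def)
      qed
      also have "(K1 * (\<beta> - \<alpha>) + 2 * pi * K0) / sqrt (\<kappa> * \<bar>L2 * r\<bar>) \<le> ((K1 * c2 + 2 * pi * K0) / sqrt \<kappa>) / sqrt \<bar>L2 * r\<bar>"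
      proof -
        have "\<beta> - \<alpha> \<le> c2" using c by (auto simp: \<alpha>_def \<beta>_def)
        thus ?thesis unfolding real_sqrt_mult divide_divide_eq_left
          by (intro divide_right_mono add_mono mult_left_mono K) (use \<kappa> in auto)
      qed
      also have "\<dots> \<le> C / sqrt \<bar>L2 * r\<bar>"
        unfolding C_def by (intro divide_right_mono) auto
      finally show ?thesis unfolding F_def[symmetric] FI .
    qed
  qed
  thus ?thesis using C by blast
qed


section \<open>Sums over integers and overlapping windows\<close>

text \<open>Telescoping, since 1 / sqrt k is at most 2 (sqrt k - sqrt (k - 1)).\<close>

lemma sum_inverse_sqrt_le: "(\<Sum>k=1..n. 1 / sqrt (real k)) \<le> 2 * sqrt (real n)"
proof (induction n)
  case (Suc n)
  define x where "x = sqrt (real n)"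
  define y where "y = sqrt (real (Suc n))"
  have xy: "0 \<le> x" "0 < y" "x \<le> y" "y * y = x * x + 1" by (simp_all add: x_def y_def)
  have "2 * (x * y) \<le> x * x + y * y" using sum_squares_bound[of x y] by (simp add: power2_eq_square)
  hence "1 \<le> 2 * (y - x) * y" using xy(4) by (simp add: algebra_simps)
  hence "1 / y \<le> 2 * (y - x)" using xy(2) by (simp add: divide_le_eq)
  thus ?case using Suc.IH by (simp add: x_def[symmetric] y_def[symmetric] del: of_nat_Suc)
qed simp

lemma sum_inverse_sqrt_int_le:
  fixes F :: "int set"
  assumes F: "finite F" and M: "M \<ge> 0"
  shows "(\<Sum>j\<in>{j\<in>F. j \<noteq> i \<and> \<bar>real_of_int (j - i)\<bar> \<le> M}. 1 / sqrt \<bar>real_of_int (j - i)\<bar>) \<le> 4 * sqrt M"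
proof -
  have half: "(\<Sum>j\<in>{j\<in>F. s * (j - i) > 0 \<and> \<bar>real_of_int (j - i)\<bar> \<le> M}. 1 / sqrt \<bar>real_of_int (j - i)\<bar>) \<le> 2 * sqrt M"
    if s: "s = 1 \<or> s = (-1::int)" for s
  proof -
    let ?J = "{j\<in>F. s * (j - i) > 0 \<and> \<bar>real_of_int (j - i)\<bar> \<le> M}"
    have sJ: "\<bar>real_of_int (j - i)\<bar> = real (nat (s * (j - i)))" if "j \<in> ?J" for j
      using that s by (elim disjE) simp_all
    have "(\<Sum>j\<in>?J. 1 / sqrt \<bar>real_of_int (j - i)\<bar>) = (\<Sum>j\<in>?J. 1 / sqrt (real (nat (s * (j - i)))))"
      by (intro sum.cong refl) (simp only: sJ)
    also have "\<dots> = (\<Sum>k\<in>(\<lambda>j. nat (s * (j - i))) ` ?J. 1 / sqrt (real k))"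
    proof (subst sum.reindex)
      show "inj_on (\<lambda>j. nat (s * (j - i))) ?J"
        using s by (elim disjE) (simp_all add: inj_on_def nat_eq_iff)
    qed simp
    also have "\<dots> \<le> (\<Sum>k=1..nat \<lfloor>M\<rfloor>. 1 / sqrt (real k))"
    proof (rule sum_mono2)
      show "(\<lambda>j. nat (s * (j - i))) ` ?J \<subseteq> {1..nat \<lfloor>M\<rfloor>}"
      proof (rule image_subsetI)
        fix j assume j: "j \<in> ?J"
        hence "real (nat (s * (j - i))) \<le> M" by (simp only: sJ[OF j, symmetric]) simp
        hence "nat (s * (j - i)) \<le> nat \<lfloor>M\<rfloor>" by (simp add: le_nat_floor)
        moreover have "0 < s * (j - i)" using j by blast
        hence "1 \<le> nat (s * (j - i))" by linarith
        ultimately show "nat (s * (j - i)) \<in> {1..nat \<lfloor>M\<rfloor>}" by simp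
      qed
    qed simp_all
    also have "\<dots> \<le> 2 * sqrt (real (nat \<lfloor>M\<rfloor>))" by (rule sum_inverse_sqrt_le)
    also have "\<dots> \<le> 2 * sqrt M" using M by simp
    finally show ?thesis .
  qed
  have eq: "{j\<in>F. j \<noteq> i \<and> \<bar>real_of_int (j - i)\<bar> \<le> M} = {j\<in>F. 1 * (j - i) > 0 \<and> \<bar>real_of_int (j - i)\<bar> \<le> M} \<union> {j\<in>F. -1 * (j - i) > 0 \<and> \<bar>real_of_int (j - i)\<bar> \<le> M}"
    by auto
  have "(\<Sum>j\<in>{j\<in>F. j \<noteq> i \<and> \<bar>real_of_int (j - i)\<bar> \<le> M}. 1 / sqrt \<bar>real_of_int (j - i)\<bar>) = (\<Sum>j\<in>{j\<in>F. 1 * (j - i) > 0 \<and> \<bar>real_of_int (j - i)\<bar> \<le> M}. 1 / sqrt \<bar>real_of_int (j - i)\<bar>) + (\<Sum>j\<in>{j\<in>F. -1 * (j - i) > 0 \<and> \<bar>real_of_int (j - i)\<bar> \<le> M}. 1 / sqrt \<bar>real_of_int (j - i)\<bar>)"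
    unfolding eq using F by (intro sum.union_disjoint) auto
  also have "\<dots> \<le> 4 * sqrt M" using half[of 1] half[of "-1"] by simp
  finally show ?thesis .
qed

lemma card_int_near_le:
  fixes F :: "int set"
  assumes "L \<ge> 0"
  shows "real (card {n\<in>F. \<bar>y - real_of_int n\<bar> \<le> L}) \<le> 2 * L + 1"
proof -
  have "card {n\<in>F. \<bar>y - real_of_int n\<bar> \<le> L} \<le> card {\<lceil>y - L\<rceil>..\<lfloor>y + L\<rfloor>}"
    by (intro card_mono) (auto simp: ceiling_le_iff le_floor_iff)
  also have "\<dots> = nat (\<lfloor>y + L\<rfloor> - \<lceil>y - L\<rceil> + 1)" by simp
  finally have "real (card {n\<in>F. \<bar>y - real_of_int n\<bar> \<le> L}) \<le> real (nat (\<lfloor>y + L\<rfloor> - \<lceil>y - L\<rceil> + 1))"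
    by linarith
  also have "\<dots> \<le> 2 * L + 1"
  proof (cases "\<lfloor>y + L\<rfloor> - \<lceil>y - L\<rceil> + 1 \<ge> 0")
    case True
    have "real_of_int \<lfloor>y + L\<rfloor> \<le> y + L" "y - L \<le> real_of_int \<lceil>y - L\<rceil>" by simp_all
    moreover have "real (nat (\<lfloor>y + L\<rfloor> - \<lceil>y - L\<rceil> + 1)) = real_of_int (\<lfloor>y + L\<rfloor> - \<lceil>y - L\<rceil> + 1)"
      using True by simp
    ultimately show ?thesis by linarith
  qed (use assms in simp)
  finally show ?thesis .
qed

lemma sum_mult_sqrt_le:
  assumes "\<And>i. i \<in> I \<Longrightarrow> 0 \<le> x i" "\<And>i. i \<in> I \<Longrightarrow> 0 \<le> y i"
  shows "(\<Sum>i\<in>I. sqrt (x i) * sqrt (y i)) \<le> sqrt (\<Sum>i\<in>I. x i) * sqrt (\<Sum>i\<in>I. y i)"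
proof -
  have "(\<Sum>i\<in>I. sqrt (x i) * sqrt (y i)) = (\<Sum>i\<in>I. \<bar>sqrt (x i)\<bar> * \<bar>sqrt (y i)\<bar>)"
    using assms by (intro sum.cong) auto
  also have "\<dots> \<le> L2_set (\<lambda>i. sqrt (x i)) I * L2_set (\<lambda>i. sqrt (y i)) I"
    by (rule L2_set_mult_ineq)
  also have "\<dots> = sqrt (\<Sum>i\<in>I. x i) * sqrt (\<Sum>i\<in>I. y i)"
    using assms unfolding L2_set_def by simp
  finally show ?thesis .
qed

text \<open>Bounded overlap: \<open>y\<close> meets the window of \<open>n\<close> only if
  \<open>A * y - v\<close> is within \<open>L\<close> of \<open>n\<close>, which happens for at most
  2 L + 1 integers. The count is independent of \<open>A\<close> and of the number of cells.\<close>

lemma sum_overlap_le: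
  fixes \<zeta> :: "real \<Rightarrow> real" and G :: "real \<Rightarrow> complex" and F :: "int set"
  assumes F: "finite F" and [measurable]: "G \<in> borel_measurable borel" "\<zeta> \<in> borel_measurable borel"
    and G: "integrable lborel (\<lambda>x. (norm (G x))\<^sup>2)"
    and X: "\<And>x. \<bar>\<zeta> x\<bar> \<le> X" and supp: "\<And>x. \<bar>x\<bar> > 1 \<Longrightarrow> \<zeta> x = 0" and L: "L > 0"
  shows "(\<Sum>n\<in>F. LINT y|lborel. (norm (of_real (\<zeta> ((A * y - (real_of_int n + v)) / L)) * G y))\<^sup>2)
      \<le> X\<^sup>2 * (2 * L + 1) * (LINT y|lborel. (norm (G y))\<^sup>2)"
proof -
  let ?f = "\<lambda>n y. (norm (of_real (\<zeta> ((A * y - (real_of_int n + v)) / L)) * G y))\<^sup>2"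
  have X0: "X \<ge> 0" using X[of 0] by linarith
  have le1: "?f n y \<le> (if \<bar>A * y - v - real_of_int n\<bar> \<le> L then X\<^sup>2 * (norm (G y))\<^sup>2 else 0)" for n y
  proof (cases "\<bar>A * y - v - real_of_int n\<bar> \<le> L")
    case True
    have "\<bar>\<zeta> ((A * y - (real_of_int n + v)) / L)\<bar>\<^sup>2 \<le> X\<^sup>2" by (intro power_mono X) auto
    thus ?thesis using True by (simp add: norm_mult power_mult_distrib mult_right_mono)
  next
    case False
    hence "\<bar>(A * y - (real_of_int n + v)) / L\<bar> > 1" using L by (simp add: algebra_simps)
    from supp[OF this] False show ?thesis by simp
  qed
  have le2: "norm (?f n y) \<le> norm (X\<^sup>2 * (norm (G y))\<^sup>2)" for n y
  proof -
    have "norm (?f n y) = ?f n y" by simp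
    also have "\<dots> \<le> X\<^sup>2 * (norm (G y))\<^sup>2" by (rule order.trans[OF le1]) simp
    also have "\<dots> \<le> norm (X\<^sup>2 * (norm (G y))\<^sup>2)" by (simp only: real_norm_def abs_ge_self)
    finally show ?thesis .
  qed
  have int: "integrable lborel (?f n)" for n
  proof (rule Bochner_Integration.integrable_bound)
    show "integrable lborel (\<lambda>y. X\<^sup>2 * (norm (G y))\<^sup>2)" using G by simp
    show "AE y in lborel. norm (?f n y) \<le> norm (X\<^sup>2 * (norm (G y))\<^sup>2)" by (intro AE_I2 le2)
  qed measurable
  have "(\<Sum>n\<in>F. LINT y|lborel. ?f n y) = (LINT y|lborel. (\<Sum>n\<in>F. ?f n y))"
    by (rule Bochner_Integration.integral_sum[symmetric]) (rule int)
  also have "\<dots> \<le> (LINT y|lborel. X\<^sup>2 * (2 * L + 1) * (norm (G y))\<^sup>2)"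
  proof (rule integral_mono)
    fix y
    have "(\<Sum>n\<in>F. ?f n y) \<le> (\<Sum>n\<in>F. if \<bar>A * y - v - real_of_int n\<bar> \<le> L then X\<^sup>2 * (norm (G y))\<^sup>2 else 0)"
      by (intro sum_mono le1)
    also have "\<dots> = (\<Sum>n\<in>{n\<in>F. \<bar>A * y - v - real_of_int n\<bar> \<le> L}. X\<^sup>2 * (norm (G y))\<^sup>2)"
      by (rule sum.inter_filter[OF F, symmetric])
    also have "\<dots> = real (card {n\<in>F. \<bar>A * y - v - real_of_int n\<bar> \<le> L}) * (X\<^sup>2 * (norm (G y))\<^sup>2)"
      by simp
    also have "\<dots> \<le> (2 * L + 1) * (X\<^sup>2 * (norm (G y))\<^sup>2)"
      using L by (intro mult_right_mono card_int_near_le) auto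
    finally show "(\<Sum>n\<in>F. ?f n y) \<le> X\<^sup>2 * (2 * L + 1) * (norm (G y))\<^sup>2" by (simp add: mult_ac)
  qed (use int G in auto)
  finally show ?thesis by simp
qed

lemma nn_integral_mult_le_sqrt:
  fixes f g :: "real \<Rightarrow> real"
  assumes [measurable]: "f \<in> borel_measurable borel" "g \<in> borel_measurable borel"
    and f: "integrable lborel (\<lambda>x. (f x)\<^sup>2)" and g: "integrable lborel (\<lambda>x. (g x)\<^sup>2)"
  shows "(\<integral>\<^sup>+x. ennreal (\<bar>f x\<bar> * \<bar>g x\<bar>) \<partial>lborel) \<le> ennreal (sqrt (LINT x|lborel. (f x)\<^sup>2) * sqrt (LINT x|lborel. (g x)\<^sup>2))"
proof -
  let ?I = "\<integral>\<^sup>+x. ennreal (\<bar>f x\<bar> * \<bar>g x\<bar>) \<partial>lborel"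
  have "?I\<^sup>2 = (\<integral>\<^sup>+x. ennreal \<bar>f x\<bar> * ennreal \<bar>g x\<bar> \<partial>lborel)\<^sup>2"
    by (simp add: ennreal_mult)
  also have "\<dots> \<le> (\<integral>\<^sup>+x. (ennreal \<bar>f x\<bar>)\<^sup>2 \<partial>lborel) * (\<integral>\<^sup>+x. (ennreal \<bar>g x\<bar>)\<^sup>2 \<partial>lborel)"
    by (rule Cauchy_Schwarz_nn_integral) measurable
  also have "\<dots> = (\<integral>\<^sup>+x. ennreal ((f x)\<^sup>2) \<partial>lborel) * (\<integral>\<^sup>+x. ennreal ((g x)\<^sup>2) \<partial>lborel)"
    by (simp add: ennreal_power)
  also have "\<dots> = ennreal (LINT x|lborel. (f x)\<^sup>2) * ennreal (LINT x|lborel. (g x)\<^sup>2)"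
    using f g by (simp add: nn_integral_eq_integral)
  also have "\<dots> = (ennreal (sqrt (LINT x|lborel. (f x)\<^sup>2) * sqrt (LINT x|lborel. (g x)\<^sup>2)))\<^sup>2"
    by (simp add: ennreal_power power_mult_distrib flip: ennreal_mult)
  finally have sq: "?I\<^sup>2 \<le> (ennreal (sqrt (LINT x|lborel. (f x)\<^sup>2) * sqrt (LINT x|lborel. (g x)\<^sup>2)))\<^sup>2" .
  show ?thesis
  proof (cases ?I)
    case (real r)
    let ?s = "sqrt (LINT x|lborel. (f x)\<^sup>2) * sqrt (LINT x|lborel. (g x)\<^sup>2)"
    have s0: "0 \<le> ?s" by simp
    from sq have "ennreal (r\<^sup>2) \<le> ennreal (?s\<^sup>2)"
      by (simp only: real ennreal_power s0)
    hence "r\<^sup>2 \<le> ?s\<^sup>2" by (subst (asm) ennreal_le_iff) simp_all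
    hence "r \<le> ?s" by (rule power2_le_imp_le) (rule s0)
    thus ?thesis unfolding real by (rule ennreal_leI)
  next
    case top
    from sq show ?thesis unfolding top by (simp add: ennreal_power top_unique)
  qed
qed


section \<open>The frozen form along an oscillating curve\<close>

text \<open>If \<open>f\<close> is not integrable its integral is 0 by convention, and
  \<open>g\<close> is nonnegative because it dominates a norm; so integrability of \<open>f\<close>
  need not be checked.\<close>

lemma norm_LINT_le:
  fixes f :: "'a \<Rightarrow> 'b::{banach,second_countable_topology}"
  assumes g: "integrable M (g :: 'a \<Rightarrow> real)" and le: "\<And>x. norm (f x) \<le> g x"
  shows "norm (LINT x|M. f x) \<le> (LINT x|M. g x)"
proof (cases "integrable M f")
  case True
  have "norm (LINT x|M. f x) \<le> (LINT x|M. norm (f x))" by (rule integral_norm_bound)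
  also have "\<dots> \<le> (LINT x|M. g x)" using True g le by (intro integral_mono integrable_norm) auto
  finally show ?thesis .
next
  case False
  have "0 \<le> g x" for x using le[of x] norm_ge_zero[of "f x"] by linarith
  thus ?thesis using False by (simp add: not_integrable_integral_eq)
qed

text \<open>Turns a bound for every choice of one point per index into a bound for the sum of the
  suprema. Each supremum is finite, a single term being at most the whole sum, and a point reaching
  half of it is chosen; this costs the factor 2.\<close>

lemma exists_common_majorant:
  fixes m :: "'i \<Rightarrow> real \<Rightarrow> real"
  assumes F: "finite F" and S: "S \<noteq> {}" and m: "\<And>n \<xi>. 0 \<le> m n \<xi>"
    and B: "\<And>\<xi>. (\<And>n. \<xi> n \<in> S) \<Longrightarrow> (\<Sum>n\<in>F. m n (\<xi> n)) \<le> B"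
  shows "\<exists>M. (\<forall>n. 0 \<le> M n) \<and> (\<forall>n\<in>F. \<forall>\<xi>\<in>S. m n \<xi> \<le> M n) \<and> (\<Sum>n\<in>F. M n) \<le> 2 * B"
proof -
  have ex: "\<exists>\<xi>. \<xi> \<in> S \<and> (n \<in> F \<longrightarrow> (\<forall>\<zeta>\<in>S. m n \<zeta> \<le> 2 * m n \<xi>))" for n
  proof (cases "n \<in> F \<and> (\<exists>\<zeta>\<in>S. m n \<zeta> > 0)")
    case True
    then obtain \<zeta>0 where \<zeta>0: "\<zeta>0 \<in> S" "m n \<zeta>0 > 0" and n: "n \<in> F" by blast
    have "m n \<zeta> \<le> B" if "\<zeta> \<in> S" for \<zeta>
    proof -
      have "m n \<zeta> \<le> (\<Sum>n\<in>F. m n \<zeta>)" using n F m by (intro member_le_sum) auto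
      also have "\<dots> \<le> B" using that by (rule B)
      finally show ?thesis .
    qed
    hence bdd: "bdd_above (m n ` S)" by (intro bdd_aboveI2)
    define s where "s = Sup (m n ` S)"
    have s: "m n \<zeta> \<le> s" if "\<zeta> \<in> S" for \<zeta> unfolding s_def using that bdd by (intro cSup_upper) auto
    have "s / 2 < s" using s[OF \<zeta>0(1)] \<zeta>0(2) by simp
    then obtain \<xi> where "\<xi> \<in> S" "s / 2 < m n \<xi>"
      using less_cSup_iff[OF _ bdd, of "s/2"] S unfolding s_def by auto
    thus ?thesis using s by (intro exI[of _ \<xi>]) force
  next
    case False
    obtain \<xi> where "\<xi> \<in> S" using S by blast
    moreover have "n \<in> F \<longrightarrow> (\<forall>\<zeta>\<in>S. m n \<zeta> \<le> 2 * m n \<xi>)"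
      using False m by (smt (verit))
    ultimately show ?thesis by blast
  qed
  then obtain \<xi> where \<xi>: "\<And>n. \<xi> n \<in> S" "\<And>n \<zeta>. n \<in> F \<Longrightarrow> \<zeta> \<in> S \<Longrightarrow> m n \<zeta> \<le> 2 * m n (\<xi> n)"
    by metis
  show ?thesis
    using \<xi> m B[of \<xi>] by (intro exI[of _ "\<lambda>n. 2 * m n (\<xi> n)"]) (simp add: sum_distrib_left[symmetric])
qed

text \<open>Collects what the L^2 argument uses of the power curve. In \<open>oscillation\<close>
  the frequency \<open>L1\<close> is arbitrary, since the frequencies attached to two different
  cells are unrelated.\<close>

locale oscillating_curve =
  fixes \<psi> \<gamma> :: "real \<Rightarrow> real" and X R c C0 :: real
  assumes cont_\<psi>: "continuous_on UNIV \<psi>" and cont_\<gamma>: "continuous_on UNIV \<gamma>"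
    and \<psi>_le: "\<And>s. \<bar>\<psi> s\<bar> \<le> X" and \<gamma>_le: "\<And>s. \<bar>\<gamma> s\<bar> \<le> R"
    and supp: "\<And>s. s \<notin> {0..c} \<Longrightarrow> \<psi> s = 0"
    and c_pos: "c > 0" and C0_pos: "C0 > 0"
    and oscillation: "\<And>L1 L2 r. L2 \<noteq> 0 \<Longrightarrow> r \<noteq> 0 \<Longrightarrow>
      norm (LINT s|lborel. cis (L1 * \<gamma> s - L2 * \<gamma> (s + r)) * of_real (\<psi> s * \<psi> (s + r))) \<le> C0 / sqrt \<bar>L2 * r\<bar>"
begin

lemma X_nonneg: "X \<ge> 0" using \<psi>_le[of 0] by linarith
lemma R_nonneg: "R \<ge> 0" using \<gamma>_le[of 0] by linarith

lemma \<psi>_compose [continuous_intros]: "continuous_on S f \<Longrightarrow> continuous_on S (\<lambda>x. \<psi> (f x))"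
  by (rule continuous_on_compose2[OF cont_\<psi>]) auto

lemma \<gamma>_compose [continuous_intros]: "continuous_on S f \<Longrightarrow> continuous_on S (\<lambda>x. \<gamma> (f x))"
  by (rule continuous_on_compose2[OF cont_\<gamma>]) auto

lemma meas_\<psi> [measurable]: "\<psi> \<in> borel_measurable borel"
  by (intro borel_measurable_continuous_onI cont_\<psi>)

lemma meas_\<gamma> [measurable]: "\<gamma> \<in> borel_measurable borel"
  by (intro borel_measurable_continuous_onI cont_\<gamma>)

text \<open>The substitution y = u - N s writes the multiplier at (u, \<xi>) as the pairing of
  \<open>p\<close> with this function of y, which is the form the large sieve needs. The factor 1 /
  N is the Jacobian.\<close>

definition kern :: "real \<Rightarrow> real \<Rightarrow> real \<Rightarrow> real \<Rightarrow> complex" where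
  "kern N u \<xi> y = of_real (\<psi> ((u - y) / N) / N) * cis (- \<xi> * N * \<gamma> ((u - y) / N))"

definition multiplier :: "real \<Rightarrow> (real \<Rightarrow> complex) \<Rightarrow> real \<Rightarrow> real \<Rightarrow> complex" where
  "multiplier N p u \<xi> = (LINT s|lborel. p (u - N * s) * cis (- \<xi> * N * \<gamma> s) * of_real (\<psi> s))"

lemma multiplier_eq_kern:
  assumes "N > 0"
  shows "(LINT y|lborel. p y * kern N u \<xi> y) = multiplier N p u \<xi>"
proof -
  have "(LINT y|lborel. p y * kern N u \<xi> y) = \<bar>-N\<bar> *\<^sub>R (LINT s|lborel. p (u + -N * s) * kern N u \<xi> (u + -N * s))"
    by (rule lborel_integral_real_affine) (use assms in simp)
  also have "\<dots> = (LINT s|lborel. of_real N * (p (u + -N * s) * kern N u \<xi> (u + -N * s)))"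
    using assms by (simp add: scaleR_conv_of_real)
  also have "\<dots> = multiplier N p u \<xi>"
    unfolding multiplier_def
    using assms by (intro Bochner_Integration.integral_cong) (auto simp: kern_def mult_ac)
  finally show ?thesis .
qed

lemma test_fun_kern:
  assumes "N > 0"
  shows "test_fun (kern N u \<xi>)"
  unfolding test_fun_def
proof (intro conjI exI allI impI)
  show "continuous_on UNIV (kern N u \<xi>)"
    unfolding kern_def[abs_def] using assms by (intro continuous_intros) auto
  fix y assume "kern N u \<xi> y \<noteq> 0"
  hence "(u - y) / N \<in> {0..c}" using supp by (force simp: kern_def)
  hence "0 \<le> u - y" "u - y \<le> N * c" using assms by (auto simp: field_simps)
  thus "\<bar>y\<bar> \<le> \<bar>u\<bar> + N * c" using assms c_pos by (auto simp: abs_if)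
qed

lemma gram_eq:
  assumes N: "N > 0"
  shows "(LINT y|lborel. kern N u \<xi> y * cnj (kern N u' \<xi>' y)) =
    of_real (1 / N) * (LINT s|lborel. cis (- \<xi> * N * \<gamma> s - - \<xi>' * N * \<gamma> (s + (u' - u) / N)) * of_real (\<psi> s * \<psi> (s + (u' - u) / N)))"
proof -
  have "(LINT y|lborel. kern N u \<xi> y * cnj (kern N u' \<xi>' y)) =
     \<bar>-N\<bar> *\<^sub>R (LINT s|lborel. kern N u \<xi> (u + -N * s) * cnj (kern N u' \<xi>' (u + -N * s)))"
    by (rule lborel_integral_real_affine) (use assms in simp)
  also have "\<dots> = of_real N * (LINT s|lborel. of_real (1/N) * of_real (1/N) * (cis (- \<xi> * N * \<gamma> s - - \<xi>' * N * \<gamma> (s + (u' - u) / N)) * of_real (\<psi> s * \<psi> (s + (u' - u) / N))))"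
  proof -
    have "kern N u \<xi> (u + -N * s) * cnj (kern N u' \<xi>' (u + -N * s)) =
      of_real (1/N) * of_real (1/N) * (cis (- \<xi> * N * \<gamma> s - - \<xi>' * N * \<gamma> (s + (u' - u) / N)) * of_real (\<psi> s * \<psi> (s + (u' - u) / N)))" for s
    proof -
      have e1: "(u - (u + -N * s)) / N = s" using N by simp
      have e2: "(u' - (u + -N * s)) / N = s + (u' - u) / N" using N by (simp add: field_simps)
      have e3: "cis (a - b) = cis a * cnj (cis b)" for a b by (simp add: cis_cnj cis_mult)
      show ?thesis unfolding kern_def e1 e2 e3 by simp
    qed
    thus ?thesis using N by (simp only: scaleR_conv_of_real) simp
  qed
  also have "\<dots> = of_real (1 / N) * (LINT s|lborel. cis (- \<xi> * N * \<gamma> s - - \<xi>' * N * \<gamma> (s + (u' - u) / N)) * of_real (\<psi> s * \<psi> (s + (u' - u) / N)))"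
    using N by (simp only: integral_mult_right_zero) (simp add: mult.assoc[symmetric])
  finally show ?thesis .
qed

lemma gram_zero:
  assumes N: "N > 0" and "\<bar>u' - u\<bar> > N * c"
  shows "(LINT y|lborel. kern N u \<xi> y * cnj (kern N u' \<xi>' y)) = 0"
proof -
  have "\<psi> s * \<psi> (s + (u' - u) / N) = 0" for s
  proof (rule ccontr)
    assume "\<not> ?thesis"
    hence "s \<in> {0..c}" "s + (u' - u) / N \<in> {0..c}" using supp by force+
    hence "\<bar>(u' - u) / N\<bar> \<le> c" by auto
    thus False using assms by (simp add: field_simps)
  qed
  thus ?thesis unfolding gram_eq[OF N] by (simp only:) simp
qed

lemma gram_le:
  assumes N: "N > 0"
  shows "norm (LINT y|lborel. kern N u \<xi> y * cnj (kern N u' \<xi>' y)) \<le> X\<^sup>2 * c / N"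
proof -
  have int: "integrable lborel (\<lambda>s. indicator {0..c} s * X\<^sup>2)"
    by (intro integrable_mult_left) (use c_pos in \<open>simp add: integrable_indicator_iff\<close>)
  have "norm (LINT s|lborel. cis (- \<xi> * N * \<gamma> s - - \<xi>' * N * \<gamma> (s + (u' - u) / N)) * of_real (\<psi> s * \<psi> (s + (u' - u) / N)))
     \<le> (LINT s|lborel. indicator {0..c} s * X\<^sup>2)"
  proof (rule norm_LINT_le[OF int])
    fix s
    have "\<bar>\<psi> s\<bar> * \<bar>\<psi> (s + (u' - u) / N)\<bar> \<le> X * X"
      by (intro mult_mono \<psi>_le X_nonneg abs_ge_zero)
    thus "norm (cis (- \<xi> * N * \<gamma> s - - \<xi>' * N * \<gamma> (s + (u' - u) / N)) * of_real (\<psi> s * \<psi> (s + (u' - u) / N))) \<le> indicator {0..c} s * X\<^sup>2"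
      using supp[of s] by (cases "s \<in> {0..c}") (simp_all add: norm_mult power2_eq_square)
  qed
  also have "\<dots> = X\<^sup>2 * c" using c_pos by simp
  finally have le: "norm (LINT s|lborel. cis (- \<xi> * N * \<gamma> s - - \<xi>' * N * \<gamma> (s + (u' - u) / N)) * of_real (\<psi> s * \<psi> (s + (u' - u) / N))) \<le> X\<^sup>2 * c" .
  have n: "norm (complex_of_real (1 / N)) = 1 / N" using N by (simp add: norm_divide)
  show ?thesis
    unfolding gram_eq[OF N] norm_mult n using mult_left_mono[OF le, of "1 / N"] N by simp
qed

text \<open>By \<open>gram_eq\<close> the inner product is an oscillatory integral with L2 = -
  \<xi>' N and shift r = (u' - u) / N. In the product L2 r the factor N cancels.\<close>

lemma gram_oscillation:
  assumes N: "N > 0" and "u \<noteq> u'" "\<xi>' \<noteq> 0"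
  shows "norm (LINT y|lborel. kern N u \<xi> y * cnj (kern N u' \<xi>' y)) \<le> C0 / (N * sqrt (\<bar>\<xi>'\<bar> * \<bar>u' - u\<bar>))"
proof -
  have "norm (LINT s|lborel. cis (- \<xi> * N * \<gamma> s - - \<xi>' * N * \<gamma> (s + (u' - u) / N)) * of_real (\<psi> s * \<psi> (s + (u' - u) / N)))
     \<le> C0 / sqrt \<bar>- \<xi>' * N * ((u' - u) / N)\<bar>"
    by (rule oscillation) (use assms in auto)
  also have "\<bar>- \<xi>' * N * ((u' - u) / N)\<bar> = \<bar>\<xi>'\<bar> * \<bar>u' - u\<bar>"
    using N by (simp add: abs_mult)
  finally have le: "norm (LINT s|lborel. cis (- \<xi> * N * \<gamma> s - - \<xi>' * N * \<gamma> (s + (u' - u) / N)) * of_real (\<psi> s * \<psi> (s + (u' - u) / N)))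
     \<le> C0 / sqrt (\<bar>\<xi>'\<bar> * \<bar>u' - u\<bar>)" .
  have n: "norm (complex_of_real (1 / N)) = 1 / N" using N by (simp add: norm_divide)
  show ?thesis
    unfolding gram_eq[OF N] norm_mult n using mult_left_mono[OF le, of "1 / N"] N by simp
qed

text \<open>About 2 N c + 1 cells have overlapping kernels and each pair contributes at most X^2 c /
  N, so the row is bounded uniformly in N but without decay. This is the estimate for the low
  frequencies.\<close>

lemma gram_row_le:
  fixes F :: "int set"
  assumes N: "N \<ge> 1" and F: "finite F"
  shows "(\<Sum>j\<in>F. norm (LINT y|lborel. kern N (real_of_int i + v) (\<xi> i) y * cnj (kern N (real_of_int j + v) (\<xi> j) y)))
    \<le> X\<^sup>2 * c * (2 * c + 1)"
proof -
  let ?g = "\<lambda>j. norm (LINT y|lborel. kern N (real_of_int i + v) (\<xi> i) y * cnj (kern N (real_of_int j + v) (\<xi> j) y))"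
  have "(\<Sum>j\<in>F. ?g j) \<le> (\<Sum>j\<in>F. if \<bar>real_of_int i - real_of_int j\<bar> \<le> N * c then X\<^sup>2 * c / N else 0)"
  proof (rule sum_mono)
    fix j
    show "?g j \<le> (if \<bar>real_of_int i - real_of_int j\<bar> \<le> N * c then X\<^sup>2 * c / N else 0)"
      using gram_zero[of N "real_of_int j + v" "real_of_int i + v" "\<xi> i" "\<xi> j"]
        gram_le[of N "real_of_int i + v" "\<xi> i" "real_of_int j + v" "\<xi> j"] N by (auto simp: abs_minus_commute)
  qed
  also have "\<dots> = (\<Sum>j\<in>{j\<in>F. \<bar>real_of_int i - real_of_int j\<bar> \<le> N * c}. X\<^sup>2 * c / N)"
    by (rule sum.inter_filter[OF F, symmetric])
  also have "\<dots> = real (card {j\<in>F. \<bar>real_of_int i - real_of_int j\<bar> \<le> N * c}) * (X\<^sup>2 * c / N)"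
    by simp
  also have "\<dots> \<le> (2 * (N * c) + 1) * (X\<^sup>2 * c / N)"
    using N c_pos by (intro mult_right_mono card_int_near_le) auto
  also have "\<dots> = X\<^sup>2 * c * (2 * c + 1 / N)" using N by (simp add: field_simps)
  also have "\<dots> \<le> X\<^sup>2 * c * (2 * c + 1)" using N c_pos by (intro mult_left_mono) auto
  finally show ?thesis .
qed

text \<open>The diagonal contributes X^2 c / N. Off the diagonal the oscillation gives C0 / (N sqrt
  (\<theta> |j - i|)), and summing 1 / sqrt |j - i| over |j - i| <= N c yields a multiple of sqrt (N
  c). For bounded \<theta> the row is thus of order (N \<theta>)^(-1/2).\<close>

lemma gram_row_high_le:
  fixes F :: "int set"
  assumes N: "N \<ge> 1" and F: "finite F" and \<theta>: "\<theta> > 0" "\<And>n. \<bar>\<xi> n\<bar> \<ge> \<theta>"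
  shows "(\<Sum>j\<in>F. norm (LINT y|lborel. kern N (real_of_int i + v) (\<xi> i) y * cnj (kern N (real_of_int j + v) (\<xi> j) y)))
    \<le> (X\<^sup>2 * c + 4 * C0 * sqrt (N * c / \<theta>)) / N"
proof -
  let ?g = "\<lambda>j. norm (LINT y|lborel. kern N (real_of_int i + v) (\<xi> i) y * cnj (kern N (real_of_int j + v) (\<xi> j) y))"
  let ?J = "{j\<in>F. j \<noteq> i \<and> \<bar>real_of_int (j - i)\<bar> \<le> N * c}"
  have "(\<Sum>j\<in>F. ?g j) \<le> (\<Sum>j\<in>F. (if j = i then X\<^sup>2 * c / N else 0) +
      (if j \<noteq> i \<and> \<bar>real_of_int (j - i)\<bar> \<le> N * c then C0 / (N * sqrt \<theta>) * (1 / sqrt \<bar>real_of_int (j - i)\<bar>) else 0))"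
  proof (rule sum_mono)
    fix j
    show "?g j \<le> (if j = i then X\<^sup>2 * c / N else 0) +
      (if j \<noteq> i \<and> \<bar>real_of_int (j - i)\<bar> \<le> N * c then C0 / (N * sqrt \<theta>) * (1 / sqrt \<bar>real_of_int (j - i)\<bar>) else 0)"
    proof (cases "j = i")
      case True
      thus ?thesis using gram_le[of N "real_of_int i + v" "\<xi> i" "real_of_int j + v" "\<xi> j"] N by simp
    next
      case ne: False
      show ?thesis
      proof (cases "\<bar>real_of_int (j - i)\<bar> \<le> N * c")
        case False
        thus ?thesis using ne gram_zero[of N "real_of_int j + v" "real_of_int i + v" "\<xi> i" "\<xi> j"] N by simp
      next
        case True
        have nz: "\<xi> j \<noteq> 0" using \<theta>(2)[of j] \<theta>(1) by auto
        have "?g j \<le> C0 / (N * sqrt (\<bar>\<xi> j\<bar> * \<bar>real_of_int j + v - (real_of_int i + v)\<bar>))"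
          by (rule gram_oscillation) (use N ne nz in auto)
        also have "\<dots> \<le> C0 / (N * sqrt (\<theta> * \<bar>real_of_int (j - i)\<bar>))"
          using N \<theta> ne C0_pos nz
          by (intro divide_left_mono mult_left_mono mult_pos_pos) (auto intro!: mult_right_mono)
        also have "\<dots> = C0 / (N * sqrt \<theta>) * (1 / sqrt \<bar>real_of_int (j - i)\<bar>)"
          by (simp add: real_sqrt_mult)
        finally show ?thesis using True ne by simp
      qed
    qed
  qed
  also have "\<dots> = (\<Sum>j\<in>F. if j = i then X\<^sup>2 * c / N else 0) + (\<Sum>j\<in>?J. C0 / (N * sqrt \<theta>) * (1 / sqrt \<bar>real_of_int (j - i)\<bar>))"
    unfolding sum.distrib by (simp only: sum.inter_filter[OF F])
  also have "\<dots> \<le> X\<^sup>2 * c / N + C0 / (N * sqrt \<theta>) * (4 * sqrt (N * c))"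
  proof (rule add_mono)
    show "(\<Sum>j\<in>F. if j = i then X\<^sup>2 * c / N else 0) \<le> X\<^sup>2 * c / N"
      using F N c_pos by simp
    show "(\<Sum>j\<in>?J. C0 / (N * sqrt \<theta>) * (1 / sqrt \<bar>real_of_int (j - i)\<bar>)) \<le> C0 / (N * sqrt \<theta>) * (4 * sqrt (N * c))"
      unfolding sum_distrib_left[symmetric]
      using N C0_pos \<theta>(1) c_pos by (intro mult_left_mono sum_inverse_sqrt_int_le F) auto
  qed
  also have "\<dots> = (X\<^sup>2 * c + 4 * C0 * sqrt (N * c / \<theta>)) / N"
    by (simp add: real_sqrt_divide add_divide_distrib mult_ac)
  finally show ?thesis .
qed

text \<open>The row bound is assumed for every assignment of frequencies to cells. The large sieve
  can therefore be applied with a nearly extremal frequency in each cell, and the supremum over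
  \<open>S\<close> ends up inside the sum over \<open>n\<close>.\<close>

lemma multiplier_majorant:
  fixes F :: "int set"
  assumes N: "N \<ge> 1" and F: "finite F" and [measurable]: "p \<in> borel_measurable borel"
    and p: "integrable lborel (\<lambda>x. (norm (p x))\<^sup>2)"
    and S: "S \<noteq> {}" and B: "B > 0"
    and row: "\<And>\<xi> i. (\<And>n. \<xi> n \<in> S) \<Longrightarrow>
      (\<Sum>j\<in>F. norm (LINT y|lborel. kern N (real_of_int i + v) (\<xi> i) y * cnj (kern N (real_of_int j + v) (\<xi> j) y))) \<le> B"
  shows "\<exists>M. (\<forall>n. 0 \<le> M n) \<and> (\<forall>n\<in>F. \<forall>\<xi>\<in>S. (norm (multiplier N p (real_of_int n + v) \<xi>))\<^sup>2 \<le> M n)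
     \<and> (\<Sum>n\<in>F. M n) \<le> 2 * (B * (LINT x|lborel. (norm (p x))\<^sup>2))"
proof (rule exists_common_majorant[OF F S])
  fix \<xi> :: "int \<Rightarrow> real" assume \<xi>: "\<And>n. \<xi> n \<in> S"
  have N0: "N > 0" using N by simp
  have "(\<Sum>n\<in>F. (norm (LINT y|lborel. p y * kern N (real_of_int n + v) (\<xi> n) y))\<^sup>2) \<le> B * (LINT x|lborel. (norm (p x))\<^sup>2)"
    by (rule large_sieve[OF F _ p test_fun_kern[OF N0] B row[OF \<xi>]]) simp
  thus "(\<Sum>n\<in>F. (norm (multiplier N p (real_of_int n + v) (\<xi> n)))\<^sup>2) \<le> B * (LINT x|lborel. (norm (p x))\<^sup>2)"
    by (simp only: multiplier_eq_kern[OF N0])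
qed simp

end


section \<open>Fourier transforms of derivatives, and the L^2 estimate for one frozen form\<close>

lemma LINT_eq_integral_Icc_on:
  fixes g :: "real \<Rightarrow> complex"
  assumes "continuous_on {a..b} g" "\<And>x. x \<notin> {a..b} \<Longrightarrow> g x = 0"
  shows "(LINT x|lborel. g x) = integral {a..b} g"
proof -
  have "(LINT x|lborel. g x) = (LINT x|lborel. indicator {a..b} x *\<^sub>R g x)"
    using assms(2) by (intro Bochner_Integration.integral_cong) (auto simp: indicator_def)
  thus ?thesis
    using set_borel_integral_eq_integral(2)[OF borel_integrable_atLeastAtMost'[OF assms(1)]]
    by (simp add: set_lebesgue_integral_def)
qed

lemma LINT_eq_integral_Icc:
  fixes g :: "real \<Rightarrow> complex"
  assumes "continuous_on UNIV g" "\<And>x. x \<notin> {a..b} \<Longrightarrow> g x = 0"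
  shows "(LINT x|lborel. g x) = integral {a..b} g"
  by (rule LINT_eq_integral_Icc_on[OF continuous_on_subset[OF assms(1)] assms(2)]) auto

lemma continuous_on_LINT_param:
  fixes f :: "real \<Rightarrow> real \<Rightarrow> complex"
  assumes f: "continuous_on UNIV (\<lambda>(x,s). f x s)" and supp: "\<And>x s. s \<notin> {a..b} \<Longrightarrow> f x s = 0"
  shows "continuous_on UNIV (\<lambda>x. LINT s|lborel. f x s)"
proof -
  have "continuous_on UNIV (f x)" for x
    using continuous_on_compose2[OF f, of UNIV "\<lambda>s. (x, s)"] continuous_on_Pair[OF continuous_on_const continuous_on_id]
    by auto
  hence "(LINT s|lborel. f x s) = integral (cbox a b) (f x)" for x
    using LINT_eq_integral_Icc[of "f x" a b] supp by simp
  moreover have "continuous_on UNIV (\<lambda>x. integral (cbox a b) (f x))"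
    by (rule integral_continuous_on_param) (rule continuous_on_subset[OF f], auto)
  ultimately show ?thesis by simp
qed

text \<open>The vanishing integral is integration by parts on the whole line; it is applied to
  products with a character.\<close>

lemma test_fun_derivative:
  assumes g: "test_fun g" and g': "continuous_on UNIV g'"
    and d: "\<And>x. (g has_vector_derivative g' x) (at x)"
  shows "test_fun g'" and "(LINT x|lborel. g' x) = 0"
proof -
  obtain K where K: "K > 0" "\<And>x. \<bar>x\<bar> > K \<Longrightarrow> g x = 0" using test_funE[OF g] by metis
  have z: "g' x = 0" if "\<bar>x\<bar> > K" for x
  proof -
    have "open {x. \<bar>x\<bar> > K}" by (intro open_Collect_less continuous_intros)
    then have "((\<lambda>x. 0) has_vector_derivative g' x) (at x)"
      using has_vector_derivative_transform_within_open[OF d[of x], of "{x. \<bar>x\<bar> > K}" "\<lambda>x. 0"] that K(2) by auto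
    thus ?thesis using has_vector_derivative_const vector_derivative_unique_at by blast
  qed
  have "\<bar>x\<bar> \<le> K" if "g' x \<noteq> 0" for x using z[of x] that by linarith
  thus "test_fun g'" using g' by (auto simp: test_fun_def)
  \<comment> \<open>\<open>g\<close> is known to vanish only strictly beyond \<open>K\<close>, so
    the interval is taken up to \<open>K + 1\<close>.\<close>
  have "(LINT x|lborel. g' x) = integral {-(K+1)..K+1} g'"
    by (rule LINT_eq_integral_Icc[OF g']) (use z K(1) in auto)
  also have "\<dots> = g (K+1) - g (-(K+1))"
    by (rule integral_unique, rule fundamental_theorem_of_calculus) (use K(1) d in \<open>auto intro: has_vector_derivative_at_within\<close>)
  also have "\<dots> = 0" using K by simp
  finally show "(LINT x|lborel. g' x) = 0" .
qed

lemma has_vector_derivative_cis_linear: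
  "((\<lambda>x. cis (- x * \<xi>)) has_vector_derivative (- \<i> * of_real \<xi> * cis (- x * \<xi>))) (at x within S)"
proof -
  have *: "((\<lambda>x. - x * \<xi>) has_real_derivative - \<xi>) (at x within S)"
    by (auto intro!: derivative_eq_intros)
  show ?thesis
    unfolding cis_conv_exp
    using field_vector_diff_chain_within[OF has_vector_derivative_mult_right[OF has_vector_derivative_of_real[OF *], of \<i>]
          has_field_derivative_at_within[OF DERIV_exp]]
    by (simp add: scaleR_conv_of_real o_def mult_ac)
qed

lemma fourier_derivative:
  assumes g: "test_fun g" and g': "continuous_on UNIV g'"
    and d: "\<And>x. (g has_vector_derivative g' x) (at x)"
  shows "fourier g' \<xi> = \<i> * of_real \<xi> * fourier g \<xi>"
proof -
  have t': "test_fun g'" by (rule test_fun_derivative[OF g g' d])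
  have c: "continuous_on UNIV (\<lambda>x. cis (- x * \<xi>))" by (intro continuous_intros)
  have t1: "test_fun (\<lambda>x. cis (- x * \<xi>) * g x)" "test_fun (\<lambda>x. cis (- x * \<xi>) * g' x)"
    by (intro test_fun_mult g t' c)+
  have "(LINT x|lborel. cis (- x * \<xi>) * g' x + - \<i> * of_real \<xi> * cis (- x * \<xi>) * g x) = 0"
  proof (rule test_fun_derivative(2)[OF t1(1)])
    show "continuous_on UNIV (\<lambda>x. cis (- x * \<xi>) * g' x + - \<i> * of_real \<xi> * cis (- x * \<xi>) * g x)"
      by (intro continuous_intros g' test_fun_continuous[OF g])
    show "((\<lambda>x. cis (- x * \<xi>) * g x) has_vector_derivative cis (- x * \<xi>) * g' x + - \<i> * of_real \<xi> * cis (- x * \<xi>) * g x) (at x)" for x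
      by (rule has_vector_derivative_mult[OF has_vector_derivative_cis_linear d])
  qed
  also have "(LINT x|lborel. cis (- x * \<xi>) * g' x + - \<i> * of_real \<xi> * cis (- x * \<xi>) * g x) =
    (LINT x|lborel. cis (- x * \<xi>) * g' x) + (- \<i> * of_real \<xi>) * (LINT x|lborel. cis (- x * \<xi>) * g x)"
  proof (subst Bochner_Integration.integral_add)
    show "integrable lborel (\<lambda>x. - \<i> * of_real \<xi> * cis (- x * \<xi>) * g x)"
      using integrable_mult_right[OF test_fun_integrable[OF t1(1)], of "- \<i> * of_real \<xi>"] by (simp add: mult.assoc)
  qed (use test_fun_integrable[OF t1(2)] in \<open>simp_all add: mult.assoc\<close>)
  finally show ?thesis by (simp add: fourier_def mult.commute)
qed

context oscillating_curve
begin

definition frozen :: "real \<Rightarrow> (real \<Rightarrow> complex) \<Rightarrow> (real \<Rightarrow> complex) \<Rightarrow> real \<Rightarrow> real \<Rightarrow> complex" where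
  "frozen N p q u x = (LINT s|lborel. p (u - N * s) * q (x - N * \<gamma> s) * of_real (\<psi> s))"

lemma
  assumes p: "continuous_on UNIV p" and q: "test_fun q" and N: "N \<ge> 0"
  shows test_fun_frozen: "test_fun (frozen N p q u)"
    and fourier_frozen: "fourier (frozen N p q u) \<xi> = multiplier N p u \<xi> * fourier q \<xi>"
proof -
  obtain K where K: "K > 0" "\<And>x. \<bar>x\<bar> > K \<Longrightarrow> q x = 0" using test_funE[OF q] by metis
  have pc: "continuous_on S (\<lambda>x. p (f x))" if "continuous_on S f" for S :: "(real \<times> real) set" and f
    by (rule continuous_on_compose2[OF p that]) auto
  have qz: "q (x - N * \<gamma> s) = 0" if "\<bar>x\<bar> > K + N * R" for x s
  proof (rule K(2))
    have "\<bar>N * \<gamma> s\<bar> \<le> N * R" unfolding abs_mult using N by (simp add: mult_left_mono \<gamma>_le)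
    thus "\<bar>x - N * \<gamma> s\<bar> > K" using that by linarith
  qed
  have cont: "continuous_on UNIV (\<lambda>(x,s). p (u - N * s) * q (x - N * \<gamma> s) * of_real (\<psi> s))"
    unfolding case_prod_beta by (intro continuous_intros pc test_fun_compose_continuous[OF q])
  have "continuous_on UNIV (frozen N p q u)"
    unfolding frozen_def by (rule continuous_on_LINT_param[OF cont, of 0 c]) (simp add: supp)
  moreover have "\<bar>x\<bar> \<le> K + N * R" if "frozen N p q u x \<noteq> 0" for x
    using that qz[of x] by (force simp: frozen_def)
  ultimately show "test_fun (frozen N p q u)" by (auto simp: test_fun_def)
  have int: "integrable (lborel \<Otimes>\<^sub>M lborel) (\<lambda>(x,s). p (u - N * s) * q (x - N * \<gamma> s) * of_real (\<psi> s) * cis (- x * \<xi>))"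
    unfolding lborel_prod
  proof (rule integrable_continuous_compact_support[where S="{-(K + N * R)..K + N * R} \<times> {0..c}"])
    show "continuous_on UNIV (\<lambda>(x,s). p (u - N * s) * q (x - N * \<gamma> s) * of_real (\<psi> s) * cis (- x * \<xi>))"
      unfolding case_prod_beta by (intro continuous_intros pc test_fun_compose_continuous[OF q])
    fix z :: "real \<times> real" assume z: "z \<notin> {-(K + N * R)..K + N * R} \<times> {0..c}"
    obtain x s where [simp]: "z = (x,s)" by force
    from z have "\<bar>x\<bar> > K + N * R \<or> s \<notin> {0..c}" by auto
    thus "(case z of (x,s) \<Rightarrow> p (u - N * s) * q (x - N * \<gamma> s) * of_real (\<psi> s) * cis (- x * \<xi>)) = 0"
      using qz supp by auto
  qed (auto intro!: compact_Times)
  have "fourier (frozen N p q u) \<xi> = (LINT x|lborel. LINT s|lborel. p (u - N * s) * q (x - N * \<gamma> s) * of_real (\<psi> s) * cis (- x * \<xi>))"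
    by (simp add: fourier_def frozen_def)
  also have "\<dots> = (LINT s|lborel. LINT x|lborel. p (u - N * s) * q (x - N * \<gamma> s) * of_real (\<psi> s) * cis (- x * \<xi>))"
    using lborel_pair.Fubini_integral[OF int] by simp
  also have "\<dots> = (LINT s|lborel. p (u - N * s) * cis (- \<xi> * N * \<gamma> s) * of_real (\<psi> s) * fourier q \<xi>)"
  proof (rule Bochner_Integration.integral_cong[OF refl])
    fix s
    have "(LINT x|lborel. q (x - N * \<gamma> s) * cis (- x * \<xi>)) = (LINT y|lborel. q y * (cis (- \<xi> * N * \<gamma> s) * cis (- y * \<xi>)))"
      by (subst lborel_integral_real_affine[where c=1 and t="N * \<gamma> s"]) (simp_all add: cis_mult algebra_simps)
    also have "\<dots> = cis (- \<xi> * N * \<gamma> s) * fourier q \<xi>"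
      unfolding fourier_def integral_mult_right_zero[symmetric] by (simp add: mult.left_commute)
    finally have eq: "(LINT x|lborel. q (x - N * \<gamma> s) * cis (- x * \<xi>)) = cis (- \<xi> * N * \<gamma> s) * fourier q \<xi>" .
    have "(LINT x|lborel. p (u - N * s) * q (x - N * \<gamma> s) * of_real (\<psi> s) * cis (- x * \<xi>)) =
       (LINT x|lborel. (p (u - N * s) * of_real (\<psi> s)) * (q (x - N * \<gamma> s) * cis (- x * \<xi>)))"
      by (simp only: mult_ac)
    also have "\<dots> = (p (u - N * s) * of_real (\<psi> s)) * (LINT x|lborel. q (x - N * \<gamma> s) * cis (- x * \<xi>))"
      by (rule integral_mult_right_zero)
    finally show "(LINT x|lborel. p (u - N * s) * q (x - N * \<gamma> s) * of_real (\<psi> s) * cis (- x * \<xi>)) =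
       p (u - N * s) * cis (- \<xi> * N * \<gamma> s) * of_real (\<psi> s) * fourier q \<xi>"
      unfolding eq by (simp add: mult_ac)
  qed
  also have "\<dots> = multiplier N p u \<xi> * fourier q \<xi>" by (simp add: multiplier_def)
  finally show "fourier (frozen N p q u) \<xi> = multiplier N p u \<xi> * fourier q \<xi>" .
qed

text \<open>Plancherel with the frequencies split at \<open>\<theta>\<close>. Below
  \<open>\<theta>\<close> the identity q = g' - e bounds the transform of q by \<theta> times that
  of g plus that of e. The term \<open>e\<close> leaves room for the derivative of a window: it
  gains no power of \<theta> and has to be small by itself.\<close>

lemma frozen_L2_le:
  assumes p: "continuous_on UNIV p" and N: "N \<ge> 0" and \<theta>: "\<theta> \<ge> 0"
    and q: "test_fun q" and g: "test_fun g" and e: "test_fun e"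
    and d: "\<And>x. (g has_vector_derivative q x + e x) (at x)"
    and Mh: "\<And>\<xi>. \<bar>\<xi>\<bar> \<ge> \<theta> \<Longrightarrow> (norm (multiplier N p u \<xi>))\<^sup>2 \<le> Mh" "0 \<le> Mh"
    and Ml: "\<And>\<xi>. (norm (multiplier N p u \<xi>))\<^sup>2 \<le> Ml"
  shows "(LINT x|lborel. (norm (frozen N p q u x))\<^sup>2) \<le> Mh * (LINT x|lborel. (norm (q x))\<^sup>2) +
     Ml * (2 * \<theta>\<^sup>2 * (LINT x|lborel. (norm (g x))\<^sup>2) + 2 * (LINT x|lborel. (norm (e x))\<^sup>2))"
proof -
  have Ml0: "0 \<le> Ml" using order.trans[OF zero_le_power2 Ml] .
  have [measurable]: "q \<in> borel_measurable borel" "g \<in> borel_measurable borel" "e \<in> borel_measurable borel"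
    using q g e by (auto intro: test_fun_measurable)
  let ?I = "\<lambda>f. LINT x|lborel. (norm (f x))\<^sup>2"
  have I0: "0 \<le> ?I f" for f :: "real \<Rightarrow> complex" by simp
  have fq: "fourier q \<xi> = \<i> * of_real \<xi> * fourier g \<xi> - fourier e \<xi>" for \<xi>
  proof -
    have cqe: "continuous_on UNIV (\<lambda>x. q x + e x)"
      by (intro continuous_intros test_fun_continuous q e)
    have i: "integrable lborel (\<lambda>x. q x * cis (- x * \<xi>))" "integrable lborel (\<lambda>x. e x * cis (- x * \<xi>))"
      using test_fun_integrable[OF test_fun_mult[OF q, of "\<lambda>x. cis (- x * \<xi>)"]]
        test_fun_integrable[OF test_fun_mult[OF e, of "\<lambda>x. cis (- x * \<xi>)"]]
      by (simp_all add: mult.commute continuous_on_cis_compose continuous_intros)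
    have "fourier (\<lambda>x. q x + e x) \<xi> = \<i> * of_real \<xi> * fourier g \<xi>"
      by (rule fourier_derivative[OF g cqe d])
    moreover have "fourier (\<lambda>x. q x + e x) \<xi> = fourier q \<xi> + fourier e \<xi>"
      unfolding fourier_def using i by (simp add: distrib_right)
    ultimately show ?thesis by (simp add: eq_diff_eq)
  qed
  have pw: "(norm (fourier (frozen N p q u) \<xi>))\<^sup>2 \<le> Mh * (norm (fourier q \<xi>))\<^sup>2 + (Ml * (2 * \<theta>\<^sup>2) * (norm (fourier g \<xi>))\<^sup>2 + Ml * 2 * (norm (fourier e \<xi>))\<^sup>2)" for \<xi>
  proof (cases "\<bar>\<xi>\<bar> \<ge> \<theta>")
    case True
    have "(norm (fourier (frozen N p q u) \<xi>))\<^sup>2 \<le> Mh * (norm (fourier q \<xi>))\<^sup>2"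
      unfolding fourier_frozen[OF p q N] norm_mult power_mult_distrib by (intro mult_right_mono Mh(1)[OF True]) simp
    moreover have "0 \<le> Ml * (2 * \<theta>\<^sup>2) * (norm (fourier g \<xi>))\<^sup>2 + Ml * 2 * (norm (fourier e \<xi>))\<^sup>2" using Ml0 by simp
    ultimately show ?thesis by linarith
  next
    case False
    have "norm (fourier q \<xi>) \<le> \<theta> * norm (fourier g \<xi>) + norm (fourier e \<xi>)"
    proof -
      have "norm (fourier q \<xi>) \<le> norm (\<i> * of_real \<xi> * fourier g \<xi>) + norm (fourier e \<xi>)"
        unfolding fq by (rule norm_triangle_ineq4)
      also have "norm (\<i> * of_real \<xi> * fourier g \<xi>) \<le> \<theta> * norm (fourier g \<xi>)"
        using False by (simp add: norm_mult mult_right_mono)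
      finally show ?thesis by simp
    qed
    hence "(norm (fourier q \<xi>))\<^sup>2 \<le> (\<theta> * norm (fourier g \<xi>) + norm (fourier e \<xi>))\<^sup>2"
      by (intro power_mono) auto
    also have "\<dots> \<le> 2 * (\<theta> * norm (fourier g \<xi>))\<^sup>2 + 2 * (norm (fourier e \<xi>))\<^sup>2"
      using sum_squares_bound[of "\<theta> * norm (fourier g \<xi>)" "norm (fourier e \<xi>)"] by (simp add: power2_sum)
    finally have "Ml * (norm (fourier q \<xi>))\<^sup>2 \<le> Ml * (2 * (\<theta> * norm (fourier g \<xi>))\<^sup>2 + 2 * (norm (fourier e \<xi>))\<^sup>2)"
      using Ml0 by (rule mult_left_mono)
    moreover have "(norm (fourier (frozen N p q u) \<xi>))\<^sup>2 \<le> Ml * (norm (fourier q \<xi>))\<^sup>2"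
      unfolding fourier_frozen[OF p q N] norm_mult power_mult_distrib by (intro mult_right_mono Ml) simp
    moreover have "0 \<le> Mh * (norm (fourier q \<xi>))\<^sup>2" using Mh(2) by simp
    ultimately show ?thesis by (simp add: power_mult_distrib algebra_simps)
  qed
  have "ennreal (2 * pi * ?I (frozen N p q u)) = (\<integral>\<^sup>+\<xi>. ennreal ((norm (fourier (frozen N p q u) \<xi>))\<^sup>2) \<partial>lborel)"
    by (rule plancherel[OF test_fun_frozen[OF p q N], symmetric])
  also have "\<dots> \<le> (\<integral>\<^sup>+\<xi>. ennreal Mh * ennreal ((norm (fourier q \<xi>))\<^sup>2) + (ennreal (Ml * (2 * \<theta>\<^sup>2)) * ennreal ((norm (fourier g \<xi>))\<^sup>2) + ennreal (Ml * 2) * ennreal ((norm (fourier e \<xi>))\<^sup>2)) \<partial>lborel)"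
  proof (rule nn_integral_mono)
    fix \<xi>
    have "ennreal ((norm (fourier (frozen N p q u) \<xi>))\<^sup>2) \<le> ennreal (Mh * (norm (fourier q \<xi>))\<^sup>2 + (Ml * (2 * \<theta>\<^sup>2) * (norm (fourier g \<xi>))\<^sup>2 + Ml * 2 * (norm (fourier e \<xi>))\<^sup>2))"
      by (rule ennreal_leI[OF pw])
    also have "\<dots> = ennreal Mh * ennreal ((norm (fourier q \<xi>))\<^sup>2) + (ennreal (Ml * (2 * \<theta>\<^sup>2)) * ennreal ((norm (fourier g \<xi>))\<^sup>2) + ennreal (Ml * 2) * ennreal ((norm (fourier e \<xi>))\<^sup>2))"
      using Ml0 Mh(2) by (simp add: ennreal_plus ennreal_mult)
    finally show "ennreal ((norm (fourier (frozen N p q u) \<xi>))\<^sup>2) \<le> ennreal Mh * ennreal ((norm (fourier q \<xi>))\<^sup>2) + (ennreal (Ml * (2 * \<theta>\<^sup>2)) * ennreal ((norm (fourier g \<xi>))\<^sup>2) + ennreal (Ml * 2) * ennreal ((norm (fourier e \<xi>))\<^sup>2))" .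
  qed
  also have "\<dots> = ennreal Mh * ennreal (2 * pi * ?I q) + (ennreal (Ml * (2 * \<theta>\<^sup>2)) * ennreal (2 * pi * ?I g) + ennreal (Ml * 2) * ennreal (2 * pi * ?I e))"
    by (simp add: nn_integral_add nn_integral_cmult plancherel[OF q] plancherel[OF g] plancherel[OF e])
  also have "\<dots> = ennreal (2 * pi * (Mh * ?I q + Ml * (2 * \<theta>\<^sup>2 * ?I g + 2 * ?I e)))"
    using Ml0 Mh(2) I0 by (simp add: ennreal_mult[symmetric] ennreal_plus[symmetric] del: ennreal_plus) (simp add: algebra_simps)
  finally have "2 * pi * ?I (frozen N p q u) \<le> 2 * pi * (Mh * ?I q + Ml * (2 * \<theta>\<^sup>2 * ?I g + 2 * ?I e))"
    using Ml0 Mh(2) I0 by (subst (asm) ennreal_le_iff) (auto intro!: mult_nonneg_nonneg add_nonneg_nonneg)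
  thus ?thesis by simp
qed

end


section \<open>Localisation to the cells and summation over them\<close>

lemma L2_norm_nonneg [simp]: "0 \<le> L2_norm f"
  by (simp add: L2_norm_def)

text \<open>The window is abstract here. Later it is the given function \<Theta> itself, which has
  exactly these properties.\<close>

locale localized_curve = oscillating_curve +
  fixes \<zeta> \<zeta>' :: "real \<Rightarrow> real" and Z :: real
  assumes d\<zeta>: "\<And>x. (\<zeta> has_real_derivative \<zeta>' x) (at x)" and cont_\<zeta>': "continuous_on UNIV \<zeta>'"
    and \<zeta>_le: "\<And>x. \<bar>\<zeta> x\<bar> \<le> Z" and \<zeta>'_le: "\<And>x. \<bar>\<zeta>' x\<bar> \<le> Z"
    and \<zeta>_one: "\<And>x. \<bar>x\<bar> \<le> 1/2 \<Longrightarrow> \<zeta> x = 1"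
    and \<zeta>_zero: "\<And>x. \<bar>x\<bar> > 1 \<Longrightarrow> \<zeta> x = 0" and \<zeta>'_zero: "\<And>x. \<bar>x\<bar> > 1 \<Longrightarrow> \<zeta>' x = 0"
begin

text \<open>On a cell the argument of the window before division by \<open>L\<close> is at most 1 +
  R in absolute value; the factor 2 brings the quotient into [-1/2, 1/2], where the window equals
  1.\<close>

definition "L = 2 * (1 + R)"
definition "V = Z\<^sup>2 * (2 * L + 1)"
definition "b\<^sub>h = X\<^sup>2 * c + 4 * C0 * sqrt c"
text \<open>The summand 1 makes this row bound positive, because \<open>large_sieve\<close> divides
  by it.\<close>

definition "b\<^sub>l = X\<^sup>2 * c * (2 * c + 1) + 1"
text \<open>The contributions of the high and of the low frequencies. The factor 2 in each comes
  from \<open>multiplier_majorant\<close>; the remaining 4 in 8 comes from the low-frequency terms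
  \<open>g\<close> and \<open>e\<close>, which contribute 2 each.\<close>

definition "Kf = sqrt (2 * b\<^sub>h * V) + sqrt (8 * b\<^sub>l * V)"

lemma L_ge: "L \<ge> 2" using R_nonneg by (simp add: L_def)
lemma V_nonneg: "V \<ge> 0" using L_ge by (simp add: V_def)
lemma bh_pos: "b\<^sub>h > 0" using c_pos C0_pos by (simp add: b\<^sub>h_def add_nonneg_pos)
lemma bl_pos: "b\<^sub>l > 0" using c_pos by (simp add: b\<^sub>l_def add_nonneg_pos)
lemma Kf_nonneg: "Kf \<ge> 0" using V_nonneg bh_pos bl_pos by (simp add: Kf_def)

lemma cont_\<zeta>: "continuous_on UNIV \<zeta>"
  using d\<zeta> by (intro DERIV_continuous_on) (auto intro: has_field_derivative_at_within)

lemma test_fun_window: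
  assumes A: "A > 0" and f: "continuous_on UNIV f" and f0: "\<And>x. \<bar>x\<bar> > 1 \<Longrightarrow> f x = (0::real)"
    and G: "continuous_on UNIV G"
  shows "test_fun (\<lambda>y. of_real (f ((A * y - u) / L)) * G y)"
proof -
  have "continuous_on UNIV (\<lambda>y. f ((A * y - u) / L))"
    using L_ge by (intro continuous_on_compose2[OF f] continuous_intros) auto
  hence "continuous_on UNIV (\<lambda>y. of_real (f ((A * y - u) / L)) * G y)"
    by (intro continuous_intros G)
  moreover have "\<bar>y\<bar> \<le> (L + \<bar>u\<bar>) / A" if "f ((A * y - u) / L) \<noteq> 0" for y
  proof -
    have "\<bar>(A * y - u) / L\<bar> \<le> 1" using f0[of "(A * y - u) / L"] that by linarith
    hence "\<bar>A * y - u\<bar> \<le> L" using L_ge by (simp add: field_simps)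
    hence "\<bar>A * y\<bar> \<le> L + \<bar>u\<bar>" by linarith
    thus ?thesis using A by (simp add: abs_mult field_simps)
  qed
  ultimately show ?thesis unfolding test_fun_def by auto
qed

text \<open>As A N <= 1, the shift N \<gamma>(s) changes A x by at most R, and A x itself is within
  1 of n + v. Hence on this cell \<open>Q\<close> is evaluated only where the window equals
  1.\<close>

lemma frozen_window:
  assumes N: "N \<ge> 0" and A: "A \<ge> 0" "A * N \<le> 1" and v: "v \<in> {0..1}"
    and x: "real_of_int n \<le> A * x" "A * x \<le> real_of_int n + 1"
  shows "frozen N p (\<lambda>y. of_real (\<zeta> ((A * y - (real_of_int n + v)) / L)) * Q y) (real_of_int n + v) x
    = frozen N p Q (real_of_int n + v) x"
proof -
  have "\<zeta> ((A * (x - N * \<gamma> s) - (real_of_int n + v)) / L) = 1" for s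
  proof (rule \<zeta>_one)
    have "\<bar>A * N * \<gamma> s\<bar> \<le> 1 * R" unfolding abs_mult using A N \<gamma>_le[of s] by (intro mult_mono) (auto simp: abs_mult)
    hence "\<bar>A * (x - N * \<gamma> s) - (real_of_int n + v)\<bar> \<le> 1 + R"
      using x v by (auto simp: algebra_simps)
    thus "\<bar>(A * (x - N * \<gamma> s) - (real_of_int n + v)) / L\<bar> \<le> 1/2"
      using R_nonneg by (simp add: L_def field_simps)
  qed
  thus ?thesis by (simp add: frozen_def)
qed

text \<open>With \<theta> = N^(-1/2) one has sqrt (N / \<theta>) / N = N^(3/4 - 1). Writing
  everything in t = N^(1/4) makes the exponents integers.\<close>

lemma high_bound_simplify:
  assumes N: "N \<ge> 1"
  shows "(X\<^sup>2 * c + 4 * C0 * sqrt (N * c / (1 / sqrt N))) / N \<le> b\<^sub>h * N powr (-1/4)"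
    and "1 / N \<le> N powr (-1/4)"
proof -
  define t where "t = N powr (1/4)"
  have t1: "t \<ge> 1" using N by (simp add: t_def ge_one_powr_ge_zero)
  have t4: "N = t ^ 4" using N by (simp add: t_def powr_power)
  have t2: "sqrt N = t\<^sup>2"
    unfolding t4 using t1 by (intro real_sqrt_unique) auto
  have \<nu>: "N powr (-1/4) = 1 / t" using N by (simp add: t_def powr_minus_divide)
  have 1: "1 / N \<le> 1 / t" unfolding t4 using t1 self_le_power[of t 4] by (simp add: field_simps)
  thus "1 / N \<le> N powr (-1/4)" by (simp only: \<nu>)
  have "sqrt (N * c / (1 / sqrt N)) = sqrt c * t ^ 3"
  proof (rule real_sqrt_unique)
    have "N * c / (1 / sqrt N) = c * (t ^ 4 * t\<^sup>2)" unfolding t2 by (simp add: t4)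
    also have "\<dots> = (sqrt c * t ^ 3)\<^sup>2" using c_pos by (simp add: power_mult_distrib flip: power_mult power_add)
    finally show "(sqrt c * t ^ 3)\<^sup>2 = N * c / (1 / sqrt N)" by simp
  qed (use c_pos t1 in simp)
  hence "(X\<^sup>2 * c + 4 * C0 * sqrt (N * c / (1 / sqrt N))) / N = X\<^sup>2 * c * (1 / N) + 4 * C0 * sqrt c * (t ^ 3 / t ^ 4)"
    by (simp add: add_divide_distrib t4)
  also have "t ^ 3 / t ^ 4 = 1 / t" using t1 by (simp add: field_simps power_numeral_reduce)
  also have "X\<^sup>2 * c * (1 / N) + 4 * C0 * sqrt c * (1 / t) \<le> X\<^sup>2 * c * (1 / t) + 4 * C0 * sqrt c * (1 / t)"
    using 1 c_pos by (intro add_right_mono mult_left_mono) auto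
  also have "\<dots> = b\<^sub>h * N powr (-1/4)" unfolding \<nu> by (simp add: b\<^sub>h_def add_divide_distrib)
  finally show "(X\<^sup>2 * c + 4 * C0 * sqrt (N * c / (1 / sqrt N))) / N \<le> b\<^sub>h * N powr (-1/4)" .
qed

text \<open>Cauchy-Schwarz over the cells pairs the multiplier majorants, summed by the large sieve,
  with the local energies, summed by bounded overlap. The square root halves the exponent, from
  N^(-1/4) to N^(-1/8).\<close>

lemma frozen_sum_L2:
  fixes F :: "int set"
  assumes N: "N \<ge> 1" and A: "A > 0" "A * N \<le> 1" and F: "finite F"
    and p: "continuous_on UNIV p" "integrable lborel (\<lambda>x. (norm (p x))\<^sup>2)"
    and Q: "continuous_on UNIV Q" "integrable lborel (\<lambda>x. (norm (Q x))\<^sup>2)"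
    and H: "\<And>x. (H has_vector_derivative Q x) (at x)" "integrable lborel (\<lambda>x. (norm (H x))\<^sup>2)"
  shows "(\<Sum>n\<in>F. sqrt (LINT x|lborel. (norm (frozen N p (\<lambda>y. of_real (\<zeta> ((A * y - (real_of_int n + v)) / L)) * Q y) (real_of_int n + v) x))\<^sup>2))
    \<le> Kf * N powr (-1/8) * L2_norm p * (L2_norm Q + L2_norm H)"
proof -
  let ?I = "\<lambda>f. LINT x|lborel. (norm (f x))\<^sup>2"
  have I0: "0 \<le> ?I f" for f :: "real \<Rightarrow> complex" by simp
  have cH: "continuous_on UNIV H"
    using H(1) by (meson continuous_at_imp_continuous_on has_vector_derivative_continuous)
  have [measurable]: "p \<in> borel_measurable borel" "Q \<in> borel_measurable borel" "H \<in> borel_measurable borel"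
    "\<zeta> \<in> borel_measurable borel" "\<zeta>' \<in> borel_measurable borel"
    using p(1) Q(1) cH cont_\<zeta> cont_\<zeta>' by (auto intro: borel_measurable_continuous_onI)
  \<comment> \<open>The high frequencies gain (N \<theta>)^(-1/2) = N^(-1/4) and the low ones
    \<theta>^2 = 1/N, so the high ones decide the rate. The threshold is a convenient choice, not
    the one that balances the two.\<close>
  define \<theta> where "\<theta> = 1 / sqrt N"
  define \<nu> where "\<nu> = N powr (-1/4)"
  have \<theta>: "\<theta> > 0" "\<theta>\<^sup>2 = 1 / N" using N by (auto simp: \<theta>_def power_divide)
  have \<nu>: "\<nu> > 0" "1 / N \<le> \<nu>" using N high_bound_simplify(2)[OF N] by (auto simp: \<nu>_def)
  have N0: "N \<ge> 0" using N by simp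
  define q where "q n y = of_real (\<zeta> ((A * y - (real_of_int n + v)) / L)) * Q y" for n y
  \<comment> \<open>The windowed primitive. Its derivative is \<open>q\<close> plus the term
    \<open>e\<close> in which the derivative falls on the window.\<close>
  define g where "g n y = of_real (\<zeta> ((A * y - (real_of_int n + v)) / L)) * H y" for n y
  define e0 where "e0 n y = of_real (\<zeta>' ((A * y - (real_of_int n + v)) / L)) * H y" for n y
  define e where "e n y = of_real (A / L) * e0 n y" for n y
  have tq: "test_fun (q n)" for n unfolding q_def by (intro test_fun_window A cont_\<zeta> \<zeta>_zero Q)
  have tg: "test_fun (g n)" for n unfolding g_def by (intro test_fun_window A cont_\<zeta> \<zeta>_zero cH)
  have te0: "test_fun (e0 n)" for n unfolding e0_def by (intro test_fun_window A cont_\<zeta>' \<zeta>'_zero cH)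
  have te: "test_fun (e n)" for n unfolding e_def by (intro test_fun_mult te0 continuous_intros)
  have dg: "(g n has_vector_derivative q n y + e n y) (at y)" for n y
  proof -
    have "((\<lambda>y. \<zeta> ((A * y - (real_of_int n + v)) / L)) has_real_derivative \<zeta>' ((A * y - (real_of_int n + v)) / L) * (A / L)) (at y)"
      using L_ge by (intro DERIV_chain2[OF d\<zeta>]) (auto intro!: derivative_eq_intros)
    from has_vector_derivative_mult[OF has_vector_derivative_of_real[OF this] H(1)[of y]]
    show ?thesis by (simp add: g_def[abs_def] q_def e_def e0_def mult_ac)
  qed
  have Bh: "(X\<^sup>2 * c + 4 * C0 * sqrt (N * c / \<theta>)) / N > 0"
    using N \<theta>(1) c_pos C0_pos by (intro divide_pos_pos add_nonneg_pos) auto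
  have "\<exists>M. (\<forall>n. 0 \<le> M n) \<and> (\<forall>n\<in>F. \<forall>\<xi>\<in>{\<xi>. \<bar>\<xi>\<bar> \<ge> \<theta>}. (norm (multiplier N p (real_of_int n + v) \<xi>))\<^sup>2 \<le> M n)
     \<and> (\<Sum>n\<in>F. M n) \<le> 2 * ((X\<^sup>2 * c + 4 * C0 * sqrt (N * c / \<theta>)) / N * ?I p)"
  proof (rule multiplier_majorant[OF N F _ p(2) _ Bh])
    have "\<theta> \<in> {\<xi>. \<bar>\<xi>\<bar> \<ge> \<theta>}" by simp
    thus "{\<xi>. \<bar>\<xi>\<bar> \<ge> \<theta>} \<noteq> {}" by blast
  qed (use gram_row_high_le[OF N F \<theta>(1)] in auto)
  then obtain Mh where Mh: "\<And>n. 0 \<le> Mh n" "\<And>n \<xi>. n \<in> F \<Longrightarrow> \<bar>\<xi>\<bar> \<ge> \<theta> \<Longrightarrow> (norm (multiplier N p (real_of_int n + v) \<xi>))\<^sup>2 \<le> Mh n"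
    "(\<Sum>n\<in>F. Mh n) \<le> 2 * ((X\<^sup>2 * c + 4 * C0 * sqrt (N * c / \<theta>)) / N * ?I p)" by auto
  have "\<exists>M. (\<forall>n. 0 \<le> M n) \<and> (\<forall>n\<in>F. \<forall>\<xi>\<in>UNIV. (norm (multiplier N p (real_of_int n + v) \<xi>))\<^sup>2 \<le> M n)
     \<and> (\<Sum>n\<in>F. M n) \<le> 2 * (b\<^sub>l * ?I p)"
  proof (rule multiplier_majorant[OF N F _ p(2) _ bl_pos])
    show "(\<Sum>j\<in>F. norm (LINT y|lborel. kern N (real_of_int i + v) (\<xi> i) y * cnj (kern N (real_of_int j + v) (\<xi> j) y))) \<le> b\<^sub>l" for \<xi> i
      using gram_row_le[OF N F, of i v \<xi>] by (simp add: b\<^sub>l_def)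
  qed auto
  then obtain Ml where Ml: "\<And>n. 0 \<le> Ml n" "\<And>n \<xi>. n \<in> F \<Longrightarrow> (norm (multiplier N p (real_of_int n + v) \<xi>))\<^sup>2 \<le> Ml n"
    "(\<Sum>n\<in>F. Ml n) \<le> 2 * (b\<^sub>l * ?I p)" by auto
  define b where "b n = 2 * \<theta>\<^sup>2 * ?I (g n) + 2 * ?I (e n)" for n
  have b0: "b n \<ge> 0" for n by (simp add: b_def)
  have sum_q: "(\<Sum>n\<in>F. ?I (q n)) \<le> V * ?I Q"
    unfolding q_def V_def using L_ge by (intro sum_overlap_le F Q \<zeta>_le \<zeta>_zero) auto
  have sum_g: "(\<Sum>n\<in>F. ?I (g n)) \<le> V * ?I H"
    unfolding g_def V_def using L_ge by (intro sum_overlap_le F H \<zeta>_le \<zeta>_zero) auto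
  have sum_e0: "(\<Sum>n\<in>F. ?I (e0 n)) \<le> V * ?I H"
    unfolding e0_def V_def using L_ge by (intro sum_overlap_le F H \<zeta>'_le \<zeta>'_zero) auto
  have I_e: "?I (e n) = (A / L)\<^sup>2 * ?I (e0 n)" for n
    by (simp add: e_def norm_mult power_mult_distrib power_divide norm_divide)
  \<comment> \<open>The chain rule gives \<open>e\<close> the factor \<open>A / L\<close>. As
    \<open>A \<le> 1 / N\<close>, its square is at most 1/N^2, so \<open>e\<close> is small without
    any gain in frequency.\<close>
  have AL: "(A / L)\<^sup>2 \<le> \<nu>"
  proof -
    have "A / L \<le> A" using A L_ge by (simp add: field_simps)
    also have "\<dots> \<le> 1 / N" using A N by (simp add: field_simps)
    finally have "(A / L)\<^sup>2 \<le> (1 / N)\<^sup>2" using A L_ge by (intro power_mono) auto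
    also have "\<dots> \<le> 1 / N" using N by (simp add: power2_eq_square field_simps)
    finally show ?thesis using \<nu>(2) by simp
  qed
  have sum_b: "(\<Sum>n\<in>F. b n) \<le> 4 * \<nu> * V * ?I H"
  proof -
    have "(\<Sum>n\<in>F. b n) = 2 * \<theta>\<^sup>2 * (\<Sum>n\<in>F. ?I (g n)) + 2 * (A / L)\<^sup>2 * (\<Sum>n\<in>F. ?I (e0 n))"
      unfolding b_def I_e by (simp add: sum.distrib sum_distrib_left mult.assoc)
    also have "\<dots> \<le> 2 * \<nu> * (V * ?I H) + 2 * \<nu> * (V * ?I H)"
      using AL \<nu> \<theta>(2) N by (intro add_mono mult_mono sum_g sum_e0 sum_nonneg) auto
    finally show ?thesis by simp
  qed
  have sum_Mh: "(\<Sum>n\<in>F. Mh n) \<le> 2 * (b\<^sub>h * \<nu> * ?I p)"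
    using Mh(3) mult_right_mono[OF high_bound_simplify(1)[OF N] I0[of p]] unfolding \<theta>_def \<nu>_def by linarith
  have "(\<Sum>n\<in>F. sqrt (?I (frozen N p (q n) (real_of_int n + v)))) \<le> (\<Sum>n\<in>F. sqrt (Mh n) * sqrt (?I (q n)) + sqrt (Ml n) * sqrt (b n))"
  proof (rule sum_mono)
    fix n assume n: "n \<in> F"
    have "?I (frozen N p (q n) (real_of_int n + v)) \<le> Mh n * ?I (q n) + Ml n * b n"
      unfolding b_def
      by (rule frozen_L2_le[OF p(1) N0 _ tq tg te dg Mh(2)[OF n] Mh(1) Ml(2)[OF n]]) (use \<theta> in auto)
    hence "sqrt (?I (frozen N p (q n) (real_of_int n + v))) \<le> sqrt (Mh n * ?I (q n) + Ml n * b n)" by simp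
    also have "\<dots> \<le> sqrt (Mh n * ?I (q n)) + sqrt (Ml n * b n)"
      using Mh(1) Ml(1) b0 I0 by (intro sqrt_add_le_add_sqrt mult_nonneg_nonneg)
    finally show "sqrt (?I (frozen N p (q n) (real_of_int n + v))) \<le> sqrt (Mh n) * sqrt (?I (q n)) + sqrt (Ml n) * sqrt (b n)"
      by (simp add: real_sqrt_mult)
  qed
  also have "\<dots> = (\<Sum>n\<in>F. sqrt (Mh n) * sqrt (?I (q n))) + (\<Sum>n\<in>F. sqrt (Ml n) * sqrt (b n))"
    by (rule sum.distrib)
  also have "\<dots> \<le> sqrt (\<Sum>n\<in>F. Mh n) * sqrt (\<Sum>n\<in>F. ?I (q n)) + sqrt (\<Sum>n\<in>F. Ml n) * sqrt (\<Sum>n\<in>F. b n)"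
    by (intro add_mono sum_mult_sqrt_le Mh(1) Ml(1) b0 I0)
  also have "\<dots> \<le> sqrt (2 * (b\<^sub>h * \<nu> * ?I p)) * sqrt (V * ?I Q) + sqrt (2 * (b\<^sub>l * ?I p)) * sqrt (4 * \<nu> * V * ?I H)"
    using sum_Mh sum_q Ml(3) sum_b
    by (intro add_mono mult_mono real_sqrt_le_mono real_sqrt_ge_zero sum_nonneg Mh(1) Ml(1) b0 I0)
       (use \<nu> V_nonneg bh_pos bl_pos in auto)
  also have "sqrt (2 * (b\<^sub>h * \<nu> * ?I p)) * sqrt (V * ?I Q) = sqrt (2 * b\<^sub>h * V) * (sqrt \<nu> * sqrt (?I p) * sqrt (?I Q))"
    by (simp add: real_sqrt_mult mult_ac)
  also have "sqrt (2 * (b\<^sub>l * ?I p)) * sqrt (4 * \<nu> * V * ?I H) = sqrt (8 * b\<^sub>l * V) * (sqrt \<nu> * sqrt (?I p) * sqrt (?I H))"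
  proof -
    have "2 * (b\<^sub>l * ?I p) * (4 * \<nu> * V * ?I H) = (8 * b\<^sub>l * V) * (\<nu> * ?I p * ?I H)" by simp
    thus ?thesis by (simp only: real_sqrt_mult[symmetric])
  qed
  also have "sqrt (2 * b\<^sub>h * V) * (sqrt \<nu> * sqrt (?I p) * sqrt (?I Q)) + sqrt (8 * b\<^sub>l * V) * (sqrt \<nu> * sqrt (?I p) * sqrt (?I H))
    \<le> Kf * (sqrt \<nu> * sqrt (?I p) * sqrt (?I Q)) + Kf * (sqrt \<nu> * sqrt (?I p) * sqrt (?I H))"
    using \<nu> bh_pos bl_pos V_nonneg by (intro add_mono mult_right_mono) (auto simp: Kf_def)
  also have "sqrt \<nu> = N powr (-1/8)"
    using N by (simp add: \<nu>_def powr_half_sqrt[symmetric] powr_powr)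
  finally show ?thesis by (simp add: L2_norm_def q_def algebra_simps)
qed

text \<open>Cauchy-Schwarz against the indicator of a cell of length 1 / A converts the L^2 bounds
  to L^1 and produces the factor 1 / sqrt A. The offset \<open>v\<close> is arbitrary in [0, 1] so
  that an average over it can be taken afterwards.\<close>

lemma frozen_sum_le:
  fixes F :: "int set"
  assumes N: "N \<ge> 1" and A: "A > 0" "A * N \<le> 1" and F: "finite F" and v: "v \<in> {0..1}"
    and p: "continuous_on UNIV p" "integrable lborel (\<lambda>x. (norm (p x))\<^sup>2)"
    and Q: "continuous_on UNIV Q" "integrable lborel (\<lambda>x. (norm (Q x))\<^sup>2)"
    and H: "\<And>x. (H has_vector_derivative Q x) (at x)" "integrable lborel (\<lambda>x. (norm (H x))\<^sup>2)"
  shows "(\<Sum>n\<in>F. \<integral>\<^sup>+x. indicator {real_of_int n / A..<(real_of_int n + 1) / A} x * ennreal (norm (frozen N p Q (real_of_int n + v) x)) \<partial>lborel)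
    \<le> ennreal (Kf * N powr (-1/8) / sqrt A * L2_norm p * (L2_norm Q + L2_norm H))"
proof -
  define q where "q n y = of_real (\<zeta> ((A * y - (real_of_int n + v)) / L)) * Q y" for n y
  have tq: "test_fun (q n)" for n unfolding q_def by (intro test_fun_window A cont_\<zeta> \<zeta>_zero Q)
  define h where "h n = frozen N p (q n) (real_of_int n + v)" for n
  have th: "test_fun (h n)" for n unfolding h_def using N by (intro test_fun_frozen p tq) auto
  have le: "(\<integral>\<^sup>+x. indicator {real_of_int n / A..<(real_of_int n + 1) / A} x * ennreal (norm (frozen N p Q (real_of_int n + v) x)) \<partial>lborel)
    \<le> ennreal (1 / sqrt A * sqrt (LINT x|lborel. (norm (h n x))\<^sup>2))" for n
  proof -
    let ?I = "{real_of_int n / A..<(real_of_int n + 1) / A}"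
    have [measurable]: "h n \<in> borel_measurable borel" by (rule test_fun_measurable[OF th])
    have em: "emeasure lborel ?I = ennreal (1 / A)"
      using A by (simp add: emeasure_lborel_Ico divide_right_mono diff_divide_distrib[symmetric])
    have "(\<integral>\<^sup>+x. indicator ?I x * ennreal (norm (frozen N p Q (real_of_int n + v) x)) \<partial>lborel) =
      (\<integral>\<^sup>+x. ennreal (\<bar>indicator ?I x\<bar> * \<bar>norm (h n x)\<bar>) \<partial>lborel)"
    proof (rule nn_integral_cong)
      fix x
      show "indicator ?I x * ennreal (norm (frozen N p Q (real_of_int n + v) x)) = ennreal (\<bar>indicator ?I x\<bar> * \<bar>norm (h n x)\<bar>)"
      proof (cases "x \<in> ?I")
        case True
        hence "real_of_int n \<le> A * x" "A * x \<le> real_of_int n + 1" using A by (auto simp: field_simps)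
        hence "h n x = frozen N p Q (real_of_int n + v) x"
          unfolding h_def q_def using N A v by (intro frozen_window) auto
        thus ?thesis using True by simp
      qed simp
    qed
    also have "\<dots> \<le> ennreal (sqrt (LINT x|lborel. (indicator ?I x)\<^sup>2) * sqrt (LINT x|lborel. (norm (h n x))\<^sup>2))"
    proof (rule nn_integral_mult_le_sqrt)
      show "integrable lborel (\<lambda>x. (indicat_real ?I x)\<^sup>2)"
        using em by (simp add: power2_eq_square flip: indicator_inter_arith)
      show "integrable lborel (\<lambda>x. (norm (h n x))\<^sup>2)" by (rule test_fun_square_integrable[OF th])
    qed measurable
    also have "(LINT x|lborel. (indicat_real ?I x)\<^sup>2) = 1 / A"
      using em A by (simp add: power2_eq_square measure_def flip: indicator_inter_arith)
    finally show ?thesis by (simp add: real_sqrt_divide)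
  qed
  have "(\<Sum>n\<in>F. \<integral>\<^sup>+x. indicator {real_of_int n / A..<(real_of_int n + 1) / A} x * ennreal (norm (frozen N p Q (real_of_int n + v) x)) \<partial>lborel)
    \<le> (\<Sum>n\<in>F. ennreal (1 / sqrt A * sqrt (LINT x|lborel. (norm (h n x))\<^sup>2)))"
    by (intro sum_mono le)
  also have "\<dots> = ennreal (\<Sum>n\<in>F. 1 / sqrt A * sqrt (LINT x|lborel. (norm (h n x))\<^sup>2))"
    using A by (intro sum_ennreal) simp
  also have "\<dots> \<le> ennreal (1 / sqrt A * (Kf * N powr (-1/8) * L2_norm p * (L2_norm Q + L2_norm H)))"
    unfolding sum_distrib_left[symmetric]
    by (intro ennreal_leI mult_left_mono frozen_sum_L2[OF N A F p Q H, of v, folded q_def h_def]) (use A in auto)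
  finally show ?thesis by simp
qed

end


context oscillating_curve
begin

lemma measurable_frozen [measurable]:
  assumes [measurable]: "p \<in> borel_measurable borel" "q \<in> borel_measurable borel"
    "f \<in> borel_measurable M" "g \<in> borel_measurable M"
  shows "(\<lambda>x. frozen N p q (f x) (g x)) \<in> borel_measurable M"
  unfolding frozen_def by measurable

text \<open>The fundamental theorem of calculus in the slow variable. Enlarging the interval {0..t}
  to {0..1} frees the right-hand side from t, which will be A x - n and so depends on x.\<close>

lemma frozen_increment_le:
  assumes P: "\<And>x. (P has_vector_derivative P' x) (at x)" "continuous_on UNIV P'"
    and Q: "continuous_on UNIV Q" and t: "t \<in> {0..1}"
  shows "ennreal (norm (frozen N P Q (u + t) x)) \<le> ennreal (norm (frozen N P Q u x)) +
    (\<integral>\<^sup>+v. indicator {0..1} v * ennreal (norm (frozen N P' Q (u + v) x)) \<partial>lborel)"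
proof -
  have cP: "continuous_on UNIV P"
    using P(1) by (meson continuous_at_imp_continuous_on has_vector_derivative_continuous)
  have Qc: "continuous_on S (\<lambda>x. Q (f x))" if "continuous_on S f" for S :: "'b::topological_space set" and f
    by (rule continuous_on_compose2[OF Q that]) auto
  have P'c: "continuous_on S (\<lambda>x. P' (f x))" if "continuous_on S f" for S :: "'b::topological_space set" and f
    by (rule continuous_on_compose2[OF P(2) that]) auto
  have Pc: "continuous_on S (\<lambda>x. P (f x))" if "continuous_on S f" for S :: "'b::topological_space set" and f
    by (rule continuous_on_compose2[OF cP that]) auto
  have int1: "integrable lborel (\<lambda>s. P (w - N * s) * Q (x - N * \<gamma> s) * of_real (\<psi> s))" for w
    by (rule integrable_continuous_compact_support[where S="{0..c}"])
       (auto intro!: continuous_intros Qc Pc simp: supp)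
  let ?F = "\<lambda>s v. indicator {0..t} v *\<^sub>R (P' (u + v - N * s) * Q (x - N * \<gamma> s) * of_real (\<psi> s))"
  have int2: "integrable (lborel \<Otimes>\<^sub>M lborel) (\<lambda>(s,v). ?F s v)"
  proof -
    have "integrable lborel (\<lambda>z::real\<times>real. indicator ({0..c} \<times> {0..t}) z *\<^sub>R
        (P' (u + snd z - N * fst z) * Q (x - N * \<gamma> (fst z)) * of_real (\<psi> (fst z))))"
      by (intro borel_integrable_compact compact_Times continuous_intros Qc P'c) auto
    also have "(\<lambda>z::real\<times>real. indicator ({0..c} \<times> {0..t}) z *\<^sub>R
        (P' (u + snd z - N * fst z) * Q (x - N * \<gamma> (fst z)) * of_real (\<psi> (fst z)))) = (\<lambda>(s,v). ?F s v)"
      using supp by (auto simp: fun_eq_iff indicator_def)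
    finally show ?thesis by (simp add: lborel_prod)
  qed
  have "frozen N P Q (u + t) x - frozen N P Q u x =
     (LINT s|lborel. P (u + t - N * s) * Q (x - N * \<gamma> s) * of_real (\<psi> s) - P (u - N * s) * Q (x - N * \<gamma> s) * of_real (\<psi> s))"
    unfolding frozen_def by (rule Bochner_Integration.integral_diff[symmetric]; rule int1)
  also have "\<dots> = (LINT s|lborel. LINT v|lborel. ?F s v)"
  proof (rule Bochner_Integration.integral_cong[OF refl])
    fix s
    have "(LINT v|lborel. indicator {0..t} v *\<^sub>R P' (u + v - N * s)) = P (u + t - N * s) - P (u + 0 - N * s)"
    proof (rule integral_FTC_atLeastAtMost)
      fix v
      have "((P \<circ> (\<lambda>v. u + v - N * s)) has_vector_derivative 1 *\<^sub>R P' (u + v - N * s)) (at v)"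
        by (rule vector_diff_chain_at[OF _ P(1)]) (auto intro!: derivative_eq_intros)
      thus "((\<lambda>v. P (u + v - N * s)) has_vector_derivative P' (u + v - N * s)) (at v within {0..t})"
        by (simp add: o_def has_vector_derivative_at_within)
    qed (use t in \<open>auto intro!: P'c continuous_intros\<close>)
    hence eq: "(LINT v|lborel. indicator {0..t} v *\<^sub>R P' (u + v - N * s)) = P (u + t - N * s) - P (u - N * s)" by simp
    have "P (u + t - N * s) * Q (x - N * \<gamma> s) * of_real (\<psi> s) - P (u - N * s) * Q (x - N * \<gamma> s) * of_real (\<psi> s)
      = (LINT v|lborel. indicator {0..t} v *\<^sub>R P' (u + v - N * s)) * (Q (x - N * \<gamma> s) * of_real (\<psi> s))"
      unfolding eq by (simp add: algebra_simps)
    also have "\<dots> = (LINT v|lborel. (indicator {0..t} v *\<^sub>R P' (u + v - N * s)) * (Q (x - N * \<gamma> s) * of_real (\<psi> s)))"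
      by (rule integral_mult_left_zero[symmetric])
    also have "\<dots> = (LINT v|lborel. ?F s v)"
      by (simp add: mult.assoc)
    finally show "P (u + t - N * s) * Q (x - N * \<gamma> s) * of_real (\<psi> s) - P (u - N * s) * Q (x - N * \<gamma> s) * of_real (\<psi> s) = (LINT v|lborel. ?F s v)" .
  qed
  also have "\<dots> = (LINT v|lborel. LINT s|lborel. ?F s v)"
    using lborel_pair.Fubini_integral[OF int2] by simp
  also have "\<dots> = (LINT v|lborel. indicator {0..t} v *\<^sub>R frozen N P' Q (u + v) x)"
    unfolding frozen_def by simp
  finally have diff: "frozen N P Q (u + t) x - frozen N P Q u x = (LINT v|lborel. indicator {0..t} v *\<^sub>R frozen N P' Q (u + v) x)" .
  have int3: "integrable lborel (\<lambda>v. indicator {0..t} v *\<^sub>R frozen N P' Q (u + v) x)"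
    using lborel_pair.integrable_snd[OF int2] unfolding frozen_def by simp
  have "ennreal (norm (frozen N P Q (u + t) x)) \<le> ennreal (norm (frozen N P Q u x) + norm (frozen N P Q (u + t) x - frozen N P Q u x))"
    by (intro ennreal_leI) (metis norm_triangle_sub)
  also have "\<dots> = ennreal (norm (frozen N P Q u x)) + ennreal (norm (LINT v|lborel. indicator {0..t} v *\<^sub>R frozen N P' Q (u + v) x))"
    by (simp add: ennreal_plus diff)
  also have "ennreal (norm (LINT v|lborel. indicator {0..t} v *\<^sub>R frozen N P' Q (u + v) x)) \<le>
     (\<integral>\<^sup>+v. ennreal (norm (indicator {0..t} v *\<^sub>R frozen N P' Q (u + v) x)) \<partial>lborel)"
    by (rule integral_norm_bound_ennreal[OF int3])
  also have "\<dots> \<le> (\<integral>\<^sup>+v. indicator {0..1} v * ennreal (norm (frozen N P' Q (u + v) x)) \<partial>lborel)"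
    using t by (intro nn_integral_mono) (auto simp: indicator_def)
  finally show ?thesis by (simp add: add_left_mono)
qed

end

context localized_curve
begin

text \<open>On each cell the slow variable is frozen at the left end n. The increment is an average
  over v in [0, 1] of forms frozen at n + v with P' in place of P, and \<open>frozen_sum_le\<close>
  bounds each of them uniformly in v.\<close>

theorem bilinear_bound:
  assumes N: "N \<ge> 1" and A: "A > 0" "A * N \<le> 1"
    and P: "\<And>x. (P has_vector_derivative P' x) (at x)" "continuous_on UNIV P'"
      "integrable lborel (\<lambda>x. (norm (P x))\<^sup>2)" "integrable lborel (\<lambda>x. (norm (P' x))\<^sup>2)"
    and Q: "continuous_on UNIV Q" "integrable lborel (\<lambda>x. (norm (Q x))\<^sup>2)"
    and H: "\<And>x. (H has_vector_derivative Q x) (at x)" "integrable lborel (\<lambda>x. (norm (H x))\<^sup>2)"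
  shows "(\<integral>\<^sup>+x. ennreal (norm (frozen N P Q (A * x) x)) \<partial>lborel)
    \<le> ennreal (Kf * N powr (-1/8) / sqrt A * (L2_norm P + L2_norm P') * (L2_norm Q + L2_norm H))"
proof -
  have cP: "continuous_on UNIV P"
    using P(1) by (meson continuous_at_imp_continuous_on has_vector_derivative_continuous)
  have [measurable]: "P \<in> borel_measurable borel" "P' \<in> borel_measurable borel" "Q \<in> borel_measurable borel"
    using cP P(2) Q(1) by (auto intro: borel_measurable_continuous_onI)
  let ?T = "\<lambda>x. ennreal (norm (frozen N P Q (A * x) x))"
  define I where "I n = {real_of_int n / A..<(real_of_int n + 1) / A}" for n
  have [measurable]: "I n \<in> sets borel" for n by (simp add: I_def)
  define K where "K p = Kf * N powr (-1/8) / sqrt A * L2_norm p * (L2_norm Q + L2_norm H)" for p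
  have K0: "K p \<ge> 0" for p using Kf_nonneg A by (simp add: K_def)
  note fs = frozen_sum_le[OF N A _ _ _ _ Q H, folded I_def K_def]
  have cell: "indicator (I n) x * ?T x \<le> indicator (I n) x * ennreal (norm (frozen N P Q (real_of_int n) x)) +
     (\<integral>\<^sup>+v. indicator {0..1} v * (indicator (I n) x * ennreal (norm (frozen N P' Q (real_of_int n + v) x))) \<partial>lborel)" for n x
  proof (cases "x \<in> I n")
    case True
    hence t: "A * x - real_of_int n \<in> {0..1}" using A by (auto simp: I_def field_simps)
    from frozen_increment_le[OF P(1,2) Q(1) t, of N "real_of_int n" x] True show ?thesis by simp
  qed simp
  have fin: "(\<Sum>n\<in>F. \<integral>\<^sup>+x. indicator (I n) x * ?T x \<partial>lborel) \<le> ennreal (K P + K P')" if F: "finite F" for F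
  proof -
    have "(\<Sum>n\<in>F. \<integral>\<^sup>+x. indicator (I n) x * ?T x \<partial>lborel) \<le> (\<Sum>n\<in>F. \<integral>\<^sup>+x. (indicator (I n) x * ennreal (norm (frozen N P Q (real_of_int n) x)) +
     (\<integral>\<^sup>+v. indicator {0..1} v * (indicator (I n) x * ennreal (norm (frozen N P' Q (real_of_int n + v) x))) \<partial>lborel)) \<partial>lborel)"
      by (intro sum_mono nn_integral_mono cell)
    also have "\<dots> = (\<Sum>n\<in>F. (\<integral>\<^sup>+x. indicator (I n) x * ennreal (norm (frozen N P Q (real_of_int n + 0) x)) \<partial>lborel) +
     (\<integral>\<^sup>+x. (\<integral>\<^sup>+v. indicator {0..1} v * (indicator (I n) x * ennreal (norm (frozen N P' Q (real_of_int n + v) x))) \<partial>lborel) \<partial>lborel))"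
      by (intro sum.cong refl, subst nn_integral_add) auto
    also have "\<dots> = (\<Sum>n\<in>F. (\<integral>\<^sup>+x. indicator (I n) x * ennreal (norm (frozen N P Q (real_of_int n + 0) x)) \<partial>lborel)) +
     (\<Sum>n\<in>F. \<integral>\<^sup>+x. (\<integral>\<^sup>+v. indicator {0..1} v * (indicator (I n) x * ennreal (norm (frozen N P' Q (real_of_int n + v) x))) \<partial>lborel) \<partial>lborel)"
      by (rule sum.distrib)
    also have "(\<Sum>n\<in>F. (\<integral>\<^sup>+x. indicator (I n) x * ennreal (norm (frozen N P Q (real_of_int n + 0) x)) \<partial>lborel)) \<le> ennreal (K P)"
      by (rule fs) (use F P cP in auto)
    \<comment> \<open>Tonelli puts v outermost, so that the sum over all cells can be estimated for
      one v at a time.\<close>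
    also have "(\<Sum>n\<in>F. \<integral>\<^sup>+x. (\<integral>\<^sup>+v. indicator {0..1} v * (indicator (I n) x * ennreal (norm (frozen N P' Q (real_of_int n + v) x))) \<partial>lborel) \<partial>lborel)
      = (\<Sum>n\<in>F. \<integral>\<^sup>+v. (\<integral>\<^sup>+x. indicator {0..1} v * (indicator (I n) x * ennreal (norm (frozen N P' Q (real_of_int n + v) x))) \<partial>lborel) \<partial>lborel)"
      by (intro sum.cong refl lborel_pair.Fubini') measurable
    also have "\<dots> = (\<Sum>n\<in>F. \<integral>\<^sup>+v. indicator {0..1} v * (\<integral>\<^sup>+x. indicator (I n) x * ennreal (norm (frozen N P' Q (real_of_int n + v) x)) \<partial>lborel) \<partial>lborel)"
      by (intro sum.cong refl nn_integral_cong nn_integral_cmult) measurable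
    also have "\<dots> = (\<integral>\<^sup>+v. (\<Sum>n\<in>F. indicator {0..1} v * (\<integral>\<^sup>+x. indicator (I n) x * ennreal (norm (frozen N P' Q (real_of_int n + v) x)) \<partial>lborel)) \<partial>lborel)"
      by (rule nn_integral_sum[symmetric]) measurable
    also have "\<dots> \<le> (\<integral>\<^sup>+v. ennreal (K P') * indicator {0..1::real} v \<partial>lborel)"
    proof (rule nn_integral_mono)
      fix v :: real
      show "(\<Sum>n\<in>F. indicator {0..1} v * (\<integral>\<^sup>+x. indicator (I n) x * ennreal (norm (frozen N P' Q (real_of_int n + v) x)) \<partial>lborel)) \<le> ennreal (K P') * indicator {0..1} v"
      proof (cases "v \<in> {0..1}")
        case True
        have "(\<Sum>n\<in>F. (\<integral>\<^sup>+x. indicator (I n) x * ennreal (norm (frozen N P' Q (real_of_int n + v) x)) \<partial>lborel)) \<le> ennreal (K P')"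
          by (rule fs) (use F P True in auto)
        thus ?thesis using True by simp
      qed simp
    qed
    also have "\<dots> = ennreal (K P')" by (simp add: nn_integral_cmult)
    finally show ?thesis using K0 by (simp add: ennreal_plus add_mono)
  qed
  \<comment> \<open>The union of the cells with indices from -k to k. Letting k grow passes from
    finitely many cells to the whole line by monotone convergence.\<close>
  define U where "U k = {- real k / A..<(real k + 1) / A}" for k :: nat
  have [measurable]: "U k \<in> sets borel" for k by (simp add: U_def)
  have part: "(\<integral>\<^sup>+x. indicator (U k) x * ?T x \<partial>lborel) \<le> ennreal (K P + K P')" for k
  proof -
    have "(\<integral>\<^sup>+x. indicator (U k) x * ?T x \<partial>lborel) \<le> (\<integral>\<^sup>+x. (\<Sum>n\<in>{- int k..int k}. indicator (I n) x * ?T x) \<partial>lborel)"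
    proof (rule nn_integral_mono)
      fix x
      show "indicator (U k) x * ?T x \<le> (\<Sum>n\<in>{- int k..int k}. indicator (I n) x * ?T x)"
      proof (cases "x \<in> U k")
        case True
        define n where "n = \<lfloor>A * x\<rfloor>"
        have "- real k \<le> A * x" "A * x < real k + 1" using True A by (auto simp: U_def field_simps)
        hence n: "n \<in> {- int k..int k}" unfolding n_def by (auto simp: le_floor_iff floor_le_iff)
        have "real_of_int n \<le> A * x" "A * x < real_of_int n + 1" unfolding n_def by linarith+
        hence "x \<in> I n" using A by (auto simp: I_def field_simps)
        hence "indicator (U k) x * ?T x = indicator (I n) x * ?T x" using True by simp
        also have "\<dots> \<le> (\<Sum>n\<in>{- int k..int k}. indicator (I n) x * ?T x)"
          using n by (intro member_le_sum) auto
        finally show ?thesis .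
      qed simp
    qed
    also have "\<dots> = (\<Sum>n\<in>{- int k..int k}. \<integral>\<^sup>+x. indicator (I n) x * ?T x \<partial>lborel)"
      by (rule nn_integral_sum) measurable
    also have "\<dots> \<le> ennreal (K P + K P')" by (rule fin) simp
    finally show ?thesis .
  qed
  have "(\<lambda>k. \<integral>\<^sup>+x. indicator (U k) x * ?T x \<partial>lborel) \<longlonglongrightarrow> (\<integral>\<^sup>+x. ?T x \<partial>lborel)"
  proof (rule nn_integral_LIMSEQ)
    have "U k \<subseteq> U (Suc k)" for k using A by (auto simp: U_def field_simps)
    thus "incseq (\<lambda>k x. indicator (U k) x * ?T x)"
      by (intro incseq_SucI le_funI mult_right_mono) (auto simp: indicator_def)
    fix x
    obtain k0 where k0: "\<bar>A * x\<bar> \<le> real k0" using real_arch_simple by blast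
    have "indicator (U k) x * ?T x = ?T x" if "k \<ge> k0" for k
    proof -
      have "\<bar>A * x\<bar> \<le> real k" using k0 that by linarith
      hence "x \<in> U k" using A by (auto simp: U_def field_simps)
      thus ?thesis by simp
    qed
    hence "eventually (\<lambda>k. indicator (U k) x * ?T x = ?T x) sequentially"
      by (auto simp: eventually_sequentially)
    thus "(\<lambda>k. indicator (U k) x * ?T x) \<longlonglongrightarrow> ?T x" by (rule tendsto_eventually)
  qed measurable
  hence "(\<integral>\<^sup>+x. ?T x \<partial>lborel) \<le> ennreal (K P + K P')"
    by (rule LIMSEQ_le_const2) (use part in auto)
  also have "K P + K P' = Kf * N powr (-1/8) / sqrt A * (L2_norm P + L2_norm P') * (L2_norm Q + L2_norm H)"
    by (simp only: K_def distrib_left distrib_right)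
  finally show ?thesis .
qed

end


section \<open>Convolution with decaying kernels\<close>

lemma integrable_inverse_one_plus_square: "integrable lborel (\<lambda>x::real. inverse (1 + x\<^sup>2))"
  using integrable_inverse_1_plus_square by (simp add: set_integrable_def)

lemma integrable_reflect_shift:
  fixes k :: "real \<Rightarrow> 'a::{banach,second_countable_topology}"
  assumes "integrable lborel k"
  shows "integrable lborel (\<lambda>y. k (x - y))"
  using lborel_integrable_real_affine[OF assms, of "-1" x] by simp

lemma LINT_reflect_shift:
  fixes k :: "real \<Rightarrow> 'a::{banach,second_countable_topology}"
  shows "(LINT y|lborel. k (x - y)) = (LINT y|lborel. k y)"
  using lborel_integral_real_affine[of "-1" k x] by simp

definition conv :: "(real \<Rightarrow> complex) \<Rightarrow> (real \<Rightarrow> complex) \<Rightarrow> real \<Rightarrow> complex" where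
  "conv f k x = (LINT y|lborel. f y * k (x - y))"

text \<open>This decay puts \<open>k\<close> into L^1 and L^2 at once: L^2 makes the convolution
  with an L^2 function converge at every point, L^1 makes it bounded on L^2.\<close>

locale decaying_kernel =
  fixes k :: "real \<Rightarrow> complex" and C :: real
  assumes cont_k: "continuous_on UNIV k" and decay: "\<And>x. norm (k x) \<le> C * inverse (1 + x\<^sup>2)"
begin

lemma C_nonneg: "C \<ge> 0" using order.trans[OF norm_ge_zero decay[of 0]] by simp

lemma meas_k [measurable]: "k \<in> borel_measurable borel"
  by (intro borel_measurable_continuous_onI cont_k)

lemma inverse_one_plus_square_le_1: "inverse (1 + x\<^sup>2) \<le> (1::real)"
  by (intro inverse_le_1_iff[THEN iffD2]) auto

lemma k_square_le: "(norm (k x))\<^sup>2 \<le> C\<^sup>2 * inverse (1 + x\<^sup>2)"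
proof -
  have "(norm (k x))\<^sup>2 \<le> (C * inverse (1 + x\<^sup>2))\<^sup>2" by (intro power_mono decay) auto
  also have "\<dots> = C\<^sup>2 * (inverse (1 + x\<^sup>2) * inverse (1 + x\<^sup>2))" by (simp add: power2_eq_square mult_ac)
  also have "\<dots> \<le> C\<^sup>2 * (inverse (1 + x\<^sup>2) * 1)"
    by (intro mult_left_mono inverse_one_plus_square_le_1) auto
  finally show ?thesis by simp
qed

lemma integrable_k_square: "integrable lborel (\<lambda>x. (norm (k x))\<^sup>2)"
proof (rule Bochner_Integration.integrable_bound)
  show "integrable lborel (\<lambda>x. C\<^sup>2 * inverse (1 + x\<^sup>2))"
    by (intro integrable_mult_right integrable_inverse_one_plus_square)
  show "AE x in lborel. norm ((norm (k x))\<^sup>2) \<le> norm (C\<^sup>2 * inverse (1 + x\<^sup>2))"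
  proof (rule AE_I2)
    fix x
    have "0 \<le> C\<^sup>2 * inverse (1 + x\<^sup>2)" by simp
    thus "norm ((norm (k x))\<^sup>2) \<le> norm (C\<^sup>2 * inverse (1 + x\<^sup>2))" using k_square_le[of x] by simp
  qed
qed measurable

end

locale L2_function =
  fixes f :: "real \<Rightarrow> complex"
  assumes meas_f [measurable]: "f \<in> borel_measurable borel" and L2_f: "integrable lborel (\<lambda>x. (norm (f x))\<^sup>2)"

locale L2_conv = decaying_kernel k C + L2_function f for k C f
begin

lemma integrable_conv: "integrable lborel (\<lambda>y. f y * k (x - y))"
  by (rule integrable_mult_L2) (use L2_f integrable_reflect_shift[OF integrable_k_square, of x] in auto)

lemma measurable_conv [measurable]: "conv f k \<in> borel_measurable borel"
  unfolding conv_def[abs_def] by measurable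

lemma continuous_conv: "continuous_on UNIV (conv f k)"
proof (rule continuous_at_imp_continuous_on, rule ballI, rule continuous_at_sequentiallyI)
  fix a :: real and u :: "nat \<Rightarrow> real" assume u: "u \<longlonglongrightarrow> a"
  have "Bseq (\<lambda>n. u n - a)" by (rule convergent_imp_Bseq[OF convergentI[OF LIM_zero[OF u]]])
  then obtain B where B: "\<And>n. \<bar>u n - a\<bar> \<le> B" by (auto simp: Bseq_def)
  \<comment> \<open>\<open>u n\<close> stays within \<open>B\<close> of \<open>a\<close>, so the
    weights centred at \<open>u n\<close> and at \<open>a\<close> are comparable with the constant
    \<open>D\<close>. This gives a dominating function that does not depend on
    \<open>n\<close>.\<close>
  define D where "D = 2 + 2 * B\<^sup>2"
  have w: "inverse (1 + (u n - y)\<^sup>2) \<le> D * inverse (1 + (a - y)\<^sup>2)" for n y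
  proof -
    have "(u n - a)\<^sup>2 \<le> B\<^sup>2" using power_mono[OF B[of n], of 2] by simp
    moreover have "(a - y)\<^sup>2 \<le> 2 * (u n - y)\<^sup>2 + 2 * (u n - a)\<^sup>2"
    proof -
      have "2 * (u n - y)\<^sup>2 + 2 * (u n - a)\<^sup>2 - (a - y)\<^sup>2 = ((u n - y) + (u n - a))\<^sup>2"
        by (simp add: power2_eq_square algebra_simps)
      moreover have "0 \<le> ((u n - y) + (u n - a))\<^sup>2" by simp
      ultimately show ?thesis by linarith
    qed
    moreover have "0 \<le> B\<^sup>2 * (u n - y)\<^sup>2" by simp
    moreover have "D * (1 + (u n - y)\<^sup>2) = 2 + 2 * B\<^sup>2 + 2 * (u n - y)\<^sup>2 + 2 * (B\<^sup>2 * (u n - y)\<^sup>2)"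
      unfolding D_def by (simp add: algebra_simps)
    ultimately have "1 + (a - y)\<^sup>2 \<le> D * (1 + (u n - y)\<^sup>2)" by linarith
    moreover have "0 < 1 + (a - y)\<^sup>2" "0 < 1 + (u n - y)\<^sup>2" by (simp_all add: add_pos_nonneg)
    ultimately show ?thesis by (simp add: field_simps)
  qed
  show "(\<lambda>n. conv f k (u n)) \<longlonglongrightarrow> conv f k a"
    unfolding conv_def
  proof (rule integral_dominated_convergence)
    let ?w = "\<lambda>y. norm (f y * of_real (C * (D * inverse (1 + (a - y)\<^sup>2))))"
    show "integrable lborel ?w"
    proof (intro integrable_norm integrable_mult_L2 L2_f)
      have "integrable lborel (\<lambda>x::real. (C * D)\<^sup>2 * inverse (1 + x\<^sup>2))"
        by (intro integrable_mult_right integrable_inverse_one_plus_square)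
      hence "integrable lborel (\<lambda>x::real. (C * D * inverse (1 + x\<^sup>2))\<^sup>2)"
      proof (rule Bochner_Integration.integrable_bound)
        show "AE x in lborel. norm ((C * D * inverse (1 + x\<^sup>2))\<^sup>2) \<le> norm ((C * D)\<^sup>2 * inverse (1 + x\<^sup>2))"
        proof (rule AE_I2)
          fix x :: real
          define i where "i = inverse (1 + x\<^sup>2)"
          have "norm ((C * D * i)\<^sup>2) = (C * D * i)\<^sup>2" by (simp only: real_norm_def abs_power2)
          also have "\<dots> = (C * D)\<^sup>2 * (i * i)" by (simp add: power2_eq_square mult_ac)
          also have "\<dots> \<le> (C * D)\<^sup>2 * (i * 1)"
            unfolding i_def by (intro mult_left_mono inverse_one_plus_square_le_1) auto
          also have "\<dots> \<le> norm ((C * D)\<^sup>2 * i)" by (simp only: real_norm_def abs_ge_self mult_1_right)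
          finally show "norm ((C * D * inverse (1 + x\<^sup>2))\<^sup>2) \<le> norm ((C * D)\<^sup>2 * inverse (1 + x\<^sup>2))"
            unfolding i_def .
        qed
      qed measurable
      from integrable_reflect_shift[OF this, of a]
      show "integrable lborel (\<lambda>y. (norm (complex_of_real (C * (D * inverse (1 + (a - y)\<^sup>2)))))\<^sup>2)"
        by (simp only: norm_of_real power2_abs mult.assoc)
    qed auto
    show "AE y in lborel. (\<lambda>n. f y * k (u n - y)) \<longlonglongrightarrow> f y * k (a - y)"
    proof (intro AE_I2 tendsto_mult tendsto_const)
      fix y
      have "isCont k (a - y)" using cont_k by (simp add: continuous_on_eq_continuous_at)
      thus "(\<lambda>n. k (u n - y)) \<longlonglongrightarrow> k (a - y)"
        by (rule isCont_tendsto_compose) (intro tendsto_intros u)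
    qed
    show "AE y in lborel. norm (f y * k (u n - y)) \<le> ?w y" for n
    proof (rule AE_I2)
      fix y
      have "norm (k (u n - y)) \<le> C * inverse (1 + (u n - y)\<^sup>2)" by (rule decay)
      also have "\<dots> \<le> C * (D * inverse (1 + (a - y)\<^sup>2))" by (intro mult_left_mono w C_nonneg)
      also have "\<dots> \<le> \<bar>C * (D * inverse (1 + (a - y)\<^sup>2))\<bar>" by simp
      finally show "norm (f y * k (u n - y)) \<le> ?w y"
        unfolding norm_mult norm_of_real by (rule mult_left_mono) simp
    qed
  qed auto
qed

text \<open>Young's inequality for L^1 with L^2: the majorant \<open>w\<close> of the kernel is
  split as sqrt w times sqrt w, Cauchy-Schwarz is applied in y, and Tonelli integrates the result in
  x. Each of the two steps yields one factor \<open>W\<close>.\<close>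

lemma
  shows L2_integrable_conv: "integrable lborel (\<lambda>x. (norm (conv f k x))\<^sup>2)"
    and L2_norm_conv_le: "L2_norm (conv f k) \<le> C * (LINT x|lborel. inverse (1 + x\<^sup>2)) * L2_norm f"
proof -
  define w where "w x = C * inverse (1 + x\<^sup>2)" for x :: real
  have [measurable]: "w \<in> borel_measurable borel" unfolding w_def by measurable
  have w0: "w x \<ge> 0" for x using C_nonneg by (simp add: w_def)
  define W where "W = (LINT x|lborel. w x)"
  have wi: "integrable lborel w" unfolding w_def by (intro integrable_mult_right integrable_inverse_one_plus_square)
  have W0: "W \<ge> 0" unfolding W_def using w0 by simp
  have wn: "(\<integral>\<^sup>+y. ennreal (w (x - y)) \<partial>lborel) = ennreal W" "(\<integral>\<^sup>+x. ennreal (w (x - y)) \<partial>lborel) = ennreal W" for x y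
  proof -
    show "(\<integral>\<^sup>+y. ennreal (w (x - y)) \<partial>lborel) = ennreal W"
      using w0 LINT_reflect_shift[of w x] nn_integral_eq_integral[OF integrable_reflect_shift[OF wi, of x]] by (simp add: W_def)
    have "integrable lborel (\<lambda>x. w (- y + 1 * x))" "(LINT x|lborel. w (- y + 1 * x)) = W"
      using lborel_integrable_real_affine[OF wi, of 1 "-y"] lborel_integral_real_affine[of 1 w "-y"] by (auto simp: W_def)
    thus "(\<integral>\<^sup>+x. ennreal (w (x - y)) \<partial>lborel) = ennreal W"
      by (subst nn_integral_eq_integral) (use w0 in auto)
  qed
  have pw: "ennreal ((norm (conv f k x))\<^sup>2) \<le> (\<integral>\<^sup>+y. ennreal ((norm (f y))\<^sup>2 * w (x - y)) \<partial>lborel) * ennreal W" for x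
  proof -
    have "ennreal (norm (conv f k x)) \<le> (\<integral>\<^sup>+y. ennreal (norm (f y * k (x - y))) \<partial>lborel)"
      unfolding conv_def by (rule integral_norm_bound_ennreal[OF integrable_conv])
    also have "\<dots> \<le> (\<integral>\<^sup>+y. ennreal (norm (f y) * sqrt (w (x - y))) * ennreal (sqrt (w (x - y))) \<partial>lborel)"
    proof (rule nn_integral_mono)
      fix y
      have "norm (f y * k (x - y)) \<le> norm (f y) * w (x - y)"
        unfolding norm_mult w_def by (intro mult_left_mono decay) simp
      also have "\<dots> = (norm (f y) * sqrt (w (x - y))) * sqrt (w (x - y))" using w0[of "x - y"] by simp
      finally show "ennreal (norm (f y * k (x - y))) \<le> ennreal (norm (f y) * sqrt (w (x - y))) * ennreal (sqrt (w (x - y)))"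
        using w0[of "x - y"] by (simp add: ennreal_mult[symmetric] ennreal_leI)
    qed
    finally have "(ennreal (norm (conv f k x)))\<^sup>2 \<le> (\<integral>\<^sup>+y. ennreal (norm (f y) * sqrt (w (x - y))) * ennreal (sqrt (w (x - y))) \<partial>lborel)\<^sup>2"
      by (rule power_mono) simp
    also have "\<dots> \<le> (\<integral>\<^sup>+y. (ennreal (norm (f y) * sqrt (w (x - y))))\<^sup>2 \<partial>lborel) * (\<integral>\<^sup>+y. (ennreal (sqrt (w (x - y))))\<^sup>2 \<partial>lborel)"
      by (rule Cauchy_Schwarz_nn_integral) measurable
    also have "\<dots> = (\<integral>\<^sup>+y. ennreal ((norm (f y))\<^sup>2 * w (x - y)) \<partial>lborel) * ennreal W"
      using w0 by (simp add: ennreal_power power_mult_distrib wn(1))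
    finally show ?thesis by (simp add: ennreal_power)
  qed
  have "(\<integral>\<^sup>+x. ennreal ((norm (conv f k x))\<^sup>2) \<partial>lborel) \<le> (\<integral>\<^sup>+x. (\<integral>\<^sup>+y. ennreal ((norm (f y))\<^sup>2 * w (x - y)) \<partial>lborel) * ennreal W \<partial>lborel)"
    by (intro nn_integral_mono pw)
  also have "\<dots> = (\<integral>\<^sup>+x. (\<integral>\<^sup>+y. ennreal ((norm (f y))\<^sup>2 * w (x - y)) \<partial>lborel) \<partial>lborel) * ennreal W"
    by (rule nn_integral_multc) measurable
  also have "(\<integral>\<^sup>+x. (\<integral>\<^sup>+y. ennreal ((norm (f y))\<^sup>2 * w (x - y)) \<partial>lborel) \<partial>lborel) = (\<integral>\<^sup>+y. (\<integral>\<^sup>+x. ennreal ((norm (f y))\<^sup>2 * w (x - y)) \<partial>lborel) \<partial>lborel)"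
    by (rule lborel_pair.Fubini') measurable
  also have "\<dots> = (\<integral>\<^sup>+y. ennreal ((norm (f y))\<^sup>2) * ennreal W \<partial>lborel)"
    using w0 by (intro nn_integral_cong) (simp add: ennreal_mult nn_integral_cmult wn(2))
  also have "\<dots> = (\<integral>\<^sup>+y. ennreal ((norm (f y))\<^sup>2) \<partial>lborel) * ennreal W"
    by (rule nn_integral_multc) measurable
  also have "(\<integral>\<^sup>+y. ennreal ((norm (f y))\<^sup>2) \<partial>lborel) = ennreal (LINT y|lborel. (norm (f y))\<^sup>2)"
    by (rule nn_integral_eq_integral[OF L2_f]) simp
  also have "ennreal (LINT y|lborel. (norm (f y))\<^sup>2) * ennreal W * ennreal W = ennreal ((LINT y|lborel. (norm (f y))\<^sup>2) * W\<^sup>2)"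
    using W0 by (simp add: ennreal_mult[symmetric] power2_eq_square mult_ac)
  finally have le: "(\<integral>\<^sup>+x. ennreal ((norm (conv f k x))\<^sup>2) \<partial>lborel) \<le> ennreal ((LINT y|lborel. (norm (f y))\<^sup>2) * W\<^sup>2)" .
  show int: "integrable lborel (\<lambda>x. (norm (conv f k x))\<^sup>2)"
    by (rule integrableI_bounded) (use le in \<open>auto intro: le_less_trans\<close>)
  have "(LINT x|lborel. (norm (conv f k x))\<^sup>2) \<le> (LINT y|lborel. (norm (f y))\<^sup>2) * W\<^sup>2"
    using le by (subst (asm) nn_integral_eq_integral[OF int]) (auto simp: ennreal_le_iff)
  hence "sqrt (LINT x|lborel. (norm (conv f k x))\<^sup>2) \<le> sqrt ((LINT y|lborel. (norm (f y))\<^sup>2) * W\<^sup>2)" by simp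
  also have "\<dots> = W * sqrt (LINT y|lborel. (norm (f y))\<^sup>2)" using W0 by (simp add: real_sqrt_mult)
  finally show "L2_norm (conv f k) \<le> C * (LINT x|lborel. inverse (1 + x\<^sup>2)) * L2_norm f"
    by (simp add: L2_norm_def W_def w_def)
qed

end

text \<open>Fubini shows that \<open>conv f k\<close> is an integral of \<open>conv f k'\<close>.
  The latter is continuous, so the fundamental theorem of calculus differentiates it back; no
  derivative is taken under the integral sign.\<close>

lemma conv_has_vector_derivative:
  assumes k: "decaying_kernel k C" and k': "decaying_kernel k' C'" and f: "L2_function f"
    and d: "\<And>x. (k has_vector_derivative k' x) (at x)"
  shows "(conv f k has_vector_derivative conv f k' x0) (at x0)"
proof -
  interpret k: L2_conv k C f by (intro L2_conv.intro k f)
  interpret k': L2_conv k' C' f by (intro L2_conv.intro k' f)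
  have [measurable]: "f \<in> borel_measurable borel" by (rule k.meas_f)
  have [measurable]: "k' \<in> borel_measurable borel" by (rule k'.meas_k)
  \<comment> \<open>Any base point to the left of \<open>x0\<close> would do: \<open>x0\<close> must
    be interior to the interval in order to have a two-sided derivative.\<close>
  define a where "a = x0 - 1"
  have incr: "conv f k x = conv f k a + integral {a..x} (conv f k')" if x: "a \<le> x" for x
  proof -
    let ?F = "\<lambda>v y. indicator {a..x} v *\<^sub>R (f y * k' (v - y))"
    define I where "I = (LINT y|lborel. (norm (f y))\<^sup>2) + (LINT y|lborel. (norm (k' y))\<^sup>2)"
    have ni: "(LINT y|lborel. norm (f y * k' (v - y))) \<le> I" for v
    proof -
      have ik: "integrable lborel (\<lambda>y. (norm (k' (v - y)))\<^sup>2)"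
        by (rule integrable_reflect_shift[OF k'.integrable_k_square])
      have "(LINT y|lborel. norm (f y * k' (v - y))) \<le> (LINT y|lborel. (norm (f y))\<^sup>2 + (norm (k' (v - y)))\<^sup>2)"
      proof (rule integral_mono)
        fix y
        have "2 * norm (f y) * norm (k' (v - y)) \<le> (norm (f y))\<^sup>2 + (norm (k' (v - y)))\<^sup>2" by (rule sum_squares_bound)
        moreover have "0 \<le> norm (f y) * norm (k' (v - y))" by simp
        ultimately show "norm (f y * k' (v - y)) \<le> (norm (f y))\<^sup>2 + (norm (k' (v - y)))\<^sup>2"
          unfolding norm_mult by linarith
      qed (use k'.integrable_conv k.L2_f ik in auto)
      also have "\<dots> = I"
        unfolding I_def using k.L2_f ik by (simp add: LINT_reflect_shift[of "\<lambda>y. (norm (k' y))\<^sup>2"])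
      finally show ?thesis .
    qed
    have int: "integrable (lborel \<Otimes>\<^sub>M lborel) (\<lambda>(v,y). ?F v y)"
    proof (rule lborel_pair.Fubini_integrable)
      show "(\<lambda>(v,y). ?F v y) \<in> borel_measurable (lborel \<Otimes>\<^sub>M lborel)" by measurable
      have "integrable lborel (\<lambda>v. indicator {a..x} v *\<^sub>R (LINT y|lborel. norm (f y * k' (v - y))))"
      proof (rule Bochner_Integration.integrable_bound)
        show "integrable lborel (\<lambda>v. indicator {a..x} v * I)"
          using x by (intro integrable_mult_left) (simp add: integrable_indicator_iff)
        have "0 \<le> (LINT y|lborel. norm (f y * k' (v - y)))" for v by simp
        thus "AE v in lborel. norm (indicator {a..x} v *\<^sub>R (LINT y|lborel. norm (f y * k' (v - y)))) \<le> norm (indicator {a..x} v * I)"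
          using ni by (intro AE_I2) (auto simp: indicator_def intro: order.trans[OF ni abs_ge_self])
      qed measurable
      thus "integrable lborel (\<lambda>v. LINT y|lborel. norm (case (v, y) of (v, y) \<Rightarrow> ?F v y))"
        by (simp add: norm_mult)
      show "AE v in lborel. integrable lborel (\<lambda>y. case (v, y) of (v, y) \<Rightarrow> ?F v y)"
        using k'.integrable_conv by simp
    qed
    have "conv f k x - conv f k a = (LINT y|lborel. f y * k (x - y) - f y * k (a - y))"
      unfolding conv_def by (rule Bochner_Integration.integral_diff[symmetric]; rule k.integrable_conv)
    also have "\<dots> = (LINT y|lborel. LINT v|lborel. ?F v y)"
    proof (rule Bochner_Integration.integral_cong[OF refl])
      fix y
      have eq: "(LINT v|lborel. indicator {a..x} v *\<^sub>R k' (v - y)) = k (x - y) - k (a - y)"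
      proof (rule integral_FTC_atLeastAtMost[OF x])
        fix v
        have "((k \<circ> (\<lambda>v. v - y)) has_vector_derivative 1 *\<^sub>R k' (v - y)) (at v)"
          by (rule vector_diff_chain_at[OF _ d]) (auto intro!: derivative_eq_intros)
        thus "((\<lambda>v. k (v - y)) has_vector_derivative k' (v - y)) (at v within {a..x})"
          by (simp add: o_def has_vector_derivative_at_within)
      next
        show "continuous_on {a..x} (\<lambda>v. k' (v - y))"
          by (rule continuous_on_compose2[OF k'.cont_k]) (auto intro!: continuous_intros)
      qed
      have "f y * k (x - y) - f y * k (a - y) = f y * (LINT v|lborel. indicator {a..x} v *\<^sub>R k' (v - y))"
        unfolding eq by (simp add: algebra_simps)
      also have "\<dots> = (LINT v|lborel. f y * (indicator {a..x} v *\<^sub>R k' (v - y)))"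
        by (rule integral_mult_right_zero[symmetric])
      also have "\<dots> = (LINT v|lborel. ?F v y)" by simp
      finally show "f y * k (x - y) - f y * k (a - y) = (LINT v|lborel. ?F v y)" .
    qed
    also have "\<dots> = (LINT v|lborel. LINT y|lborel. ?F v y)"
      using lborel_pair.Fubini_integral[OF int] by simp
    also have "\<dots> = (LINT v|lborel. indicator {a..x} v *\<^sub>R conv f k' v)"
      unfolding conv_def by simp
    also have "\<dots> = integral {a..x} (conv f k')"
    proof -
      have "set_integrable lborel {a..x} (conv f k')"
        by (rule borel_integrable_atLeastAtMost') (rule continuous_on_subset[OF k'.continuous_conv], simp)
      from set_borel_integral_eq_integral(2)[OF this] show ?thesis by (simp add: set_lebesgue_integral_def)
    qed
    finally show ?thesis by (simp add: algebra_simps)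
  qed
  have "((\<lambda>x. integral {a..x} (conv f k')) has_vector_derivative conv f k' x0) (at x0 within {a..x0+1})"
    by (rule integral_has_vector_derivative) (auto simp: a_def intro: continuous_on_subset[OF k'.continuous_conv])
  hence "((\<lambda>x. conv f k a + integral {a..x} (conv f k')) has_vector_derivative conv f k' x0) (at x0 within {a..x0+1})"
    using has_vector_derivative_add[OF has_vector_derivative_const] by fastforce
  hence "(conv f k has_vector_derivative conv f k' x0) (at x0 within {a..x0+1})"
  proof (rule has_vector_derivative_transform[rotated 2])
    show "x0 \<in> {a..x0+1}" by (simp add: a_def)
    show "conv f k x = conv f k a + integral {a..x} (conv f k')" if "x \<in> {a..x0+1}" for x
      by (rule incr) (use that in simp)
  qed
  thus ?thesis using at_within_interior[of x0 "{a..x0+1}"] by (simp add: a_def)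
qed


section \<open>Kernels of multipliers with compactly supported symbols\<close>

lemma norm_fourier_le: "norm (fourier g x) \<le> (LINT y|lborel. norm (g y))"
  unfolding fourier_def by (rule order.trans[OF integral_norm_bound]) (simp add: norm_mult)

text \<open>Two integrations by parts turn x^2 times the transform of g into the transform of g2 up
  to sign, and a transform is bounded by the L^1 norm.\<close>

lemma fourier_decay:
  assumes g: "test_fun g" and d1: "\<And>x. (g has_vector_derivative g1 x) (at x)"
    and d2: "\<And>x. (g1 has_vector_derivative g2 x) (at x)" and g2: "continuous_on UNIV g2"
  shows "\<exists>C. \<forall>x. norm (fourier g x) \<le> C * inverse (1 + x\<^sup>2)"
proof -
  have g1: "continuous_on UNIV g1"
    using d2 by (meson continuous_at_imp_continuous_on has_vector_derivative_continuous)
  have t1: "test_fun g1" by (rule test_fun_derivative[OF g g1 d1])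
  define C where "C = (LINT y|lborel. norm (g y)) + (LINT y|lborel. norm (g2 y))"
  have "norm (fourier g x) \<le> C * inverse (1 + x\<^sup>2)" for x
  proof -
    have "fourier g2 x = \<i> * of_real x * (\<i> * of_real x * fourier g x)"
      by (simp only: fourier_derivative[OF t1 g2 d2] fourier_derivative[OF g g1 d1])
    hence "norm (fourier g2 x) = x\<^sup>2 * norm (fourier g x)"
      by (simp add: norm_mult power2_eq_square)
    hence "(1 + x\<^sup>2) * norm (fourier g x) = norm (fourier g x) + norm (fourier g2 x)"
      by (simp add: algebra_simps)
    also have "\<dots> \<le> C" unfolding C_def by (intro add_mono norm_fourier_le)
    finally have le: "(1 + x\<^sup>2) * norm (fourier g x) \<le> C" .
    have "0 < 1 + x\<^sup>2" by (simp add: add_pos_nonneg)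
    thus ?thesis using le by (simp add: field_simps)
  qed
  thus ?thesis by blast
qed

lemma fourier_has_vector_derivative:
  assumes g: "test_fun g"
  shows "(fourier g has_vector_derivative fourier (\<lambda>y. - \<i> * of_real y * g y) x) (at x)"
proof -
  obtain K where K: "K > 0" "\<And>x. \<bar>x\<bar> > K \<Longrightarrow> g x = 0" using test_funE[OF g] by metis
  have cg: "continuous_on UNIV g" by (rule test_fun_continuous[OF g])
  have gc: "continuous_on S (\<lambda>x. g (f x))" if "continuous_on S f" for S :: "(real \<times> real) set" and f
    by (rule continuous_on_compose2[OF cg that]) auto
  have e1: "fourier g = (\<lambda>x. integral (cbox (-K) K) (\<lambda>y. g y * cis (- y * x)))"
  proof
    fix x show "fourier g x = integral (cbox (-K) K) (\<lambda>y. g y * cis (- y * x))"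
      unfolding fourier_def cbox_interval
      by (rule LINT_eq_integral_Icc) (use K in \<open>auto intro!: continuous_intros cg\<close>)
  qed
  have e2: "fourier (\<lambda>y. - \<i> * of_real y * g y) x = integral (cbox (-K) K) (\<lambda>y. - \<i> * of_real y * g y * cis (- y * x))"
      unfolding fourier_def cbox_interval
      by (rule LINT_eq_integral_Icc) (use K in \<open>auto intro!: continuous_intros cg\<close>)
  show ?thesis
    unfolding e1 e2
  proof (rule leibniz_rule_vector_derivative[where U=UNIV])
    fix x y :: real
    have "((\<lambda>x. cis (- x * y)) has_vector_derivative - \<i> * of_real y * cis (- x * y)) (at x)"
      by (rule has_vector_derivative_cis_linear)
    from has_vector_derivative_mult_right[OF this, of "g y"]
    show "((\<lambda>x. g y * cis (- y * x)) has_vector_derivative - \<i> * of_real y * g y * cis (- y * x)) (at x)"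
      by (simp add: mult_ac)
    show "(\<lambda>y. g y * cis (- y * x)) integrable_on cbox (-K) K"
      unfolding cbox_interval by (intro integrable_continuous_real continuous_intros continuous_on_subset[OF cg]) auto
  next
    show "continuous_on (UNIV \<times> cbox (-K) K) (\<lambda>(x,y). - \<i> * of_real y * g y * cis (- y * x))"
      unfolding case_prod_beta by (intro continuous_intros gc)
  qed auto
qed

text \<open>Two derivatives are what the decay 1 / (1 + x^2) of the kernel takes, and the class is
  stable under multiplying the symbol by the frequency and, away from frequency 0, dividing by
  it.\<close>

definition C2_test :: "(real \<Rightarrow> real) \<Rightarrow> bool" where
  "C2_test h \<longleftrightarrow> (\<exists>h1 h2. (\<forall>x. (h has_real_derivative h1 x) (at x)) \<and> (\<forall>x. (h1 has_real_derivative h2 x) (at x)) \<and>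
     continuous_on UNIV h2 \<and> (\<exists>K. \<forall>x. h x \<noteq> 0 \<longrightarrow> \<bar>x\<bar> \<le> K))"

lemma C2_test_imp_test_fun:
  assumes "C2_test h"
  shows "test_fun (\<lambda>y. of_real (h y))"
proof -
  from assms obtain h1 K where h: "\<And>x. (h has_real_derivative h1 x) (at x)" "\<And>x. h x \<noteq> 0 \<Longrightarrow> \<bar>x\<bar> \<le> K"
    unfolding C2_test_def by blast
  have "continuous_on UNIV (\<lambda>y. complex_of_real (h y))"
    by (intro continuous_intros DERIV_continuous_on[OF has_field_derivative_at_within[OF h(1)]])
  thus ?thesis using h(2) by (auto simp: test_fun_def)
qed

text \<open>The inverse transform of \<open>h\<close> in the convention of \<open>Phi_of\<close>,
  with e^(2 pi i x y): the argument -2 pi x converts from the angular convention of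
  \<open>fourier\<close>.\<close>

definition osc_kernel :: "(real \<Rightarrow> real) \<Rightarrow> real \<Rightarrow> complex" where
  "osc_kernel h x = fourier (\<lambda>y. of_real (h y)) (- 2 * pi * x)"

lemma osc_kernel_has_vector_derivative:
  assumes "C2_test h"
  shows "(osc_kernel h has_vector_derivative 2 * pi * \<i> * osc_kernel (\<lambda>y. y * h y) x) (at x)"
proof -
  let ?g = "\<lambda>y. complex_of_real (h y)"
  have "((fourier ?g \<circ> (\<lambda>x. - 2 * pi * x)) has_vector_derivative (- 2 * pi) *\<^sub>R fourier (\<lambda>y. - \<i> * of_real y * ?g y) (- 2 * pi * x)) (at x)"
    by (rule vector_diff_chain_at[OF _ fourier_has_vector_derivative[OF C2_test_imp_test_fun[OF assms]]])
       (auto intro!: derivative_eq_intros)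
  also have "fourier (\<lambda>y. - \<i> * of_real y * ?g y) (- 2 * pi * x) = - \<i> * osc_kernel (\<lambda>y. y * h y) x"
    unfolding osc_kernel_def fourier_def integral_mult_right_zero[symmetric] by (simp add: mult_ac)
  finally show ?thesis
    by (simp add: o_def osc_kernel_def[abs_def] scaleR_conv_of_real mult_ac)
qed

lemma osc_kernel_decaying:
  assumes "C2_test h"
  shows "\<exists>C. decaying_kernel (osc_kernel h) C"
proof -
  from assms obtain h1 h2 where h: "\<And>x. (h has_real_derivative h1 x) (at x)" "\<And>x. (h1 has_real_derivative h2 x) (at x)"
    "continuous_on UNIV h2" unfolding C2_test_def by blast
  have "\<exists>C. \<forall>x. norm (fourier (\<lambda>y. of_real (h y)) x) \<le> C * inverse (1 + x\<^sup>2)"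
    by (rule fourier_decay[OF C2_test_imp_test_fun[OF assms] has_vector_derivative_of_real[OF h(1)] has_vector_derivative_of_real[OF h(2)]])
       (intro continuous_intros h(3))
  then obtain C where C: "\<And>x. norm (fourier (\<lambda>y. of_real (h y)) x) \<le> C * inverse (1 + x\<^sup>2)" by blast
  have C0: "C \<ge> 0" using order.trans[OF norm_ge_zero C[of 0]] by simp
  have "norm (osc_kernel h x) \<le> C * inverse (1 + x\<^sup>2)" for x
  proof -
    have "1 \<le> (2 * pi)\<^sup>2" by (rule one_le_power) (use pi_gt3 in linarith)
    hence "1 * x\<^sup>2 \<le> (2 * pi)\<^sup>2 * x\<^sup>2" by (intro mult_right_mono) auto
    hence "inverse (1 + (- 2 * pi * x)\<^sup>2) \<le> inverse (1 + x\<^sup>2)"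
      by (intro le_imp_inverse_le) (auto simp: power_mult_distrib add_pos_nonneg)
    hence "C * inverse (1 + (- 2 * pi * x)\<^sup>2) \<le> C * inverse (1 + x\<^sup>2)" using C0 by (rule mult_left_mono)
    with C[of "- 2 * pi * x"] show ?thesis unfolding osc_kernel_def by linarith
  qed
  moreover have "continuous_on UNIV (osc_kernel h)"
    using osc_kernel_has_vector_derivative[OF assms]
    by (meson continuous_at_imp_continuous_on has_vector_derivative_continuous)
  ultimately show ?thesis by (intro exI[of _ C]) (simp add: decaying_kernel_def)
qed

lemma decaying_kernel_cmult:
  assumes "decaying_kernel k C"
  shows "decaying_kernel (\<lambda>x. a * k x) (norm a * C)"
proof -
  interpret decaying_kernel k C by fact
  show ?thesis
    by unfold_locales (auto intro!: continuous_intros cont_k mult_left_mono decay simp: norm_mult mult.assoc)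
qed

lemma C2_test_times_id:
  assumes "C2_test h"
  shows "C2_test (\<lambda>y. y * h y)"
proof -
  from assms obtain h1 h2 K where h: "\<And>x. (h has_real_derivative h1 x) (at x)" "\<And>x. (h1 has_real_derivative h2 x) (at x)"
    "continuous_on UNIV h2" "\<And>x. h x \<noteq> 0 \<Longrightarrow> \<bar>x\<bar> \<le> K" unfolding C2_test_def by blast
  have c: "continuous_on UNIV h1" by (rule DERIV_continuous_on[OF has_field_derivative_at_within[OF h(2)]])
  have 1: "((\<lambda>y. y * h y) has_real_derivative h x + x * h1 x) (at x)" for x
    by (auto intro!: derivative_eq_intros h(1))
  have 2: "((\<lambda>x. h x + x * h1 x) has_real_derivative 2 * h1 x + x * h2 x) (at x)" for x
    by (auto intro!: derivative_eq_intros h(1) h(2))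
  have 3: "continuous_on UNIV (\<lambda>x. 2 * h1 x + x * h2 x)" by (intro continuous_intros c h(3))
  show ?thesis unfolding C2_test_def
    by (rule exI[of _ "\<lambda>x. h x + x * h1 x"], rule exI[of _ "\<lambda>x. 2 * h1 x + x * h2 x"], intro conjI allI exI[of _ K] 1 2 3)
       (use h(4) in auto)
qed

text \<open>Away from 0 this is the quotient rule. Near 0 the quotient is identically zero, and at 0
  itself division by zero gives 0, so the same formula holds there.\<close>

lemma vanishing_near_0_divide_id:
  fixes h h' :: "real \<Rightarrow> real"
  assumes z: "\<And>x. \<bar>x\<bar> < 1/2 \<Longrightarrow> h x = 0"
  shows "(\<And>x. (h has_real_derivative h' x) (at x)) \<Longrightarrow>
      ((\<lambda>y. h y / y) has_real_derivative h' x / x - h x / x / x) (at x)"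
    and "continuous_on UNIV h \<Longrightarrow> continuous_on UNIV (\<lambda>y. h y / y)"
proof -
  have op: "open {x::real. \<bar>x\<bar> < 1/2}" by (intro open_Collect_less continuous_intros)
  assume d: "\<And>x. (h has_real_derivative h' x) (at x)"
  show "((\<lambda>y. h y / y) has_real_derivative h' x / x - h x / x / x) (at x)"
  proof (cases "x = 0")
    case True
    have "((\<lambda>y. h y / y) has_real_derivative 0) (at 0)"
      by (rule DERIV_cong_ev[OF refl _ refl, THEN iffD2, of _ "\<lambda>_. 0"])
         (auto simp: eventually_nhds z intro!: exI[of _ "{x::real. \<bar>x\<bar> < 1/2}"] op)
    thus ?thesis using True by simp
  next
    case False
    thus ?thesis by (auto intro!: derivative_eq_intros d simp: field_simps power2_eq_square)
  qed
next
  have op: "open {x::real. \<bar>x\<bar> < 1/2}" by (intro open_Collect_less continuous_intros)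
  assume c: "continuous_on UNIV h"
  show "continuous_on UNIV (\<lambda>y. h y / y)"
    unfolding continuous_on_eq_continuous_at[OF open_UNIV]
  proof
    fix x :: real
    show "isCont (\<lambda>y. h y / y) x"
    proof (cases "x = 0")
      case True
      have "continuous_on {x::real. \<bar>x\<bar> < 1/2} (\<lambda>y. h y / y)"
        by (rule continuous_on_eq[OF continuous_on_const[of _ 0]]) (simp add: z)
      hence "isCont (\<lambda>y. h y / y) 0" unfolding continuous_on_eq_continuous_at[OF op] by simp
      thus ?thesis using True by simp
    next
      case False
      thus ?thesis using c by (auto intro!: continuous_intros simp: continuous_on_eq_continuous_at)
    qed
  qed
qed

lemma derivative_vanishes_near_0:
  assumes z: "\<And>x. \<bar>x\<bar> < 1/2 \<Longrightarrow> h x = 0" and d: "\<And>x. (h has_real_derivative h' x) (at x)" and x: "\<bar>x\<bar> < 1/2"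
  shows "h' x = (0::real)"
proof -
  have op: "open {x::real. \<bar>x\<bar> < 1/2}" by (intro open_Collect_less continuous_intros)
  have "(h has_real_derivative 0) (at x)"
    by (rule DERIV_cong_ev[OF refl _ refl, THEN iffD2, of _ "\<lambda>_. 0"])
       (use x in \<open>auto simp: eventually_nhds z intro!: exI[of _ "{x::real. \<bar>x\<bar> < 1/2}"] op\<close>)
  from DERIV_unique[OF d this] show ?thesis .
qed

text \<open>Dividing the symbol by the frequency integrates the kernel; this is the source of the
  primitive H.\<close>

lemma C2_test_divide_id:
  assumes "C2_test h" and z: "\<And>x. \<bar>x\<bar> < 1/2 \<Longrightarrow> h x = 0"
  shows "C2_test (\<lambda>y. h y / y)"
proof -
  from assms(1) obtain h1 h2 K where h: "\<And>x. (h has_real_derivative h1 x) (at x)" "\<And>x. (h1 has_real_derivative h2 x) (at x)"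
    "continuous_on UNIV h2" "\<And>x. h x \<noteq> 0 \<Longrightarrow> \<bar>x\<bar> \<le> K" unfolding C2_test_def by blast
  note z1 = derivative_vanishes_near_0[of h h1, OF z h(1)]
  note z2 = derivative_vanishes_near_0[of h1 h2, OF z1 h(2)]
  have c: "continuous_on UNIV h" "continuous_on UNIV h1"
    by (rule DERIV_continuous_on[OF has_field_derivative_at_within[OF h(1)]]
             DERIV_continuous_on[OF has_field_derivative_at_within[OF h(2)]])+
  have 1: "((\<lambda>y. h y / y) has_real_derivative h1 x / x - h x / x / x) (at x)" for x
    by (rule vanishing_near_0_divide_id(1)[OF z h(1)])
  have d1': "((\<lambda>y. h y / y / y) has_real_derivative (h1 x / x - h x / x / x) / x - h x / x / x / x) (at x)" for x
    by (rule vanishing_near_0_divide_id(1)[OF _ 1]) (simp add: z)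
  have d1'': "((\<lambda>y. h1 y / y) has_real_derivative h2 x / x - h1 x / x / x) (at x)" for x
    by (rule vanishing_near_0_divide_id(1)[OF z1 h(2)])
  have 2: "((\<lambda>y. h1 y / y - h y / y / y) has_real_derivative
      h2 x / x - h1 x / x / x - ((h1 x / x - h x / x / x) / x - h x / x / x / x)) (at x)" for x
    by (rule DERIV_diff[OF d1'' d1'])
  have 3: "continuous_on UNIV (\<lambda>x. h2 x / x - h1 x / x / x - ((h1 x / x - h x / x / x) / x - h x / x / x / x))"
  proof -
    have q: "continuous_on UNIV (\<lambda>x. g x / x)" if "continuous_on UNIV g" "\<And>x. \<bar>x\<bar> < 1/2 \<Longrightarrow> g x = 0" for g :: "real \<Rightarrow> real"
      by (rule vanishing_near_0_divide_id(2)[OF that(2) that(1)])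
    have a1: "continuous_on UNIV (\<lambda>x. h x / x)" by (rule q[OF c(1) z])
    have a2: "continuous_on UNIV (\<lambda>x. h x / x / x)" by (rule q[OF a1]) (simp add: z)
    have a3: "continuous_on UNIV (\<lambda>x. h x / x / x / x)" by (rule q[OF a2]) (simp add: z)
    have b1: "continuous_on UNIV (\<lambda>x. h1 x / x)" by (rule q[OF c(2) z1])
    have b2: "continuous_on UNIV (\<lambda>x. h1 x / x / x)" by (rule q[OF b1]) (simp add: z1)
    have b3: "continuous_on UNIV (\<lambda>x. (h1 x / x - h x / x / x) / x)"
      by (rule q[OF continuous_on_diff[OF b1 a2]]) (simp add: z z1)
    have e: "continuous_on UNIV (\<lambda>x. h2 x / x)" by (rule q[OF h(3) z2])
    show ?thesis by (rule continuous_on_diff[OF continuous_on_diff[OF e b2] continuous_on_diff[OF b3 a3]])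
  qed
  show ?thesis unfolding C2_test_def
    by (rule exI[of _ "\<lambda>y. h1 y / y - h y / y / y"], rule exI[of _ "\<lambda>x. h2 x / x - h1 x / x / x - ((h1 x / x - h x / x / x) / x - h x / x / x / x)"], intro conjI allI exI[of _ K] 1 2 3)
       (use h(4) in auto)
qed

lemma smooth_fun_derivatives:
  assumes "smooth_fun h"
  shows "(h has_real_derivative deriv h x) (at x)" "(deriv h has_real_derivative deriv (deriv h) x) (at x)"
    "continuous_on UNIV (deriv (deriv h))" "continuous_on UNIV (deriv h)"
proof -
  have d: "((deriv ^^ k) h) differentiable (at x)" for k x using assms by (auto simp: smooth_fun_def)
  have d0: "h differentiable (at x)" "deriv h differentiable (at x)" "deriv (deriv h) differentiable (at x)" for x
    using d[of 0 x] d[of 1 x] d[of 2 x] by (simp_all add: numeral_2_eq_2)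
  show "(h has_real_derivative deriv h x) (at x)" "(deriv h has_real_derivative deriv (deriv h) x) (at x)"
    unfolding DERIV_deriv_iff_real_differentiable by (rule d0)+
  show "continuous_on UNIV (deriv (deriv h))" "continuous_on UNIV (deriv h)"
    by (intro continuous_at_imp_continuous_on ballI differentiable_imp_continuous_within d0)+
qed

lemma zero_outside_supp_fun: "x \<notin> supp_fun h \<Longrightarrow> h x = 0"
  unfolding supp_fun_def using closure_subset[of "{x. h x \<noteq> 0}"] by auto

lemma C2_test_littlewood_paley:
  assumes s: "smooth_fun \<Theta>" and supp: "supp_fun \<Theta> \<subseteq> {-1<..<1}"
  shows "C2_test (\<lambda>\<xi>. \<Theta> (\<xi> / 2) - \<Theta> \<xi>)"
proof -
  note d = smooth_fun_derivatives[OF s]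
  have sc: "((\<lambda>x. f (x / 2)) has_real_derivative f' (x / 2) / 2) (at x)" if "\<And>x. (f has_real_derivative f' x) (at x)" for f f' :: "real \<Rightarrow> real" and x
    by (rule DERIV_chain2[OF that, THEN DERIV_cong]) (auto intro!: derivative_eq_intros)
  have 1: "((\<lambda>\<xi>. \<Theta> (\<xi> / 2) - \<Theta> \<xi>) has_real_derivative deriv \<Theta> (x / 2) / 2 - deriv \<Theta> x) (at x)" for x
    by (intro DERIV_diff sc d)
  have 2: "((\<lambda>x. deriv \<Theta> (x / 2) / 2 - deriv \<Theta> x) has_real_derivative deriv (deriv \<Theta>) (x / 2) / 2 / 2 - deriv (deriv \<Theta>) x) (at x)" for x
    by (intro DERIV_diff DERIV_cdivide sc d)
  have 3: "continuous_on UNIV (\<lambda>x. deriv (deriv \<Theta>) (x / 2) / 2 / 2 - deriv (deriv \<Theta>) x)"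
  proof -
    have "continuous_on UNIV (\<lambda>x. deriv (deriv \<Theta>) (x / 2))"
      by (rule continuous_on_compose2[OF d(3)]) (auto intro!: continuous_intros)
    thus ?thesis by (intro continuous_on_diff continuous_on_divide continuous_on_const d(3)) simp_all
  qed
  have z: "\<Theta> x = 0" if "\<bar>x\<bar> \<ge> 1" for x
    by (rule zero_outside_supp_fun[of x \<Theta>]) (use subsetD[OF supp, of x] that in auto)
  have 4: "\<bar>x\<bar> \<le> 2" if "\<Theta> (x / 2) - \<Theta> x \<noteq> 0" for x
    using z[of x] z[of "x/2"] that by (cases "\<bar>x\<bar> \<le> 2") auto
  show ?thesis unfolding C2_test_def
    by (rule exI[of _ "\<lambda>x. deriv \<Theta> (x / 2) / 2 - deriv \<Theta> x"], rule exI[of _ "\<lambda>x. deriv (deriv \<Theta>) (x / 2) / 2 / 2 - deriv (deriv \<Theta>) x"],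
        intro conjI allI exI[of _ 2] impI 1 2 3 4)
qed

text \<open>The frequency localisation in the form in which it is used: L^2 control of a derivative
  and of a primitive. Both are demanded of the same function because \<open>f\<close> and
  \<open>g\<close> exchange their roles when j changes sign.\<close>

definition tame :: "(real \<Rightarrow> complex) \<Rightarrow> real \<Rightarrow> bool" where
  "tame P M \<longleftrightarrow> (\<exists>P' H. (\<forall>x. (P has_vector_derivative P' x) (at x)) \<and> (\<forall>x. (H has_vector_derivative P x) (at x)) \<and>
     continuous_on UNIV P' \<and> integrable lborel (\<lambda>x. (norm (P x))\<^sup>2) \<and>
     integrable lborel (\<lambda>x. (norm (P' x))\<^sup>2) \<and> integrable lborel (\<lambda>x. (norm (H x))\<^sup>2) \<and>
     L2_norm P \<le> M \<and> L2_norm P' \<le> M \<and> L2_norm H \<le> M)"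

text \<open>The derivative and the primitive of \<open>R_Phi \<Theta> f\<close> are again
  convolutions with f, with the symbols 2 pi i y \<phi>(y) and \<phi>(y) / (2 pi i y). The second is
  regular because \<Theta> is 1 at both y and y/2 when |y| < 1/2, so that \<phi> vanishes
  there.\<close>

theorem R_Phi_regularity:
  assumes s: "smooth_fun \<Theta>" and supp: "supp_fun \<Theta> \<subseteq> {-1<..<1}" and one: "\<forall>x. \<bar>x\<bar> \<le> 1/2 \<longrightarrow> \<Theta> x = 1"
  shows "\<exists>C\<ge>0. \<forall>f. in_L2 f \<longrightarrow> tame (R_Phi \<Theta> f) (C * L2_norm f)"
proof -
  define \<phi> where "\<phi> \<xi> = \<Theta> (\<xi> / 2) - \<Theta> \<xi>" for \<xi>
  have C2: "C2_test \<phi>" unfolding \<phi>_def[abs_def] by (rule C2_test_littlewood_paley[OF s supp])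
  have z: "\<phi> x = 0" if "\<bar>x\<bar> < 1/2" for x using one that by (simp add: \<phi>_def)
  define \<phi>d where "\<phi>d y = \<phi> y / y" for y
  have C2d: "C2_test \<phi>d" unfolding \<phi>d_def[abs_def] by (rule C2_test_divide_id[OF C2 z])
  have \<phi>_eq: "(\<lambda>y. y * \<phi>d y) = \<phi>" using z[of 0] by (auto simp: \<phi>d_def fun_eq_iff)
  have Phi: "Phi_of \<Theta> = osc_kernel \<phi>"
    by (auto simp: fun_eq_iff Phi_of_def osc_kernel_def fourier_def \<phi>_def mult_ac)
  define k1 where "k1 x = 2 * pi * \<i> * osc_kernel (\<lambda>y. y * \<phi> y) x" for x
  define k2 where "k2 x = 1 / (2 * pi * \<i>) * osc_kernel \<phi>d x" for x
  obtain C0 where C0: "decaying_kernel (osc_kernel \<phi>) C0" using osc_kernel_decaying[OF C2] by blast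
  obtain C1 where "decaying_kernel (osc_kernel (\<lambda>y. y * \<phi> y)) C1" using osc_kernel_decaying[OF C2_test_times_id[OF C2]] by blast
  from decaying_kernel_cmult[OF this, of "2 * pi * \<i>"] obtain C1 where C1: "decaying_kernel k1 C1" unfolding k1_def[abs_def] by blast
  obtain C2' where "decaying_kernel (osc_kernel \<phi>d) C2'" using osc_kernel_decaying[OF C2d] by blast
  from decaying_kernel_cmult[OF this, of "1 / (2 * pi * \<i>)"] obtain C2' where C2': "decaying_kernel k2 C2'" unfolding k2_def[abs_def] by blast
  have dk: "(osc_kernel \<phi> has_vector_derivative k1 x) (at x)" for x
    unfolding k1_def by (rule osc_kernel_has_vector_derivative[OF C2])
  have dk2: "(k2 has_vector_derivative osc_kernel \<phi> x) (at x)" for x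
    using has_vector_derivative_mult_right[OF osc_kernel_has_vector_derivative[OF C2d, of x], of "1 / (2 * pi * \<i>)"]
    unfolding \<phi>_eq k2_def[abs_def] by simp
  define W where "W = (LINT x|lborel. inverse (1 + (x::real)\<^sup>2))"
  have W0: "W \<ge> 0" by (simp add: W_def)
  define C where "C = (\<bar>C0\<bar> + \<bar>C1\<bar> + \<bar>C2'\<bar>) * W"
  have C_nonneg: "C \<ge> 0" using W0 by (simp add: C_def)
  have CW: "C0 * W \<le> C" "C1 * W \<le> C" "C2' * W \<le> C" unfolding C_def by (intro mult_right_mono W0; linarith)+
  show ?thesis
  proof (intro exI[of _ C] conjI C_nonneg allI impI)
    fix f assume f: "in_L2 f"
    have [measurable]: "f \<in> borel_measurable borel" using f by (simp add: in_L2_def)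
    have "integrable lborel (\<lambda>x. (norm (f x))\<^sup>2)"
      by (rule integrableI_bounded) (use f in \<open>auto simp: in_L2_def\<close>)
    hence Lf: "L2_function f" by unfold_locales simp_all
    have R: "R_Phi \<Theta> f = conv f (osc_kernel \<phi>)"
      by (auto simp: fun_eq_iff R_Phi_def conv_def Phi)
    interpret c0: L2_conv "osc_kernel \<phi>" C0 f by (intro L2_conv.intro C0 Lf)
    interpret c1: L2_conv k1 C1 f by (intro L2_conv.intro C1 Lf)
    interpret c2: L2_conv k2 C2' f by (intro L2_conv.intro C2' Lf)
    have n: "C' * W * L2_norm f \<le> C * L2_norm f" if "C' * W \<le> C" for C'
      using that by (intro mult_right_mono) auto
    show "tame (R_Phi \<Theta> f) (C * L2_norm f)"
      unfolding R tame_def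
    proof (rule exI[of _ "conv f k1"], rule exI[of _ "conv f k2"], intro conjI allI)
      show "(conv f (osc_kernel \<phi>) has_vector_derivative conv f k1 x) (at x)" for x
        by (rule conv_has_vector_derivative[OF C0 C1 Lf dk])
      show "(conv f k2 has_vector_derivative conv f (osc_kernel \<phi>) x) (at x)" for x
        by (rule conv_has_vector_derivative[OF C2' C0 Lf dk2])
      show "L2_norm (conv f (osc_kernel \<phi>)) \<le> C * L2_norm f"
        using order.trans[OF c0.L2_norm_conv_le n[OF CW(1), unfolded W_def]] .
      show "L2_norm (conv f k1) \<le> C * L2_norm f"
        using order.trans[OF c1.L2_norm_conv_le n[OF CW(2), unfolded W_def]] .
      show "L2_norm (conv f k2) \<le> C * L2_norm f"
        using order.trans[OF c2.L2_norm_conv_le n[OF CW(3), unfolded W_def]] .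
    qed (rule c1.continuous_conv c0.L2_integrable_conv c1.L2_integrable_conv c2.L2_integrable_conv)+
  qed
qed


section \<open>Reduction to power curves\<close>

lemma tame_continuous: "tame P M \<Longrightarrow> continuous_on UNIV P"
  unfolding tame_def by (meson continuous_at_imp_continuous_on has_vector_derivative_continuous)

lemma tame_nonneg: "tame P M \<Longrightarrow> 0 \<le> M"
  unfolding tame_def using L2_norm_nonneg order.trans by blast

lemma tame_reflect:
  assumes "tame P M"
  shows "tame (\<lambda>x. P (- x)) M"
proof -
  from assms obtain P' H where P: "\<And>x. (P has_vector_derivative P' x) (at x)" "\<And>x. (H has_vector_derivative P x) (at x)"
     "continuous_on UNIV P'" "integrable lborel (\<lambda>x. (norm (P x))\<^sup>2)"
     "integrable lborel (\<lambda>x. (norm (P' x))\<^sup>2)" "integrable lborel (\<lambda>x. (norm (H x))\<^sup>2)"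
     "L2_norm P \<le> M" "L2_norm P' \<le> M" "L2_norm H \<le> M" unfolding tame_def by blast
  have d: "((\<lambda>x. G (- x)) has_vector_derivative - G' (- x)) (at x)" if "\<And>x. (G has_vector_derivative G' x) (at x)" for G G' :: "real \<Rightarrow> complex" and x
  proof -
    have "((G \<circ> (\<lambda>x. - x)) has_vector_derivative (-1) *\<^sub>R G' (- x)) (at x)"
      by (rule vector_diff_chain_at[OF _ that]) (auto intro!: derivative_eq_intros)
    thus ?thesis by (simp add: o_def)
  qed
  have i: "integrable lborel (\<lambda>x. (norm (G (- x)))\<^sup>2)" if "integrable lborel (\<lambda>x. (norm (G x))\<^sup>2)" for G :: "real \<Rightarrow> complex"
    using integrable_reflect_shift[OF that, of 0] by simp
  have n: "L2_norm (\<lambda>x. G (- x)) = L2_norm G" "L2_norm (\<lambda>x. - G (- x)) = L2_norm G" for G :: "real \<Rightarrow> complex"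
    using LINT_reflect_shift[of "\<lambda>x. (norm (G x))\<^sup>2" 0] by (simp_all add: L2_norm_def)
  show ?thesis unfolding tame_def
  proof (rule exI[of _ "\<lambda>x. - P' (- x)"], rule exI[of _ "\<lambda>x. - H (- x)"], intro conjI allI)
    show "((\<lambda>x. P (- x)) has_vector_derivative - P' (- x)) (at x)" for x by (rule d[OF P(1)])
    show "((\<lambda>x. - H (- x)) has_vector_derivative P (- x)) (at x)" for x
      using has_vector_derivative_minus[OF d[OF P(2), of x]] by simp
    show "continuous_on UNIV (\<lambda>x. - P' (- x))"
      by (intro continuous_intros continuous_on_compose2[OF P(3)]) auto
  qed (use P(4-9) i[OF P(4)] i[OF P(5)] i[OF P(6)] n in simp_all)
qed

lemma derivative_zero_on_open:
  assumes z: "\<And>x. x \<in> S \<Longrightarrow> h x = 0" and S: "open S" and d: "(h has_real_derivative h') (at x)" and x: "x \<in> S"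
  shows "h' = (0::real)"
proof -
  have "(h has_real_derivative 0) (at x)"
    by (rule DERIV_cong_ev[OF refl _ refl, THEN iffD2, of _ "\<lambda>_. 0"])
       (use x S z in \<open>auto simp: eventually_nhds intro!: exI[of _ S]\<close>)
  from DERIV_unique[OF d this] show ?thesis .
qed

text \<open>Continuity of h' on the closed interval is enough, because h' vanishes on the open
  complement, where h is zero.\<close>

lemma bump_bounded:
  fixes h h' :: "real \<Rightarrow> real"
  assumes d: "\<And>x. (h has_real_derivative h' x) (at x)" and z: "\<And>x. x \<notin> {a<..<b} \<Longrightarrow> h x = 0"
    and c: "continuous_on {a..b} h'"
  shows "\<exists>X. (\<forall>x. \<bar>h x\<bar> \<le> X) \<and> (\<forall>x. \<bar>h' x\<bar> \<le> X)" and "x \<notin> {a..b} \<Longrightarrow> h' x = 0"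
proof -
  show z': "h' x = 0" if "x \<notin> {a..b}" for x
    by (rule derivative_zero_on_open[of "- {a..b}", OF _ _ d]) (use that in \<open>auto intro!: z\<close>)
  have ch: "continuous_on {a..b} h"
    by (rule DERIV_continuous_on[OF has_field_derivative_at_within[OF d]])
  obtain B1 where B1: "B1 > 0" "\<And>x. x \<in> {a..b} \<Longrightarrow> norm (h x) \<le> B1"
    using compact_imp_bounded[OF compact_continuous_image[OF ch compact_Icc]] unfolding bounded_pos by auto
  obtain B2 where B2: "B2 > 0" "\<And>x. x \<in> {a..b} \<Longrightarrow> norm (h' x) \<le> B2"
    using compact_imp_bounded[OF compact_continuous_image[OF c compact_Icc]] unfolding bounded_pos by auto
  have "\<bar>h x\<bar> \<le> B1 + B2" for x
  proof (cases "x \<in> {a..b}")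
    case True
    from B1(2)[OF True] B2(1) show ?thesis by simp
  next
    case False
    hence "h x = 0" by (intro z) auto
    thus ?thesis using B1(1) B2(1) by simp
  qed
  moreover have "\<bar>h' x\<bar> \<le> B1 + B2" for x
  proof (cases "x \<in> {a..b}")
    case True
    from B2(2)[OF True] B1(1) show ?thesis by simp
  next
    case False
    thus ?thesis using B1(1) B2(1) z'[OF False] by simp
  qed
  ultimately show "\<exists>X. (\<forall>x. \<bar>h x\<bar> \<le> X) \<and> (\<forall>x. \<bar>h' x\<bar> \<le> X)" by blast
qed

text \<open>The common normal form of both halves of the t-line and of both signs of j:
  \<open>\<tau>\<close> and \<open>\<sigma>\<close> are signs, and the exponent \<open>a\<close> is
  d or 1/d.\<close>

definition curve_form :: "real \<Rightarrow> (real \<Rightarrow> real) \<Rightarrow> real \<Rightarrow> real \<Rightarrow> real \<Rightarrow> real \<Rightarrow>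
    (real \<Rightarrow> complex) \<Rightarrow> (real \<Rightarrow> complex) \<Rightarrow> real \<Rightarrow> complex" where
  "curve_form a \<psi> \<tau> \<sigma> A N P Q x = (LINT s|lborel. P (A * x - \<tau> * N * s) * Q (x - \<sigma> * N * s powr a) * of_real (\<psi> s))"

definition curve_bound :: "real \<Rightarrow> (real \<Rightarrow> real) \<Rightarrow> real \<Rightarrow> real \<Rightarrow> real \<Rightarrow> bool" where
  "curve_bound a \<psi> \<tau> \<sigma> K \<longleftrightarrow> (\<forall>N A P Q M1 M2. N \<ge> 1 \<longrightarrow> A > 0 \<longrightarrow> A * N \<le> 1 \<longrightarrow> tame P M1 \<longrightarrow> tame Q M2 \<longrightarrow>
     L1_norm (curve_form a \<psi> \<tau> \<sigma> A N P Q) \<le> ennreal (K * N powr (-1/8) / sqrt A * M1 * M2))"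

lemma curve_form_bound:
  fixes \<psi> \<psi>' \<Theta> :: "real \<Rightarrow> real"
  assumes a: "a > 0" "a \<noteq> 1" and c: "0 < c1" "c1 < c2"
    and d\<psi>: "\<And>s. (\<psi> has_real_derivative \<psi>' s) (at s)" and c\<psi>': "continuous_on {c1..c2} \<psi>'"
    and \<psi>0: "\<And>s. s \<notin> {c1<..<c2} \<Longrightarrow> \<psi> s = 0"
    and \<Theta>: "smooth_fun \<Theta>" "supp_fun \<Theta> \<subseteq> {-1<..<1}" "\<forall>x. \<bar>x\<bar> \<le> 1/2 \<longrightarrow> \<Theta> x = 1"
    and \<sigma>: "\<sigma> = 1 \<or> \<sigma> = -1"
  shows "\<exists>K\<ge>0. curve_bound a \<psi> 1 \<sigma> K"
proof -
  obtain X where X: "\<And>s. \<bar>\<psi> s\<bar> \<le> X" "\<And>s. \<bar>\<psi>' s\<bar> \<le> X"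
    using bump_bounded(1)[OF d\<psi> \<psi>0 c\<psi>'] by blast
  obtain C0 where C0: "C0 > 0" "\<And>L1 L2 r. L2 \<noteq> 0 \<Longrightarrow> r \<noteq> 0 \<Longrightarrow>
     norm (LINT s|lborel. cis (L1 * power_curve c1 c2 a s - L2 * power_curve c1 c2 a (s + r)) * of_real (\<psi> s * \<psi> (s + r)))
       \<le> C0 / sqrt \<bar>L2 * r\<bar>"
    using power_curve_oscillation[OF a c d\<psi> X \<psi>0] by blast
  note d\<Theta> = smooth_fun_derivatives[OF \<Theta>(1)]
  have z\<Theta>: "\<Theta> x = 0" if "x \<notin> {-1<..<1}" for x
    by (rule zero_outside_supp_fun[of x \<Theta>]) (use \<Theta>(2) that in blast)
  have c\<Theta>: "continuous_on {-1..1} (deriv \<Theta>)" by (rule continuous_on_subset[OF d\<Theta>(4)]) simp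
  obtain Z where Z: "\<And>s. \<bar>\<Theta> s\<bar> \<le> Z" "\<And>s. \<bar>deriv \<Theta> s\<bar> \<le> Z"
    using bump_bounded(1)[OF d\<Theta>(1) z\<Theta> c\<Theta>] by blast
  define R where "R = max (c1 powr a) (c2 powr a)"
  define \<gamma> where "\<gamma> s = \<sigma> * power_curve c1 c2 a s" for s
  interpret localized_curve \<psi> \<gamma> X R c2 C0 \<Theta> "deriv \<Theta>" Z
  proof unfold_locales
    show "continuous_on UNIV \<psi>" by (rule DERIV_continuous_on[OF has_field_derivative_at_within[OF d\<psi>]])
    show "continuous_on UNIV \<gamma>" unfolding \<gamma>_def by (intro continuous_intros continuous_power_curve c)
    show "\<bar>\<gamma> s\<bar> \<le> R" for s using power_curve_bounded[of c1 c2 a s] c \<sigma> by (auto simp: \<gamma>_def R_def)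
    show "\<psi> s = 0" if "s \<notin> {0..c2}" for s by (rule \<psi>0) (use that c in auto)
    show "norm (LINT s|lborel. cis (L1 * \<gamma> s - L2 * \<gamma> (s + r)) * of_real (\<psi> s * \<psi> (s + r))) \<le> C0 / sqrt \<bar>L2 * r\<bar>"
      if "L2 \<noteq> 0" "r \<noteq> 0" for L1 L2 r
    proof -
      \<comment> \<open>The sign of the curve is absorbed into both frequencies, so the constant is
        the one for the unsigned curve.\<close>
      have "\<sigma> * L2 \<noteq> 0" using that \<sigma> by auto
      from C0(2)[OF this that(2), of "\<sigma> * L1"] show ?thesis
        using \<sigma> by (auto simp: \<gamma>_def mult_ac abs_mult)
    qed
    show "\<Theta> x = 1" if "\<bar>x\<bar> \<le> 1/2" for x using \<Theta>(3) that by blast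
    show "\<Theta> x = 0" if "\<bar>x\<bar> > 1" for x by (rule z\<Theta>) (use that in auto)
    show "deriv \<Theta> x = 0" if "\<bar>x\<bar> > 1" for x by (rule bump_bounded(2)[OF d\<Theta>(1) z\<Theta> c\<Theta>]) (use that in auto)
  qed (use X C0 c d\<Theta> Z in auto)
  have "L1_norm (curve_form a \<psi> 1 \<sigma> A N P Q) \<le> ennreal (4 * Kf * N powr (-1/8) / sqrt A * M1 * M2)"
    if NA: "N \<ge> 1" "A > 0" "A * N \<le> 1" and P: "tame P M1" and Q: "tame Q M2" for N A P Q M1 M2
  proof -
    have eq: "curve_form a \<psi> 1 \<sigma> A N P Q x = frozen N P Q (A * x) x" for x
      unfolding curve_form_def frozen_def
    proof (rule Bochner_Integration.integral_cong[OF refl])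
      fix s
      show "P (A * x - 1 * N * s) * Q (x - \<sigma> * N * s powr a) * of_real (\<psi> s) = P (A * x - N * s) * Q (x - N * \<gamma> s) * of_real (\<psi> s)"
      proof (cases "s \<in> {c1<..<c2}")
        case True
        hence "power_curve c1 c2 a s = s powr a" by (intro power_curve_eq) auto
        thus ?thesis by (simp add: \<gamma>_def mult_ac)
      next
        case False
        thus ?thesis using \<psi>0[OF False] by simp
      qed
    qed
    obtain P' where P': "\<And>x. (P has_vector_derivative P' x) (at x)" "continuous_on UNIV P'"
      "integrable lborel (\<lambda>x. (norm (P x))\<^sup>2)" "integrable lborel (\<lambda>x. (norm (P' x))\<^sup>2)" "L2_norm P \<le> M1" "L2_norm P' \<le> M1"
      using P unfolding tame_def by blast
    obtain H where H: "\<And>x. (H has_vector_derivative Q x) (at x)" "integrable lborel (\<lambda>x. (norm (Q x))\<^sup>2)"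
      "integrable lborel (\<lambda>x. (norm (H x))\<^sup>2)" "L2_norm Q \<le> M2" "L2_norm H \<le> M2"
      using Q unfolding tame_def by blast
    have "(\<integral>\<^sup>+x. ennreal (norm (frozen N P Q (A * x) x)) \<partial>lborel)
      \<le> ennreal (Kf * N powr (-1/8) / sqrt A * (L2_norm P + L2_norm P') * (L2_norm Q + L2_norm H))"
      by (rule bilinear_bound[OF NA P'(1-4) tame_continuous[OF Q] H(2,1,3)])
    also have "\<dots> \<le> ennreal (Kf * N powr (-1/8) / sqrt A * (M1 + M1) * (M2 + M2))"
      using P' H Kf_nonneg NA tame_nonneg[OF P] tame_nonneg[OF Q]
      by (intro ennreal_leI mult_mono add_mono mult_nonneg_nonneg divide_nonneg_nonneg add_nonneg_nonneg) auto
    also have "Kf * N powr (-1/8) / sqrt A * (M1 + M1) * (M2 + M2) = 4 * Kf * N powr (-1/8) / sqrt A * M1 * M2"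
      by (simp add: mult_ac)
    finally show ?thesis by (simp only: eq L1_norm_def)
  qed
  thus ?thesis unfolding curve_bound_def using Kf_nonneg by (intro exI[of _ "4 * Kf"]) auto
qed

text \<open>Reflecting x to -x replaces P and Q by their reflections, turns \<tau> = -1 into \<tau>
  = 1 and flips \<sigma>. Since \<open>tame\<close> and the L^1 norm are invariant, only \<tau> = 1
  needs the analysis.\<close>

lemma curve_form_bound_signs:
  fixes \<psi> \<psi>' \<Theta> :: "real \<Rightarrow> real"
  assumes a: "a > 0" "a \<noteq> 1" and c: "0 < c1" "c1 < c2"
    and d\<psi>: "\<And>s. (\<psi> has_real_derivative \<psi>' s) (at s)" and c\<psi>': "continuous_on {c1..c2} \<psi>'"
    and \<psi>0: "\<And>s. s \<notin> {c1<..<c2} \<Longrightarrow> \<psi> s = 0"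
    and \<Theta>: "smooth_fun \<Theta>" "supp_fun \<Theta> \<subseteq> {-1<..<1}" "\<forall>x. \<bar>x\<bar> \<le> 1/2 \<longrightarrow> \<Theta> x = 1"
  shows "\<exists>K\<ge>0. \<forall>\<tau>\<in>{1,-1}. \<forall>\<sigma>\<in>{1,-1}. curve_bound a \<psi> \<tau> \<sigma> K"
proof -
  obtain K1 where K1: "K1 \<ge> 0" "curve_bound a \<psi> 1 1 K1"
    using curve_form_bound[OF a c d\<psi> c\<psi>' \<psi>0 \<Theta>, of 1] by blast
  obtain K2 where K2: "K2 \<ge> 0" "curve_bound a \<psi> 1 (-1) K2"
    using curve_form_bound[OF a c d\<psi> c\<psi>' \<psi>0 \<Theta>, of "-1"] by blast
  define K where "K = K1 + K2"
  have plus: "L1_norm (curve_form a \<psi> 1 \<sigma> A N P Q) \<le> ennreal (K * N powr (-1/8) / sqrt A * M1 * M2)"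
    if "\<sigma> \<in> {1,-1}" "N \<ge> 1" "A > 0" "A * N \<le> 1" "tame P M1" "tame Q M2" for \<sigma> N A P Q M1 M2
  proof -
    have le: "ennreal (K' * N powr (-1/8) / sqrt A * M1 * M2) \<le> ennreal (K * N powr (-1/8) / sqrt A * M1 * M2)" if "K' \<le> K" for K'
      using \<open>A > 0\<close> tame_nonneg[OF \<open>tame P M1\<close>] tame_nonneg[OF \<open>tame Q M2\<close>] that
      by (intro ennreal_leI mult_right_mono divide_right_mono) auto
    have "L1_norm (curve_form a \<psi> 1 1 A N P Q) \<le> ennreal (K1 * N powr (-1/8) / sqrt A * M1 * M2)"
      "L1_norm (curve_form a \<psi> 1 (-1) A N P Q) \<le> ennreal (K2 * N powr (-1/8) / sqrt A * M1 * M2)"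
      using K1(2) K2(2) that unfolding curve_bound_def by blast+
    moreover have "K1 \<le> K" "K2 \<le> K" using K1(1) K2(1) by (auto simp: K_def)
    ultimately show ?thesis using that(1) le order.trans by blast
  qed
  have minus: "L1_norm (curve_form a \<psi> (-1) \<sigma> A N P Q) \<le> ennreal (K * N powr (-1/8) / sqrt A * M1 * M2)"
    if \<sigma>: "\<sigma> \<in> {1,-1}" and *: "N \<ge> 1" "A > 0" "A * N \<le> 1" "tame P M1" "tame Q M2" for \<sigma> N A P Q M1 M2
  proof -
    have [measurable]: "P \<in> borel_measurable borel" "Q \<in> borel_measurable borel" "\<psi> \<in> borel_measurable borel"
      using tame_continuous[OF *(4)] tame_continuous[OF *(5)] DERIV_continuous_on[OF has_field_derivative_at_within[OF d\<psi>]]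
      by (auto intro: borel_measurable_continuous_onI)
    have "L1_norm (curve_form a \<psi> (-1) \<sigma> A N P Q) =
      ennreal \<bar>-1\<bar> * (\<integral>\<^sup>+x. ennreal (norm (curve_form a \<psi> (-1) \<sigma> A N P Q (0 + -1 * x))) \<partial>lborel)"
      unfolding L1_norm_def by (rule nn_integral_real_affine) (auto simp: curve_form_def)
    also have "\<dots> = L1_norm (curve_form a \<psi> 1 (-\<sigma>) A N (\<lambda>x. P (- x)) (\<lambda>x. Q (- x)))"
      by (simp add: L1_norm_def curve_form_def algebra_simps)
    also have "\<dots> \<le> ennreal (K * N powr (-1/8) / sqrt A * M1 * M2)"
      by (rule plus) (use \<sigma> * tame_reflect in auto)
    finally show ?thesis .
  qed
  show ?thesis
    unfolding curve_bound_def using plus minus K1(1) K2(1) by (intro exI[of _ K]) (auto simp: K_def)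
qed


text \<open>The weight after the substitution t = s^e, Jacobian included.\<close>

definition root_bump :: "real \<Rightarrow> (real \<Rightarrow> real) \<Rightarrow> real \<Rightarrow> real" where
  "root_bump e \<rho> s = (if s > 0 then \<rho> (s powr e) * (e * s powr (e - 1)) else 0)"

lemma root_bump_zero:
  assumes e: "e > 0" and \<rho>: "\<And>t. t \<notin> {1/4<..<4} \<Longrightarrow> \<rho> t = 0"
    and s: "s \<notin> {(1/4) powr (1/e)<..<4 powr (1/e)}"
  shows "root_bump e \<rho> s = 0"
proof (cases "s > 0")
  case True
  consider "s \<le> (1/4) powr (1/e)" | "4 powr (1/e) \<le> s" using s by force
  hence "s powr e \<notin> {1/4<..<4}"
  proof cases
    case 1
    hence "s powr e \<le> ((1/4) powr (1/e)) powr e" using True e by (intro powr_mono2) auto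
    also have "\<dots> = 1/4" using e by (simp add: powr_powr)
    finally show ?thesis by simp
  next
    case 2
    hence "(4 powr (1/e)) powr e \<le> s powr e" using True e by (intro powr_mono2) auto
    moreover have "(4 powr (1/e)) powr e = 4" using e by (simp add: powr_powr)
    ultimately show ?thesis by simp
  qed
  thus ?thesis using \<rho> by (simp add: root_bump_def)
qed (simp add: root_bump_def)

lemma root_bump_derivative:
  assumes e: "e > 0" and \<rho>: "\<And>t. t \<notin> {1/4<..<4} \<Longrightarrow> \<rho> t = 0"
    and d: "\<And>t. (\<rho> has_real_derivative \<rho>' t) (at t)" and c: "continuous_on UNIV \<rho>'"
  shows "\<exists>\<psi>'. (\<forall>s. (root_bump e \<rho> has_real_derivative \<psi>' s) (at s)) \<and> continuous_on {(1/4) powr (1/e)..4 powr (1/e)} \<psi>'"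
proof -
  define c1 where "c1 = (1/4::real) powr (1/e)"
  have c1: "c1 > 0" by (simp add: c1_def)
  define F where "F s = \<rho>' (s powr e) * (e * s powr (e - 1)) * (e * s powr (e - 1)) + \<rho> (s powr e) * (e * ((e - 1) * s powr (e - 1 - 1)))" for s
  \<comment> \<open>Below \<open>c1\<close> the bump vanishes while \<open>F\<close> involves
    \<open>powr\<close> at possibly nonpositive arguments, so the formula is used only from
    \<open>c1\<close> on.\<close>
  define \<psi>' where "\<psi>' s = (if s \<ge> c1 then F s else 0)" for s
  have cont_\<rho>: "continuous_on UNIV \<rho>" by (rule DERIV_continuous_on[OF has_field_derivative_at_within[OF d]])
  have "(root_bump e \<rho> has_real_derivative \<psi>' s) (at s)" for s
  proof (cases "s \<ge> c1")
    case True
    hence s0: "s > 0" using c1 by linarith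
    have p: "((\<lambda>s. s powr b) has_real_derivative b * s powr (b - 1)) (at s)" for b
      using s0 by (auto intro!: derivative_eq_intros)
    have "((\<lambda>s. \<rho> (s powr e) * (e * s powr (e - 1))) has_real_derivative \<rho>' (s powr e) * (e * s powr (e - 1)) * (e * s powr (e - 1)) + e * ((e - 1) * s powr (e - 1 - 1)) * \<rho> (s powr e)) (at s)"
      by (intro DERIV_mult DERIV_cmult DERIV_chain2[OF d] p)
    hence "((\<lambda>s. \<rho> (s powr e) * (e * s powr (e - 1))) has_real_derivative \<psi>' s) (at s)"
      using True by (simp add: \<psi>'_def F_def mult_ac)
    thus ?thesis
      by (rule has_field_derivative_transform_within_open[where S="{0<..}"]) (use s0 in \<open>auto simp: root_bump_def\<close>)
  next
    case False
    have "((\<lambda>_. 0) has_real_derivative \<psi>' s) (at s)" using False by (simp add: \<psi>'_def)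
    thus ?thesis
    proof (rule has_field_derivative_transform_within_open[where S="{..<c1}"])
      show "0 = root_bump e \<rho> x" if "x \<in> {..<c1}" for x
        by (rule root_bump_zero[where \<rho>=\<rho>, OF e \<rho>, symmetric]) (use that in \<open>auto simp: c1_def\<close>)
    qed (use False in auto)
  qed
  moreover have "continuous_on {c1..4 powr (1/e)} \<psi>'"
  proof (rule continuous_on_eq[where f=F])
    have ne: "s \<noteq> 0" if "s \<in> {c1..4 powr (1/e)}" for s using that c1 by auto
    have pc: "continuous_on {c1..4 powr (1/e)} (\<lambda>s. s powr b)" for b
      using ne by (intro continuous_intros) auto
    show "continuous_on {c1..4 powr (1/e)} F"
      unfolding F_def
      by (intro continuous_intros pc continuous_on_compose2[OF c pc] continuous_on_compose2[OF cont_\<rho> pc]) auto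
  qed (simp add: \<psi>'_def)
  ultimately show ?thesis unfolding c1_def by blast
qed

text \<open>For negative j the slow variable is shifted by N t^d. With s = t^d its shift becomes
  linear in s, as in \<open>curve_form\<close>, and the curvature moves to the other factor with
  exponent 1/d.\<close>

lemma LINT_root_substitution:
  fixes G :: "real \<Rightarrow> complex"
  assumes e: "e > 0" and \<rho>: "\<And>t. t \<notin> {1/4<..<4} \<Longrightarrow> \<rho> t = 0" and c: "continuous_on UNIV \<rho>" and G: "continuous_on UNIV G"
  shows "(LINT t|lborel. G t * of_real (\<rho> t)) = (LINT s|lborel. G (s powr e) * of_real (root_bump e \<rho> s))"
proof -
  define c1 where "c1 = (1/4::real) powr (1/e)"
  define c2 where "c2 = (4::real) powr (1/e)"
  have c1: "c1 > 0" by (simp add: c1_def)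
  have c12: "c1 \<le> c2" unfolding c1_def c2_def using e by (intro powr_mono2) auto
  have ends: "c1 powr e = 1/4" "c2 powr e = 4" using e by (simp_all add: c1_def c2_def powr_powr)
  let ?f = "\<lambda>t. G t * complex_of_real (\<rho> t)"
  have cf: "continuous_on S ?f" for S
    by (intro continuous_intros continuous_on_subset[OF G] continuous_on_subset[OF c]) auto
  have "(LINT t|lborel. ?f t) = integral {1/4..4} ?f"
    by (rule LINT_eq_integral_Icc_on[OF cf]) (auto intro!: \<rho>)
  also have "\<dots> = integral {c1 powr e..c2 powr e} ?f" by (simp only: ends)
  also have "\<dots> = integral {c1..c2} (\<lambda>s. (e * s powr (e - 1)) *\<^sub>R ?f (s powr e))"
  proof (rule integral_unique[symmetric], rule has_integral_substitution[OF c12, where c="1/4" and d=4])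
    show "c1 powr e \<le> c2 powr e" by (simp add: ends)
    show "(\<lambda>s. s powr e) ` {c1..c2} \<subseteq> {1/4..4}"
    proof (rule image_subsetI)
      fix s assume s: "s \<in> {c1..c2}"
      hence "c1 powr e \<le> s powr e" "s powr e \<le> c2 powr e" using c1 e by (auto intro!: powr_mono2)
      thus "s powr e \<in> {1/4..4}" by (simp add: ends)
    qed
    show "continuous_on {1/4..4} ?f" by (rule cf)
    show "((\<lambda>s. s powr e) has_real_derivative e * s powr (e - 1)) (at s within {c1..c2})" if "s \<in> {c1..c2}" for s
      using that c1 by (auto intro!: derivative_eq_intros)
  qed
  also have "\<dots> = integral {c1..c2} (\<lambda>s. G (s powr e) * of_real (root_bump e \<rho> s))"
    by (rule integral_cong) (use c1 in \<open>auto simp: root_bump_def scaleR_conv_of_real mult_ac\<close>)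
  also have "\<dots> = (LINT s|lborel. G (s powr e) * of_real (root_bump e \<rho> s))"
  proof (rule LINT_eq_integral_Icc_on[symmetric])
    have ne: "s \<noteq> 0" if "s \<in> {c1..c2}" for s using that c1 by auto
    have pc: "continuous_on {c1..c2} (\<lambda>s. s powr b)" for b
      using ne by (intro continuous_intros) auto
    have "continuous_on {c1..c2} (\<lambda>s. G (s powr e) * of_real (\<rho> (s powr e) * (e * s powr (e - 1))))"
      by (intro continuous_intros pc continuous_on_compose2[OF c pc] continuous_on_compose2[OF G pc]) auto
    thus "continuous_on {c1..c2} (\<lambda>s. G (s powr e) * of_real (root_bump e \<rho> s))"
      by (rule continuous_on_eq) (use c1 in \<open>auto simp: root_bump_def\<close>)
    show "G (s powr e) * of_real (root_bump e \<rho> s) = 0" if "s \<notin> {c1..c2}" for s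
      using root_bump_zero[where \<rho>=\<rho> and s=s, OF e \<rho>] that by (auto simp: c1_def c2_def)
  qed
  finally show ?thesis .
qed

text \<open>As \<rho> lives on the positive half-line, its odd extension is \<rho>(t) - \<rho>(-t)
  for every t, including 0.\<close>

lemma LINT_rho_of:
  fixes F :: "real \<Rightarrow> complex"
  assumes \<rho>: "\<And>t. t \<notin> {1/4<..<4} \<Longrightarrow> \<rho> t = 0" and c: "continuous_on UNIV \<rho>" and F: "continuous_on UNIV F"
  shows "(LINT t|lborel. F t * of_real (rho_of \<rho> t)) = (LINT t|lborel. F t * of_real (\<rho> t)) - (LINT t|lborel. F (- t) * of_real (\<rho> t))"
proof -
  have i: "integrable lborel (\<lambda>t. G t * complex_of_real (\<rho> t))" if "continuous_on UNIV G" for G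
    by (rule integrable_continuous_compact_support[where S="{1/4..4}"])
       (use \<rho> in \<open>auto intro!: continuous_intros that c\<close>)
  have F': "continuous_on UNIV (\<lambda>t. F (- t))" by (rule continuous_on_compose2[OF F]) (auto intro!: continuous_intros)
  have i': "integrable lborel (\<lambda>t. F t * complex_of_real (\<rho> (- t)))"
    using integrable_reflect_shift[OF i[OF F'], of 0] by simp
  have r: "rho_of \<rho> t = \<rho> t - \<rho> (- t)" for t using \<rho>[of t] \<rho>[of "-t"] by (auto simp: rho_of_def)
  have "(LINT t|lborel. F t * of_real (rho_of \<rho> t)) = (LINT t|lborel. F t * of_real (\<rho> t) - F t * of_real (\<rho> (- t)))"
    by (simp add: r algebra_simps)
  also have "\<dots> = (LINT t|lborel. F t * of_real (\<rho> t)) - (LINT t|lborel. F t * of_real (\<rho> (- t)))"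
    by (rule Bochner_Integration.integral_diff[OF i[OF F] i'])
  also have "(LINT t|lborel. F t * of_real (\<rho> (- t))) = (LINT t|lborel. F (- t) * of_real (\<rho> t))"
    using LINT_reflect_shift[of "\<lambda>t. F t * complex_of_real (\<rho> (- t))" 0] by simp
  finally show ?thesis .
qed

text \<open>Here s will be \<open>sqrt A\<close>, which cancels the 1 / sqrt A in
  \<open>curve_bound\<close>; the factor 2 counts the two halves of the t-line.\<close>

lemma L1_norm_difference_le:
  assumes B: "\<And>x. B x = of_real s * (I1 x - I2 x)" and s: "s > 0"
    and [measurable]: "I1 \<in> borel_measurable borel" "I2 \<in> borel_measurable borel"
    and I1: "L1_norm I1 \<le> ennreal (E / s)"
    and I2: "L1_norm I2 \<le> ennreal (E / s)" and E: "E \<ge> 0"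
  shows "L1_norm B \<le> ennreal (2 * E)"
proof -
  have "L1_norm B \<le> (\<integral>\<^sup>+x. ennreal s * (ennreal (norm (I1 x)) + ennreal (norm (I2 x))) \<partial>lborel)"
    unfolding L1_norm_def[of B]
  proof (rule nn_integral_mono)
    fix x
    have "norm (B x) = s * norm (I1 x - I2 x)" using s by (simp add: B norm_mult)
    also have "\<dots> \<le> s * (norm (I1 x) + norm (I2 x))" using s by (intro mult_left_mono norm_triangle_ineq4) auto
    finally have "ennreal (norm (B x)) \<le> ennreal (s * (norm (I1 x) + norm (I2 x)))" by (rule ennreal_leI)
    thus "ennreal (norm (B x)) \<le> ennreal s * (ennreal (norm (I1 x)) + ennreal (norm (I2 x)))"
      using s by (simp add: ennreal_mult ennreal_plus)
  qed
  also have "\<dots> = ennreal s * (L1_norm I1 + L1_norm I2)"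
    by (simp add: L1_norm_def nn_integral_cmult nn_integral_add)
  also have "\<dots> \<le> ennreal s * (ennreal (E / s) + ennreal (E / s))"
    by (intro mult_left_mono add_mono I1 I2) simp
  also have "\<dots> = ennreal (2 * E)"
    using s E by (simp add: ennreal_mult[symmetric] ennreal_plus[symmetric] del: ennreal_plus)
  finally show ?thesis .
qed

lemma measurable_curve_form [measurable]:
  assumes [measurable]: "P \<in> borel_measurable borel" "Q \<in> borel_measurable borel" "\<psi> \<in> borel_measurable borel"
  shows "curve_form a \<psi> \<tau> \<sigma> A N P Q \<in> borel_measurable borel"
  unfolding curve_form_def[abs_def] by measurable

text \<open>Replacing t by -t on the negative half gives the signs \<tau> = -1 and \<sigma> =
  (-1)^d. The powers \<open>t ^ d\<close> and \<open>t powr d\<close> agree where the weight is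
  nonzero, since t > 0 there.\<close>

lemma B_op_nonneg_eq:
  assumes d: "d \<ge> 2" and j: "j \<ge> 0" and \<rho>: "\<And>t. t \<notin> {1/4<..<4} \<Longrightarrow> \<rho> t = 0" and c: "continuous_on UNIV \<rho>"
    and P: "continuous_on UNIV (R_Phi \<Theta> f)" and Q: "continuous_on UNIV (R_Phi \<Theta> g)"
    and A: "A = 2 powr (- (real d - 1) * real_of_int j)"
  shows "B_op d \<rho> \<Theta> j m f g x = of_real (sqrt A) *
    (curve_form d \<rho> 1 1 A (2 ^ m) (R_Phi \<Theta> f) (R_Phi \<Theta> g) x - curve_form d \<rho> (-1) ((-1) ^ d) A (2 ^ m) (R_Phi \<Theta> f) (R_Phi \<Theta> g) x)"
proof -
  let ?P = "R_Phi \<Theta> f" and ?Q = "R_Phi \<Theta> g" and ?N = "2 ^ m :: real"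
  have s: "2 powr (- (real d - 1) * real_of_int j / 2) = sqrt A"
    unfolding A by (simp add: powr_half_sqrt[symmetric] powr_powr)
  have F: "continuous_on UNIV (\<lambda>t. ?P (A * x - ?N * t) * ?Q (x - ?N * t ^ d))"
    by (intro continuous_intros continuous_on_compose2[OF P] continuous_on_compose2[OF Q]) auto
  have pd: "t ^ d = t powr real d" if "\<rho> t \<noteq> 0" for t
  proof -
    have "t \<in> {1/4<..<4}" using \<rho>[of t] that by blast
    thus ?thesis by (simp add: powr_realpow)
  qed
  have "(LINT t|lborel. ?P (A * x - ?N * t) * ?Q (x - ?N * t ^ d) * of_real (\<rho> t)) = curve_form d \<rho> 1 1 A ?N ?P ?Q x"
    unfolding curve_form_def
    by (rule Bochner_Integration.integral_cong[OF refl]) (use pd in auto)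
  moreover have "(LINT t|lborel. ?P (A * x - ?N * - t) * ?Q (x - ?N * (- t) ^ d) * of_real (\<rho> t)) = curve_form d \<rho> (-1) ((-1) ^ d) A ?N ?P ?Q x"
    unfolding curve_form_def
  proof (rule Bochner_Integration.integral_cong[OF refl])
    fix t
    have "(- t) ^ d = (-1) ^ d * t powr real d" if "\<rho> t \<noteq> 0"
      using pd[OF that] power_minus[of t d] by simp
    thus "?P (A * x - ?N * - t) * ?Q (x - ?N * (- t) ^ d) * of_real (\<rho> t) = ?P (A * x - -1 * ?N * t) * ?Q (x - (-1) ^ d * ?N * t powr real d) * of_real (\<rho> t)"
      by (cases "\<rho> t = 0") (simp_all add: mult_ac)
  qed
  moreover have "(LINT t|lborel. ?P (A * x - ?N * t) * ?Q (x - ?N * t ^ d) * of_real (rho_of \<rho> t)) =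
      (LINT t|lborel. ?P (A * x - ?N * t) * ?Q (x - ?N * t ^ d) * of_real (\<rho> t)) -
      (LINT t|lborel. ?P (A * x - ?N * - t) * ?Q (x - ?N * (- t) ^ d) * of_real (\<rho> t))"
    by (rule LINT_rho_of[OF _ c F]) (rule \<rho>)
  ultimately show ?thesis
    using j by (simp only: B_op_def if_True s A[symmetric])
qed

text \<open>Now g carries the slow variable and f the fast one, so they trade places in
  \<open>curve_form\<close>; after s = t^d the sign (-1)^d belongs to the slow factor.\<close>

lemma B_op_neg_eq:
  assumes d: "d \<ge> 2" and j: "j < 0" and \<rho>: "\<And>t. t \<notin> {1/4<..<4} \<Longrightarrow> \<rho> t = 0" and c: "continuous_on UNIV \<rho>"
    and P: "continuous_on UNIV (R_Phi \<Theta> f)" and Q: "continuous_on UNIV (R_Phi \<Theta> g)"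
    and A: "A = 2 powr ((real d - 1) * real_of_int j)"
  shows "B_op d \<rho> \<Theta> j m f g x = of_real (sqrt A) *
    (curve_form (1/d) (root_bump (1/d) \<rho>) 1 1 A (2 ^ m) (R_Phi \<Theta> g) (R_Phi \<Theta> f) x -
     curve_form (1/d) (root_bump (1/d) \<rho>) ((-1) ^ d) (-1) A (2 ^ m) (R_Phi \<Theta> g) (R_Phi \<Theta> f) x)"
proof -
  let ?P = "R_Phi \<Theta> f" and ?Q = "R_Phi \<Theta> g" and ?N = "2 ^ m :: real" and ?e = "1 / real d"
  have e: "?e > 0" using d by simp
  have s: "2 powr ((real d - 1) * real_of_int j / 2) = sqrt A"
    unfolding A by (simp add: powr_half_sqrt[symmetric] powr_powr)
  have F: "continuous_on UNIV (\<lambda>t. ?P (x - ?N * t) * ?Q (A * x - ?N * t ^ d))"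
    by (intro continuous_intros continuous_on_compose2[OF P] continuous_on_compose2[OF Q]) auto
  have F': "continuous_on UNIV (\<lambda>t. ?P (x - ?N * - t) * ?Q (A * x - ?N * (- t) ^ d))"
    by (intro continuous_intros continuous_on_compose2[OF P] continuous_on_compose2[OF Q]) auto
  have pd: "(s powr ?e) ^ d = s" if "root_bump ?e \<rho> s \<noteq> 0" for s
  proof -
    have "s > 0" using that by (auto simp: root_bump_def split: if_splits)
    thus ?thesis using d by (simp add: powr_power)
  qed
  have sub: "(LINT t|lborel. ?P (x - ?N * t) * ?Q (A * x - ?N * t ^ d) * of_real (\<rho> t)) =
      (LINT s|lborel. ?P (x - ?N * s powr ?e) * ?Q (A * x - ?N * (s powr ?e) ^ d) * of_real (root_bump ?e \<rho> s))"
    by (rule LINT_root_substitution[OF e _ c F]) (rule \<rho>)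
  have sub': "(LINT t|lborel. ?P (x - ?N * - t) * ?Q (A * x - ?N * (- t) ^ d) * of_real (\<rho> t)) =
      (LINT s|lborel. ?P (x - ?N * - (s powr ?e)) * ?Q (A * x - ?N * (- (s powr ?e)) ^ d) * of_real (root_bump ?e \<rho> s))"
    by (rule LINT_root_substitution[OF e _ c F']) (rule \<rho>)
  have "(LINT t|lborel. ?P (x - ?N * t) * ?Q (A * x - ?N * t ^ d) * of_real (\<rho> t)) = curve_form ?e (root_bump ?e \<rho>) 1 1 A ?N ?Q ?P x"
    unfolding curve_form_def
  proof (rule trans[OF sub], rule Bochner_Integration.integral_cong[OF refl])
    fix s
    show "?P (x - ?N * s powr ?e) * ?Q (A * x - ?N * (s powr ?e) ^ d) * of_real (root_bump ?e \<rho> s) =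
       ?Q (A * x - 1 * ?N * s) * ?P (x - 1 * ?N * s powr ?e) * of_real (root_bump ?e \<rho> s)"
      using pd[of s] by (cases "root_bump ?e \<rho> s = 0") (simp_all add: mult_ac)
  qed
  moreover have "(LINT t|lborel. ?P (x - ?N * - t) * ?Q (A * x - ?N * (- t) ^ d) * of_real (\<rho> t)) = curve_form ?e (root_bump ?e \<rho>) ((-1) ^ d) (-1) A ?N ?Q ?P x"
    unfolding curve_form_def
  proof (rule trans[OF sub'], rule Bochner_Integration.integral_cong[OF refl])
    fix s
    have "(- (s powr ?e)) ^ d = (-1) ^ d * s" if "root_bump ?e \<rho> s \<noteq> 0"
      using pd[OF that] power_minus[of "s powr ?e" d] by simp
    thus "?P (x - ?N * - (s powr ?e)) * ?Q (A * x - ?N * (- (s powr ?e)) ^ d) * of_real (root_bump ?e \<rho> s) =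
       ?Q (A * x - (-1) ^ d * ?N * s) * ?P (x - -1 * ?N * s powr ?e) * of_real (root_bump ?e \<rho> s)"
      by (cases "root_bump ?e \<rho> s = 0") (simp_all add: mult_ac)
  qed
  moreover have "(LINT t|lborel. ?P (x - ?N * t) * ?Q (A * x - ?N * t ^ d) * of_real (rho_of \<rho> t)) =
      (LINT t|lborel. ?P (x - ?N * t) * ?Q (A * x - ?N * t ^ d) * of_real (\<rho> t)) -
      (LINT t|lborel. ?P (x - ?N * - t) * ?Q (A * x - ?N * (- t) ^ d) * of_real (\<rho> t))"
    by (rule LINT_rho_of[OF _ c F]) (rule \<rho>)
  ultimately show ?thesis
    using j by (simp only: B_op_def not_le[symmetric] if_False s A[symmetric])
qed

theorem theorem5p2:
  fixes d :: nat and \<rho>1 \<Theta> :: "real \<Rightarrow> real"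
  assumes "d \<ge> 2"
    and "smooth_fun \<rho>1" and "supp_fun \<rho>1 \<subseteq> {1/2..2}"
    and "smooth_fun \<Theta>" and "supp_fun \<Theta> \<subseteq> {-1<..<1}"
    and "\<forall>x. \<bar>x\<bar> \<le> 1/2 \<longrightarrow> \<Theta> x = 1"
  shows "\<exists>\<epsilon>0 C. \<epsilon>0 > 0 \<and>
    (\<forall>(j::int) (m::nat). \<bar>real_of_int j\<bar> \<ge> real m / (real d - 1) \<longrightarrow>
      (\<forall>f g. in_L2 f \<longrightarrow> in_L2 g \<longrightarrow>
         L1_norm (B_op d \<rho>1 \<Theta> j m f g) \<le>
           ennreal (C * max (2 powr ((real m - (real d - 1) * \<bar>real_of_int j\<bar>) / 3))
                             (2 powr (- \<epsilon>0 * real m)) * L2_norm f * L2_norm g)))"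
proof -
  note d2 = assms(1) and \<Theta> = assms(4-6)
  define e where "e = 1 / real d"
  have e: "e > 0" "e \<noteq> 1" "1 / e = real d" using d2 by (auto simp: e_def)
  note d\<rho> = smooth_fun_derivatives[OF assms(2)]
  \<comment> \<open>The support lies in [1/2, 2]. A larger open interval is used so that the weight
    vanishes at the ends as well, as the integration by parts requires.\<close>
  have \<rho>0: "\<rho>1 t = 0" if "t \<notin> {1/4<..<4}" for t
    by (rule zero_outside_supp_fun[of t \<rho>1]) (use subsetD[OF assms(3), of t] that in auto)
  have c\<rho>: "continuous_on UNIV \<rho>1" by (rule DERIV_continuous_on[OF has_field_derivative_at_within[OF d\<rho>(1)]])
  obtain \<psi>' where \<psi>': "\<And>s. (root_bump e \<rho>1 has_real_derivative \<psi>' s) (at s)" "continuous_on {(1/4) powr (1/e)..4 powr (1/e)} \<psi>'"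
    using root_bump_derivative[where \<rho>=\<rho>1, OF e(1) \<rho>0 d\<rho>(1) d\<rho>(4)] by blast
  have c\<psi>: "continuous_on UNIV (root_bump e \<rho>1)" by (rule DERIV_continuous_on[OF has_field_derivative_at_within[OF \<psi>'(1)]])
  have [measurable]: "\<rho>1 \<in> borel_measurable borel" "root_bump e \<rho>1 \<in> borel_measurable borel"
    by (intro borel_measurable_continuous_onI c\<rho> c\<psi>)+
  have "\<exists>K\<ge>0. \<forall>\<tau>\<in>{1,-1}. \<forall>\<sigma>\<in>{1,-1}. curve_bound (real d) \<rho>1 \<tau> \<sigma> K"
    by (rule curve_form_bound_signs[where ?c1.0="1/4" and ?c2.0=4, OF _ _ _ _ d\<rho>(1) _ \<rho>0 \<Theta>])
       (use d2 in \<open>auto intro: continuous_on_subset[OF d\<rho>(4)]\<close>)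
  then obtain K1 where K1: "K1 \<ge> 0" "\<And>\<tau> \<sigma>. \<tau> \<in> {1,-1} \<Longrightarrow> \<sigma> \<in> {1,-1} \<Longrightarrow> curve_bound (real d) \<rho>1 \<tau> \<sigma> K1"
    by blast
  have pw: "(1/4::real) powr (1/e) < 4 powr (1/e)" using e(1) by (intro powr_less_mono2) simp_all
  have "\<exists>K\<ge>0. \<forall>\<tau>\<in>{1,-1}. \<forall>\<sigma>\<in>{1,-1}. curve_bound e (root_bump e \<rho>1) \<tau> \<sigma> K"
    by (rule curve_form_bound_signs[OF e(1,2) _ pw \<psi>' root_bump_zero[where \<rho>=\<rho>1, OF e(1) \<rho>0] \<Theta>]) simp_all
  then obtain K2 where K2: "K2 \<ge> 0" "\<And>\<tau> \<sigma>. \<tau> \<in> {1,-1} \<Longrightarrow> \<sigma> \<in> {1,-1} \<Longrightarrow> curve_bound e (root_bump e \<rho>1) \<tau> \<sigma> K2"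
    by blast
  obtain CR where CR: "CR \<ge> 0" "\<And>f. in_L2 f \<Longrightarrow> tame (R_Phi \<Theta> f) (CR * L2_norm f)"
    using R_Phi_regularity[OF \<Theta>] by blast
  \<comment> \<open>The 2 counts the halves of the t-line, \<open>K1\<close> and \<open>K2\<close>
    serve the two signs of j, and each of f and g brings one factor \<open>CR\<close>.\<close>
  define C where "C = 2 * (K1 + K2) * CR\<^sup>2"
  have C0: "C \<ge> 0" using K1(1) K2(1) by (simp add: C_def)
  have "L1_norm (B_op d \<rho>1 \<Theta> j m f g) \<le> ennreal (C * max (2 powr ((real m - (real d - 1) * \<bar>real_of_int j\<bar>) / 3))
        (2 powr (- (1/8) * real m)) * L2_norm f * L2_norm g)"
    if j: "\<bar>real_of_int j\<bar> \<ge> real m / (real d - 1)" and f: "in_L2 f" and g: "in_L2 g" for j :: int and m f g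
  proof -
    define A where "A = 2 powr (- (real d - 1) * \<bar>real_of_int j\<bar>)"
    define N where "N = (2::real) ^ m"
    define n where "n = N powr (-1/8)"
    have A: "A > 0" by (simp add: A_def)
    have N: "N \<ge> 1" by (simp add: N_def)
    have Np: "N = 2 powr real m" by (simp add: N_def powr_realpow)
    have n: "n = 2 powr (- (1/8) * real m)" by (simp add: n_def Np powr_powr)
    have n0: "n \<ge> 0" by (simp add: n_def)
    \<comment> \<open>The condition on j is the same as A N <= 1.\<close>
    have "real m \<le> (real d - 1) * \<bar>real_of_int j\<bar>" using j d2 by (simp add: divide_le_eq mult.commute)
    hence "A * N \<le> 2 powr 0" unfolding A_def Np powr_add[symmetric] by (intro powr_mono) (auto simp: left_diff_distrib)
    hence AN: "A * N \<le> 1" by simp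
    note tf = CR(2)[OF f] and tg = CR(2)[OF g]
    have [measurable]: "R_Phi \<Theta> f \<in> borel_measurable borel" "R_Phi \<Theta> g \<in> borel_measurable borel"
      by (intro borel_measurable_continuous_onI tame_continuous[OF tf] tame_continuous[OF tg])+
    define E where "E K = K * n * (CR * L2_norm f) * (CR * L2_norm g)" for K
    have E0: "E K \<ge> 0" if "K \<ge> 0" for K using that n0 CR(1) by (simp add: E_def)
    have sg: "(-1::real) ^ d \<in> {1,-1}" "(1::real) \<in> {1,-1}" "(-1::real) \<in> {1,-1}" by (auto simp: minus_one_power_iff)
    have sA: "sqrt A > 0" using A by simp
    have "L1_norm (B_op d \<rho>1 \<Theta> j m f g) \<le> ennreal (2 * E (K1 + K2))"
    proof (cases "j \<ge> 0")
      case True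
      hence A_eq: "A = 2 powr (- (real d - 1) * real_of_int j)" by (simp add: A_def)
      have bd: "L1_norm (curve_form (real d) \<rho>1 \<tau> \<sigma> A N (R_Phi \<Theta> f) (R_Phi \<Theta> g)) \<le> ennreal (E K1 / sqrt A)"
        if "\<tau> \<in> {1,-1}" "\<sigma> \<in> {1,-1}" for \<tau> \<sigma>
        using K1(2)[OF that, unfolded curve_bound_def, rule_format, OF N A AN tf tg] by (simp add: E_def n_def)
      have "L1_norm (B_op d \<rho>1 \<Theta> j m f g) \<le> ennreal (2 * E K1)"
      proof (rule L1_norm_difference_le[OF _ sA _ _ bd[OF sg(2) sg(2)] bd[OF sg(3) sg(1)] E0[OF K1(1)]])
        show "B_op d \<rho>1 \<Theta> j m f g x = of_real (sqrt A) * (curve_form d \<rho>1 1 1 A N (R_Phi \<Theta> f) (R_Phi \<Theta> g) x -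
            curve_form d \<rho>1 (-1) ((-1) ^ d) A N (R_Phi \<Theta> f) (R_Phi \<Theta> g) x)" for x
          unfolding N_def
          by (rule B_op_nonneg_eq[OF d2 True _ c\<rho> tame_continuous[OF tf] tame_continuous[OF tg] A_eq]) (rule \<rho>0)
      qed measurable
      also have "\<dots> \<le> ennreal (2 * E (K1 + K2))"
        unfolding E_def using K2(1) n0 CR(1) by (intro ennreal_leI mult_left_mono mult_right_mono) auto
      finally show ?thesis .
    next
      case False
      hence j0: "j < 0" by simp
      hence A_eq: "A = 2 powr ((real d - 1) * real_of_int j)" by (simp add: A_def left_diff_distrib)
      have bd: "L1_norm (curve_form e (root_bump e \<rho>1) \<tau> \<sigma> A N (R_Phi \<Theta> g) (R_Phi \<Theta> f)) \<le> ennreal (E K2 / sqrt A)"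
        if "\<tau> \<in> {1,-1}" "\<sigma> \<in> {1,-1}" for \<tau> \<sigma>
        using K2(2)[OF that, unfolded curve_bound_def, rule_format, OF N A AN tg tf] by (simp add: E_def n_def mult_ac)
      have "L1_norm (B_op d \<rho>1 \<Theta> j m f g) \<le> ennreal (2 * E K2)"
      proof (rule L1_norm_difference_le[OF _ sA _ _ bd[OF sg(2) sg(2)] bd[OF sg(1) sg(3)] E0[OF K2(1)]])
        show "B_op d \<rho>1 \<Theta> j m f g x = of_real (sqrt A) * (curve_form e (root_bump e \<rho>1) 1 1 A N (R_Phi \<Theta> g) (R_Phi \<Theta> f) x -
            curve_form e (root_bump e \<rho>1) ((-1) ^ d) (-1) A N (R_Phi \<Theta> g) (R_Phi \<Theta> f) x)" for x
          unfolding N_def e_def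
          by (rule B_op_neg_eq[OF d2 j0 _ c\<rho> tame_continuous[OF tf] tame_continuous[OF tg] A_eq]) (rule \<rho>0)
      qed measurable
      also have "\<dots> \<le> ennreal (2 * E (K1 + K2))"
        unfolding E_def using K1(1) n0 CR(1) by (intro ennreal_leI mult_left_mono mult_right_mono) auto
      finally show ?thesis .
    qed
    also have "2 * E (K1 + K2) = C * n * L2_norm f * L2_norm g"
      by (simp add: E_def C_def power2_eq_square mult_ac)
    \<comment> \<open>\<open>n\<close> equals 2^(-m/8), the second entry of the maximum.\<close>
    also have "ennreal (C * n * L2_norm f * L2_norm g) \<le> ennreal (C * max (2 powr ((real m - (real d - 1) * \<bar>real_of_int j\<bar>) / 3))
        (2 powr (- (1/8) * real m)) * L2_norm f * L2_norm g)"
      unfolding n by (intro ennreal_leI mult_right_mono mult_left_mono C0) auto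
    finally show ?thesis .
  qed
  thus ?thesis by (intro exI[of _ "1/8"] exI[of _ C]) auto
qed


end
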